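(* Let $n\geq 1$, let $T$ be an $n$-dependent theory with monster model $\mathbb{M}$, let $A\subseteq\mathbb{M}$ be a small set of parameters and let $G=G(\mathbb{M})$ be a group type-definable over $A$. Let $\mathcal{M}\supseteq A$ be a small model (a small elementary submodel of $\mathbb{M}$) and $\bar b_1,\ldots,\bar b_{n-1}$ finite tuples in $\mathbb{M}$ such that $(\mathcal{M},A,\bar b_1,\ldots,\bar b_{n-1})$ are in a generic position. Let $(H_\alpha:\alpha\in I)$ be any family of subgroups of $G$ of bounded index, with each $H_\alpha$ type-definable over $\mathcal{M}\bar b_1\ldots\bar b_{n-1}$. Then there is some $J\subseteq I$ with $|J|\leq\beth_2(|T|+|A|)$ such that $$\bigcap_{\alpha\in I}H_\alpha\cap\bigcap_{i=1,\ldots,n-1}G^{00}_{\mathcal{M}\cup\bar b_1\cup\ldots\cup\bar b_{i-1}\cup\bar b_{i+1}\cup\ldots\cup\bar b_{n-1}}=\bigcap_{\alpha\in J}H_\alpha\cap\bigcap_{i=1,\ldots,n-1}G^{00}_{\mathcal{M}\cup\bar b_1\cup\ldots\cup\bar b_{i-1}\cup\bar b_{i+1}\cup\ldots\cup\bar b_{n-1}}.$$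
   Context: Monster model: $\mathbb{M}\models T$ is $\kappa(\mathbb M)$-saturated and $\kappa(\mathbb M)$-homogeneous for some sufficiently large strongly inaccessible cardinal $\kappa(\mathbb{M})$; "small" means of cardinality $<\kappa(\mathbb{M})$, and a subgroup has bounded index if its index is small. $T$ is complete. $n$-dependence: a partitioned formula $\varphi(x;y_1,\ldots,y_n)$ (variables are finite tuples) has the $n$-independence property with respect to $T$ if in some model of $T$ there is a sequence of tuples $(a_{1,i},\ldots,a_{n,i})_{i\in\omega}$ such that for every $s\subseteq\omega^n$ there is a tuple $b_s$ with $\models\varphi(b_s;a_{1,i_1},\ldots,a_{n,i_n})\Leftrightarrow(i_1,\ldots,i_n)\in s$; otherwise it is $n$-dependent. $T$ is $n$-dependent if every formula is. For a small set $B$, $G^{00}_B$ is the intersection of all subgroups of $G$ that are type-definable over $B$ and of bounded index. An empty intersection of subgroups of $G$ is $G$. $\beth_0(\kappa)=\kappa$ and $\beth_{m+1}(\kappa)=2^{\beth_m(\kappa)}$. $\kappa$-coheirs: for a cardinal $\kappa$, a model $\mathcal{N}$, a tuple $a$ and a set $B$, write $a\perp^{u,\kappa}_{\mathcal{N}}B$ if for any set $C\subseteq B\cup\mathcal{N}$ of size $<\kappa$, $\mathrm{tp}(a/C)$ is realized in $\mathcal{N}$. Generic position: for a small model $\mathcal{M}$, a subset $A$ of $\mathcal M$ and finite tuples $\bar b_1,\ldots,\bar b_{n-1}$ in $\mathbb{M}$, $(\mathcal{M},A,\bar b_1,\ldots,\bar b_{n-1})$ are in a generic position if there exist regular cardinals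 $\kappa_1<\kappa_2<\ldots<\kappa_{n-1}$ and models $\mathcal{M}_0\preceq\mathcal{M}_1\preceq\ldots\preceq\mathcal{M}_{n-1}=\mathcal{M}$ such that $A\subseteq\mathcal{M}_0$, $\beth_2(|\mathcal{M}_i|)^+\leq\kappa_{i+1}$ for $i=0,\ldots,n-2$, and $\bar b_i\perp^{u,\kappa_i}_{\mathcal{M}_i}\bar b_{<i}\mathcal{M}_{n-1}$ for all $1\leq i\leq n-1$ (where $\bar b_{<i}=\bar b_1\ldots\bar b_{i-1}$). *)

theory Defs
  imports "HOL-Algebra.Coset"
begin

unbundle cardinal_syntax

section \<open>First-order logic with equality\<close>

text \<open>A language is a set of function symbols and a set of relation symbols, each a pair of a name
  and an arity.\<close>

record ('f, 'r) lang =
  funs :: "('f \<times> nat) set"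
  rels :: "('r \<times> nat) set"

datatype 'f tm = Var nat | Fun 'f "'f tm list"

datatype ('f, 'r) fm =
    Eq "'f tm" "'f tm"
  | Rel 'r "'f tm list"
  | Neg "('f, 'r) fm"
  | Conj "('f, 'r) fm" "('f, 'r) fm"
  | Exists nat "('f, 'r) fm"

fun wf_tm :: "('f, 'r) lang \<Rightarrow> 'f tm \<Rightarrow> bool" where
  "wf_tm L (Var i) \<longleftrightarrow> True"
| "wf_tm L (Fun f ts) \<longleftrightarrow> (f, length ts) \<in> funs L \<and> (\<forall>t\<in>set ts. wf_tm L t)"

fun wf_fm :: "('f, 'r) lang \<Rightarrow> ('f, 'r) fm \<Rightarrow> bool" where
  "wf_fm L (Eq s t) \<longleftrightarrow> wf_tm L s \<and> wf_tm L t"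
| "wf_fm L (Rel r ts) \<longleftrightarrow> (r, length ts) \<in> rels L \<and> (\<forall>t\<in>set ts. wf_tm L t)"
| "wf_fm L (Neg \<phi>) \<longleftrightarrow> wf_fm L \<phi>"
| "wf_fm L (Conj \<phi> \<psi>) \<longleftrightarrow> wf_fm L \<phi> \<and> wf_fm L \<psi>"
| "wf_fm L (Exists i \<phi>) \<longleftrightarrow> wf_fm L \<phi>"

fun fv_tm :: "'f tm \<Rightarrow> nat set" where
  "fv_tm (Var i) = {i}"
| "fv_tm (Fun f ts) = (\<Union>t\<in>set ts. fv_tm t)"

fun fv :: "('f, 'r) fm \<Rightarrow> nat set" where
  "fv (Eq s t) = fv_tm s \<union> fv_tm t"
| "fv (Rel r ts) = (\<Union>t\<in>set ts. fv_tm t)"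
| "fv (Neg \<phi>) = fv \<phi>"
| "fv (Conj \<phi> \<psi>) = fv \<phi> \<union> fv \<psi>"
| "fv (Exists i \<phi>) = fv \<phi> - {i}"

definition formulas :: "('f, 'r) lang \<Rightarrow> nat \<Rightarrow> ('f, 'r) fm set" where
  "formulas L k = {\<phi>. wf_fm L \<phi> \<and> fv \<phi> \<subseteq> {..<k}}"

abbreviation sentences :: "('f, 'r) lang \<Rightarrow> ('f, 'r) fm set" where
  "sentences L \<equiv> formulas L 0"

record ('a, 'f, 'r) fo_struct =
  universe :: "'a set"
  fun_int :: "'f \<Rightarrow> 'a list \<Rightarrow> 'a"
  rel_int :: "'r \<Rightarrow> 'a list \<Rightarrow> bool"

definition tuples :: "'a set \<Rightarrow> nat \<Rightarrow> 'a list set" where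
  "tuples X k = {x. length x = k \<and> set x \<subseteq> X}"

definition is_struct :: "('f, 'r) lang \<Rightarrow> ('a, 'f, 'r) fo_struct \<Rightarrow> bool" where
  "is_struct L M \<longleftrightarrow> universe M \<noteq> {} \<and>
     (\<forall>(f, k)\<in>funs L. \<forall>x\<in>tuples (universe M) k. fun_int M f x \<in> universe M)"

fun eval_tm :: "('a, 'f, 'r) fo_struct \<Rightarrow> (nat \<Rightarrow> 'a) \<Rightarrow> 'f tm \<Rightarrow> 'a" where
  "eval_tm M e (Var i) = e i"
| "eval_tm M e (Fun f ts) = fun_int M f (map (eval_tm M e) ts)"

fun sat :: "('a, 'f, 'r) fo_struct \<Rightarrow> (nat \<Rightarrow> 'a) \<Rightarrow> ('f, 'r) fm \<Rightarrow> bool" where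
  "sat M e (Eq s t) \<longleftrightarrow> eval_tm M e s = eval_tm M e t"
| "sat M e (Rel r ts) \<longleftrightarrow> rel_int M r (map (eval_tm M e) ts)"
| "sat M e (Neg \<phi>) \<longleftrightarrow> \<not> sat M e \<phi>"
| "sat M e (Conj \<phi> \<psi>) \<longleftrightarrow> sat M e \<phi> \<and> sat M e \<psi>"
| "sat M e (Exists i \<phi>) \<longleftrightarrow> (\<exists>a\<in>universe M. sat M (e(i := a)) \<phi>)"

text \<open>Variable \<open>i\<close> takes the \<open>i\<close>-th entry of the list as its value. This is only used for
  \<open>\<phi> \<in> formulas L (length x)\<close>, so that no out-of-range entry matters.\<close>

definition holds :: "('a, 'f, 'r) fo_struct \<Rightarrow> ('f, 'r) fm \<Rightarrow> 'a list \<Rightarrow> bool" where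
  "holds M \<phi> x \<longleftrightarrow> sat M (\<lambda>i. x ! i) \<phi>"

definition model :: "('f, 'r) lang \<Rightarrow> ('f, 'r) fm set \<Rightarrow> ('a, 'f, 'r) fo_struct \<Rightarrow> bool" where
  "model L T M \<longleftrightarrow> is_struct L M \<and> (\<forall>\<phi>\<in>T. holds M \<phi> [])"

text \<open>Complete theories are taken to be deductively closed; together with the existence of a model
  the following says that \<open>T\<close> is a maximal consistent set of sentences. Hence the cardinality
  \<open>|T|\<close> of the set \<open>T\<close> is that of the set of all formulas of the language, which is the usual
  meaning of \<open>|T|\<close>.\<close>

definition complete_theory :: "('f, 'r) lang \<Rightarrow> ('f, 'r) fm set \<Rightarrow> bool" where
  "complete_theory L T \<longleftrightarrow> T \<subseteq> sentences L \<and> (\<forall>\<phi>\<in>sentences L. \<phi> \<in> T \<or> Neg \<phi> \<in> T)"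

definition restrict_to :: "('a, 'f, 'r) fo_struct \<Rightarrow> 'a set \<Rightarrow> ('a, 'f, 'r) fo_struct"
    (infixl \<open>\<restriction>\<close> 100) where
  "M \<restriction> X = M\<lparr>universe := X\<rparr>"

text \<open>\<open>X\<close> and \<open>Y\<close> are universes of substructures of \<open>M\<close>, and the first is an elementary
  substructure of the second.\<close>

definition elem_sub ::
    "('f, 'r) lang \<Rightarrow> ('a, 'f, 'r) fo_struct \<Rightarrow> 'a set \<Rightarrow> 'a set \<Rightarrow> bool" where
  "elem_sub L M X Y \<longleftrightarrow> X \<subseteq> Y \<and> Y \<subseteq> universe M \<and> is_struct L (M \<restriction> X) \<and> is_struct L (M \<restriction> Y) \<and>
     (\<forall>k. \<forall>\<phi>\<in>formulas L k. \<forall>x\<in>tuples X k. holds (M \<restriction> X) \<phi> x \<longleftrightarrow> holds (M \<restriction> Y) \<phi> x)"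

abbreviation elem_submodel ::
    "('f, 'r) lang \<Rightarrow> ('a, 'f, 'r) fo_struct \<Rightarrow> 'a set \<Rightarrow> bool" where
  "elem_submodel L M X \<equiv> elem_sub L M X (universe M)"

section \<open>Types and type-definable sets\<close>

text \<open>A formula over \<open>C\<close> in the variables \<open>0, \<dots>, k - 1\<close> is represented by a formula without
  parameters and a finite tuple of parameters from \<open>C\<close> to be substituted for the variables
  \<open>k, k + 1, \<dots>\<close>\<close>

definition formulas_over ::
    "('f, 'r) lang \<Rightarrow> 'a set \<Rightarrow> nat \<Rightarrow> (('f, 'r) fm \<times> 'a list) set" where
  "formulas_over L C k = {(\<phi>, c). set c \<subseteq> C \<and> \<phi> \<in> formulas L (k + length c)}"

definition tp ::
    "('f, 'r) lang \<Rightarrow> ('a, 'f, 'r) fo_struct \<Rightarrow> 'a list \<Rightarrow> 'a set \<Rightarrow> (('f, 'r) fm \<times> 'a list) set" where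
  "tp L M a C = {(\<phi>, c) \<in> formulas_over L C (length a). holds M \<phi> (a @ c)}"

definition realizations ::
    "('a, 'f, 'r) fo_struct \<Rightarrow> nat \<Rightarrow> (('f, 'r) fm \<times> 'a list) set \<Rightarrow> 'a list set" where
  "realizations M k \<Sigma> = {x \<in> tuples (universe M) k. \<forall>(\<phi>, c)\<in>\<Sigma>. holds M \<phi> (x @ c)}"

definition type_definable ::
    "('f, 'r) lang \<Rightarrow> ('a, 'f, 'r) fo_struct \<Rightarrow> nat \<Rightarrow> 'a set \<Rightarrow> 'a list set \<Rightarrow> bool" where
  "type_definable L M k B X \<longleftrightarrow> (\<exists>\<Sigma>\<subseteq>formulas_over L B k. X = realizations M k \<Sigma>)"

section \<open>Monster models\<close>

abbreviation two_power :: "'c rel \<Rightarrow> ('c \<Rightarrow> bool) rel" where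
  "two_power r \<equiv> BNF_Cardinal_Arithmetic.cexp BNF_Cardinal_Arithmetic.ctwo r"

abbreviation beth2 :: "'c rel \<Rightarrow> (('c \<Rightarrow> bool) \<Rightarrow> bool) rel" where
  "beth2 r \<equiv> two_power (two_power r)"

definition regular_cardinal :: "'k rel \<Rightarrow> bool" where
  "regular_cardinal \<kappa> \<longleftrightarrow> Card_order \<kappa> \<and> infinite (Field \<kappa>) \<and> regularCard \<kappa>"

definition strongly_inaccessible :: "'k rel \<Rightarrow> bool" where
  "strongly_inaccessible \<kappa> \<longleftrightarrow> regular_cardinal \<kappa> \<and> natLeq <o \<kappa> \<and>
     (\<forall>\<mu>::'k rel. Card_order \<mu> \<and> \<mu> <o \<kappa> \<longrightarrow> two_power \<mu> <o \<kappa>)"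

definition saturated ::
    "('f, 'r) lang \<Rightarrow> 'k rel \<Rightarrow> ('a, 'f, 'r) fo_struct \<Rightarrow> bool" where
  "saturated L \<kappa> M \<longleftrightarrow>
     (\<forall>C k \<Sigma>. C \<subseteq> universe M \<and> |C| <o \<kappa> \<and> \<Sigma> \<subseteq> formulas_over L C k \<and>
        (\<forall>\<Sigma>0\<subseteq>\<Sigma>. finite \<Sigma>0 \<longrightarrow> realizations M k \<Sigma>0 \<noteq> {}) \<longrightarrow> realizations M k \<Sigma> \<noteq> {})"

definition partial_elementary ::
    "('f, 'r) lang \<Rightarrow> ('a, 'f, 'r) fo_struct \<Rightarrow> 'a set \<Rightarrow> ('a \<Rightarrow> 'a) \<Rightarrow> bool" where
  "partial_elementary L M C h \<longleftrightarrow> C \<subseteq> universe M \<and> h ` C \<subseteq> universe M \<and>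
     (\<forall>k. \<forall>\<phi>\<in>formulas L k. \<forall>c\<in>tuples C k. holds M \<phi> c \<longleftrightarrow> holds M \<phi> (map h c))"

definition automorphism ::
    "('f, 'r) lang \<Rightarrow> ('a, 'f, 'r) fo_struct \<Rightarrow> ('a \<Rightarrow> 'a) \<Rightarrow> bool" where
  "automorphism L M g \<longleftrightarrow> bij_betw g (universe M) (universe M) \<and>
     (\<forall>(f, k)\<in>funs L. \<forall>x\<in>tuples (universe M) k. g (fun_int M f x) = fun_int M f (map g x)) \<and>
     (\<forall>(r, k)\<in>rels L. \<forall>x\<in>tuples (universe M) k. rel_int M r x \<longleftrightarrow> rel_int M r (map g x))"

text \<open>Homogeneity is meant in the sense customary for monster models (sometimes called strong
  homogeneity): small partial elementary maps extend to automorphisms.\<close>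

definition homogeneous ::
    "('f, 'r) lang \<Rightarrow> 'k rel \<Rightarrow> ('a, 'f, 'r) fo_struct \<Rightarrow> bool" where
  "homogeneous L \<kappa> M \<longleftrightarrow>
     (\<forall>C h. |C| <o \<kappa> \<and> partial_elementary L M C h \<longrightarrow>
        (\<exists>g. automorphism L M g \<and> (\<forall>c\<in>C. g c = h c)))"

definition monster_model ::
    "('f, 'r) lang \<Rightarrow> ('f, 'r) fm set \<Rightarrow> 'k rel \<Rightarrow> ('a, 'f, 'r) fo_struct \<Rightarrow> bool" where
  "monster_model L T \<kappa> M \<longleftrightarrow> strongly_inaccessible \<kappa> \<and> |T| <o \<kappa> \<and> model L T M \<and>
     saturated L \<kappa> M \<and> homogeneous L \<kappa> M"

section \<open>\<open>n\<close>-dependence\<close>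

text \<open>In the partitioned formula \<open>\<phi>(x; y\<^sub>1, \<dots>, y\<^sub>n)\<close> the tuple \<open>x\<close> has length \<open>p\<close> and \<open>y\<^sub>j\<^sub>+\<^sub>1\<close> has
  length \<open>q ! j\<close>, so \<open>n = length q\<close>; \<open>a j i\<close> is the tuple \<open>a\<^sub>j\<^sub>+\<^sub>1\<^sub>,\<^sub>i\<close>, and \<open>\<omega>\<^sup>n\<close> is the set of lists of
  naturals of length \<open>n\<close>.

  HOL cannot quantify over models of all cardinalities, so the models \<open>N\<close> range over those whose
  universe is a subset of a given type \<open>'a\<close>. We use this with the type in which a monster
  model of \<open>T\<close> lives; every model of cardinality at most that of the monster model has a copy
  there, which suffices by downward Loewenheim-Skolem.\<close>

definition has_IP ::
    "'a itself \<Rightarrow> ('f, 'r) lang \<Rightarrow> ('f, 'r) fm set \<Rightarrow> ('f, 'r) fm \<Rightarrow> nat \<Rightarrow> nat list \<Rightarrow> bool" where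
  "has_IP _ L T \<phi> p q \<longleftrightarrow>
     (\<exists>(N :: ('a, 'f, 'r) fo_struct) a. model L T N \<and>
        (\<forall>j<length q. \<forall>i. a j i \<in> tuples (universe N) (q ! j)) \<and>
        (\<forall>s\<subseteq>{is::nat list. length is = length q}. \<exists>b\<in>tuples (universe N) p.
           \<forall>is. length is = length q \<longrightarrow>
             (holds N \<phi> (b @ concat (map (\<lambda>j. a j (is ! j)) [0..<length q])) \<longleftrightarrow> is \<in> s)))"

definition n_dependent ::
    "'a itself \<Rightarrow> ('f, 'r) lang \<Rightarrow> ('f, 'r) fm set \<Rightarrow> nat \<Rightarrow> bool" where
  "n_dependent A L T n \<longleftrightarrow>
     (\<forall>p q \<phi>. length q = n \<and> \<phi> \<in> formulas L (p + sum_list q) \<longrightarrow> \<not> has_IP A L T \<phi> p q)"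

section \<open>Type-definable groups and connected components\<close>

text \<open>By compactness, type-definability of the graph means that multiplication is the restriction
  to the carrier of a relation definable over \<open>A\<close>.\<close>

definition type_definable_group ::
    "('f, 'r) lang \<Rightarrow> ('a, 'f, 'r) fo_struct \<Rightarrow> nat \<Rightarrow> 'a set \<Rightarrow> 'a list monoid \<Rightarrow> bool" where
  "type_definable_group L M k A G \<longleftrightarrow> group G \<and> type_definable L M k A (carrier G) \<and>
     type_definable L M (k + k + k) A {x @ y @ (x \<otimes>\<^bsub>G\<^esub> y) | x y. x \<in> carrier G \<and> y \<in> carrier G}"

definition bounded_index :: "'k rel \<Rightarrow> ('g, 'z) monoid_scheme \<Rightarrow> 'g set \<Rightarrow> bool" where
  "bounded_index \<kappa> G H \<longleftrightarrow> |rcosets\<^bsub>G\<^esub> H| <o \<kappa>"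

definition G00 ::
    "('f, 'r) lang \<Rightarrow> 'k rel \<Rightarrow> ('a, 'f, 'r) fo_struct \<Rightarrow> nat \<Rightarrow> 'a list monoid \<Rightarrow> 'a set \<Rightarrow> 'a list set" where
  "G00 L \<kappa> M k G B =
     carrier G \<inter> \<Inter>{H. subgroup H G \<and> type_definable L M k B H \<and> bounded_index \<kappa> G H}"

section \<open>Coheirs and generic position\<close>

definition coheir ::
    "('f, 'r) lang \<Rightarrow> ('a, 'f, 'r) fo_struct \<Rightarrow> 'k rel \<Rightarrow> 'a set \<Rightarrow> 'a list \<Rightarrow> 'a set \<Rightarrow> bool" where
  "coheir L M \<kappa> N a B \<longleftrightarrow>
     (\<forall>C\<subseteq>B \<union> N. |C| <o \<kappa> \<longrightarrow> (\<exists>a'\<in>tuples N (length a). tp L M a' C = tp L M a C))"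

text \<open>The tuples are \<open>b 1, \<dots>, b (n - 1)\<close>. The cardinals \<open>\<kappa>\<^sub>i\<close> are well-orders on the given type
  \<open>'k\<close>, the type carrying the inaccessible cardinal of the monster model. Nothing is lost:
  decreasing \<open>\<kappa>\<^sub>i\<close> weakens the coheir condition, so one may always choose \<open>\<kappa>\<^sub>i\<close> least possible, and
  then it is smaller than this inaccessible as \<open>N (i - 1)\<close> is small.\<close>

definition generic_position ::
    "'k itself \<Rightarrow> ('f, 'r) lang \<Rightarrow> ('a, 'f, 'r) fo_struct \<Rightarrow> nat \<Rightarrow> 'a set \<Rightarrow> 'a set \<Rightarrow>
     (nat \<Rightarrow> 'a list) \<Rightarrow> bool" where
  "generic_position _ L M n Ms A b \<longleftrightarrow>
     (\<exists>(\<kappa> :: nat \<Rightarrow> 'k rel) (N :: nat \<Rightarrow> 'a set).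
        (\<forall>i\<in>{1..n - 1}. regular_cardinal (\<kappa> i)) \<and>
        (\<forall>i\<in>{1..n - 1}. \<forall>j\<in>{1..n - 1}. i < j \<longrightarrow> \<kappa> i <o \<kappa> j) \<and>
        (\<forall>i<n - 1. elem_sub L M (N i) (N (i + 1))) \<and> N (n - 1) = Ms \<and> A \<subseteq> N 0 \<and>
        (\<forall>i<n - 1. cardSuc (beth2 |N i| ) \<le>o \<kappa> (i + 1)) \<and>
        (\<forall>i\<in>{1..n - 1}. coheir L M (\<kappa> i) (N i) (b i) ((\<Union>j\<in>{1..<i}. set (b j)) \<union> N (n - 1))))"

end

theory Submission
  imports Defs "HOL-Library.Ramsey" "HOL-Library.Countable_Set"
begin

text \<open>
  If \<open>c \<notin> H \<alpha>\<close>, compactness yields a chain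
  of definable supersets of \<open>H \<alpha>\<close>, the first of which omits \<open>c\<close>, such that \<open>x y\<^sup>-\<^sup>1\<close> lies in each of
  them when \<open>x\<close> and \<open>y\<close> lie in the next one, and bounded index becomes a finite bound \<open>q m\<close> on the
  number of cosets modulo the \<open>m\<close>-th set. There are at most \<open>2\<^sup>|\<^sup>T\<^sup>|\<close> pairs of a formula and a
  bound function, so it suffices that, for a fixed such pair, no infinite sequence \<open>c\<^sub>i\<close> in the
  intersection of the given connected components satisfies \<open>c\<^sub>i \<in> H\<^sub>j\<close> for \<open>j < i\<close> while avoiding
  the first approximation of \<open>H\<^sub>i\<close>.

  Given such a sequence, generic position provides, for \<open>r\<close> from large to small, sequences of
  conjugates of \<open>b\<^sub>r\<close> inside the \<open>r\<close>-th model, each over the smaller tuples, the previous model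
  and everything chosen before. As soon as one \<open>b\<^sub>r\<close> is replaced by such a conjugate, the
  corresponding conjugate of \<open>H\<^sub>j\<close> is type-definable over the parameters of one of the connected
  components and contains all \<open>c\<^sub>i\<close>. Transporting the \<open>c\<^sub>i\<close> by automorphisms and passing to
  quotients \<open>c\<^sub>i c\<^sub>j\<^sup>-\<^sup>1\<close>, which Ramsey's theorem makes small modulo all later conjugates, one
  coordinate at a time, isolates for every point of a finite box an element that lies in all the
  approximations indexed by the box except the one at that point. Products of these
  elements realise all subsets of the box, which contradicts \<open>n\<close>-dependence.
\<close>

section \<open>Differences in approximate subgroups\<close>

text \<open>A coheir condition realises types over fewer than \<open>\<kappa>\<^sub>r\<close>
  parameters only, so it yields no conjugate of \<open>b\<^sub>r\<close> over the whole large model.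
  This is why each group is traded for a countable chain of definable sets: the chains of a sequence
  of groups involve countably many parameters, and the smaller model together with a countable set
  is still small enough to be kept fixed. The price is that the sets are only approximate subgroups,
  so each operation shifts the level at which something is known. Membership of the
  \<open>c\<^sub>i\<close> holds at all levels and can be requested as deep as desired. Failure
  starts at level 0 and moves one level deeper with each round of differences. With n = p + 1 there
  are p + 1 rounds, and multiplying the isolated elements moves it by three more. Hence the
  independent formula is the one at level p + 4, the only formula that has to be common to all
  groups of the sequence. The bound function has to be common as well, because the Ramsey number for
  one coordinate decides, before any element is chosen, how many of its conjugates have to be
  controlled.\<close>

lemma ramsey_triples:
  fixes N q :: nat and S :: "'s set"
  assumes "finite S"
  shows "\<exists>R::nat. \<forall>good :: nat \<Rightarrow> nat \<Rightarrow> nat \<Rightarrow> 's \<Rightarrow> bool.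
    (\<forall>j<R. \<forall>s\<in>S. \<forall>is. length is = q \<and> sorted_wrt (<) is \<and> set is \<subseteq> {..<j} \<longrightarrow>
       (\<exists>a b. a < b \<and> b < q \<and> good (is ! a) (is ! b) j s)) \<longrightarrow>
    (\<exists>z. strict_mono_on {..<N} z \<and> z ` {..<N} \<subseteq> {..<R} \<and>
       (\<forall>a b c. a < b \<longrightarrow> b < c \<longrightarrow> c < N \<longrightarrow> (\<forall>s\<in>S. good (z a) (z b) (z c) s)))"
proof -
  obtain l where l: "set l = S"
    using assms finite_list by blast
  \<comment> \<open>Colour 0 means good for all of \<open>S\<close>; colour \<open>t + 1\<close>
    means that \<open>l ! t\<close> is the first entry at which the triple is bad. Against the
    latter, \<open>q\<close> points form the list \<open>is\<close> and one more point above them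
    serves as \<open>j\<close>.\<close>
  define qs where "qs = N # replicate (length l) (Suc q)"
  obtain R :: nat where R: "partn_lst {..<R} qs 3"
    using ramsey_full by blast
  show ?thesis
  proof (intro exI[of _ R] allI impI)
    fix good :: "nat \<Rightarrow> nat \<Rightarrow> nat \<Rightarrow> 's \<Rightarrow> bool"
    assume thick: "\<forall>j<R. \<forall>s\<in>S. \<forall>is. length is = q \<and> sorted_wrt (<) is \<and> set is \<subseteq> {..<j} \<longrightarrow>
       (\<exists>a b. a < b \<and> b < q \<and> good (is ! a) (is ! b) j s)"
    define bad where "bad X = {t. t < length l \<and>
      \<not> good (sorted_list_of_set X ! 0) (sorted_list_of_set X ! 1) (sorted_list_of_set X ! 2) (l ! t)}"
      for X :: "nat set"
    have fin_bad: "finite (bad X)" for X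
      unfolding bad_def by simp
    define f where "f X = (if bad X = {} then 0 else Suc (Min (bad X)))" for X
    have len: "length qs = Suc (length l)"
      by (simp add: qs_def)
    have "f \<in> nsets {..<R} 3 \<rightarrow> {..<Suc (length l)}"
    proof
      fix X
      have "Min (bad X) < length l" if "bad X \<noteq> {}"
        using Min_in[OF fin_bad that] by (simp add: bad_def)
      then show "f X \<in> {..<Suc (length l)}"
        by (simp add: f_def)
    qed
    then obtain i H where i: "i < length qs" and H: "H \<in> nsets {..<R} (qs ! i)"
        and mono: "f ` nsets H 3 \<subseteq> {i}"
      using partn_lstE[OF R _ len] by blast
    from H have fin: "finite H" and card: "card H = qs ! i" and HR: "H \<subseteq> {..<R}"
      by (auto simp: nsets_def)
    define h where "h = sorted_list_of_set H"
    have h: "set h = H" "sorted_wrt (<) h" "length h = card H"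
      using fin by (simp_all add: h_def)
    have fh: "f {h ! a, h ! b, h ! c} = i \<and>
        sorted_list_of_set {h ! a, h ! b, h ! c} = [h ! a, h ! b, h ! c]"
      if "a < b" "b < c" "c < card H" for a b c
    proof -
      have lt: "h ! a < h ! b" "h ! b < h ! c"
        using that h sorted_wrt_iff_nth_less[of "(<)" h] by auto
      have "{h ! a, h ! b, h ! c} \<in> nsets H 3"
        using lt that h by (auto simp: nsets_def)
      moreover have "sorted_list_of_set {h ! a, h ! b, h ! c} = [h ! a, h ! b, h ! c]"
        using lt by (intro sorted_list_of_set_unique[THEN iffD1]) auto
      ultimately show ?thesis
        using mono by blast
    qed
    show "\<exists>z. strict_mono_on {..<N} z \<and> z ` {..<N} \<subseteq> {..<R} \<and>
       (\<forall>a b c. a < b \<longrightarrow> b < c \<longrightarrow> c < N \<longrightarrow> (\<forall>s\<in>S. good (z a) (z b) (z c) s))"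
    proof (cases i)
      case 0
      then have cN: "card H = N"
        using card by (simp add: qs_def)
      have "good (h ! a) (h ! b) (h ! c) s" if "a < b" "b < c" "c < N" "s \<in> S" for a b c s
      proof -
        have eq: "sorted_list_of_set {h ! a, h ! b, h ! c} = [h ! a, h ! b, h ! c]"
          and "f {h ! a, h ! b, h ! c} = 0"
          using fh[of a b c] that cN 0 by auto
        then have "bad {h ! a, h ! b, h ! c} = {}"
          by (simp add: f_def split: if_splits)
        moreover obtain t where "t < length l" "l ! t = s"
          using \<open>s \<in> S\<close> l by (metis in_set_conv_nth)
        ultimately show ?thesis
          unfolding bad_def eq by auto
      qed
      moreover have "strict_mono_on {..<N} ((!) h)"
        using h cN sorted_wrt_iff_nth_less[of "(<)" h] by (auto simp: strict_mono_on_def)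
      moreover have "(!) h ` {..<N} \<subseteq> {..<R}"
        using h cN HR by auto
      ultimately show ?thesis
        by blast
    next
      case (Suc t)
      then have t: "t < length l" and cq: "card H = Suc q"
        using i card by (simp_all add: qs_def)
      have nb: "\<not> good (h ! a) (h ! b) (h ! q) (l ! t)" if "a < b" "b < q" for a b
      proof -
        have eq: "sorted_list_of_set {h ! a, h ! b, h ! q} = [h ! a, h ! b, h ! q]"
          and "f {h ! a, h ! b, h ! q} = Suc t"
          using fh[of a b q] that cq Suc by auto
        then have "t \<in> bad {h ! a, h ! b, h ! q}"
          using Min_in[OF fin_bad, of "{h ! a, h ! b, h ! q}"] by (auto simp: f_def split: if_splits)
        then show ?thesis
          unfolding bad_def eq by simp
      qed
      have lq: "h ! q < R"
        using h cq HR nth_mem[of q h] by auto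
      have "sorted_wrt (<) (take q h)" "length (take q h) = q"
        using h cq by (auto simp: sorted_wrt_take)
      moreover have "set (take q h) \<subseteq> {..<h ! q}"
        using h cq sorted_wrt_iff_nth_less[of "(<)" h] by (auto simp: in_set_conv_nth)
      moreover have "l ! t \<in> S"
        using t l by auto
      ultimately obtain a b where "a < b" "b < q" "good (take q h ! a) (take q h ! b) (h ! q) (l ! t)"
        using thick lq by blast
      then show ?thesis
        using nb[of a b] by simp
    qed
  qed
qed

section \<open>Thick sets and approximate subgroups\<close>

context group
begin

text \<open>For a subgroup \<open>X\<close> this says that there are fewer than \<open>q\<close>
  right cosets. As \<open>X\<close> need not be closed under inverses, the order
  \<open>a < b\<close> fixes which of the two differences is meant.\<close>

definition thick :: "nat \<Rightarrow> 'a set \<Rightarrow> bool" where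
  "thick q X \<longleftrightarrow> (\<forall>xs. length xs = q \<longrightarrow> set xs \<subseteq> carrier G \<longrightarrow>
    (\<exists>a b. a < b \<and> b < length xs \<and> xs ! a \<otimes> inv (xs ! b) \<in> X))"

lemma foldr_closed: "set xs \<subseteq> carrier G \<Longrightarrow> foldr (\<otimes>) xs \<one> \<in> carrier G"
  by (induction xs) auto

lemma foldr_append_mult:
  assumes "set xs \<subseteq> carrier G" "set ys \<subseteq> carrier G"
  shows "foldr (\<otimes>) (xs @ ys) \<one> = foldr (\<otimes>) xs \<one> \<otimes> foldr (\<otimes>) ys \<one>"
  using assms(1)
proof (induction xs)
  case Nil
  then show ?case using foldr_closed[OF assms(2)] by simp
next
  case (Cons a xs)
  then show ?case using foldr_closed[of xs] foldr_closed[OF assms(2)] by (simp add: m_assoc)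
qed

end

text \<open>A definable superset of a type-definable subgroup need be neither a subgroup nor
  contained in the carrier. Compactness preserves only that differences from one set lie in the
  preceding one, and this for elements of the carrier.\<close>

locale approx_chain = group G for G (structure) +
  fixes X :: "nat \<Rightarrow> 'a set"
  assumes one: "\<one> \<in> X m"
    and diff: "x \<in> carrier G \<Longrightarrow> y \<in> carrier G \<Longrightarrow> x \<in> X (Suc m) \<Longrightarrow> y \<in> X (Suc m) \<Longrightarrow>
      x \<otimes> inv y \<in> X m"
begin

lemma Suc_mem: "x \<in> carrier G \<Longrightarrow> x \<in> X (Suc m) \<Longrightarrow> x \<in> X m"
  using diff[of x \<one> m] one by simp

lemma mono_mem: "x \<in> carrier G \<Longrightarrow> x \<in> X m' \<Longrightarrow> m \<le> m' \<Longrightarrow> x \<in> X m"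
  by (induction m' rule: nat_induct) (auto simp: le_Suc_eq intro: Suc_mem)

lemma inv_mem: "x \<in> carrier G \<Longrightarrow> x \<in> X (Suc m) \<Longrightarrow> inv x \<in> X m"
  using diff[of \<one> x m] one by simp

lemma mult_mem:
  "x \<in> carrier G \<Longrightarrow> y \<in> carrier G \<Longrightarrow> x \<in> X (m + 2) \<Longrightarrow> y \<in> X (m + 2) \<Longrightarrow> x \<otimes> y \<in> X m"
  using diff[of x "inv y" m] inv_mem[of y "Suc m"] Suc_mem[of x "Suc m"] by simp

text \<open>Multiplying back by \<open>y\<close> would put \<open>x\<close> into \<open>X m\<close>.
  Failure thus survives only one level deeper, which is the cost of one round of
  differences.\<close>

lemma diff_not_mem:
  assumes "x \<in> carrier G" "y \<in> carrier G" "x \<notin> X m" "y \<in> X (m + 2)"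
  shows "x \<otimes> inv y \<notin> X (Suc m)"
proof
  assume "x \<otimes> inv y \<in> X (Suc m)"
  then have "x \<otimes> inv y \<otimes> inv (inv y) \<in> X m"
    using assms inv_mem[of y "Suc m"] by - (rule diff, simp_all)
  then show False
    using assms by (simp add: m_assoc)
qed

lemma subgroup_Inter: "subgroup {x \<in> carrier G. \<forall>m. x \<in> X m} G"
proof (rule subgroupI)
  show "{x \<in> carrier G. \<forall>m. x \<in> X m} \<noteq> {}"
    using one by blast
qed (auto intro: inv_mem mult_mem)


text \<open>Splitting off a factor uses \<open>mult_mem\<close>, which costs two levels: one for an
  inverse and one for a difference.\<close>

lemma foldr_mem:
  assumes "set xs \<subseteq> carrier G" "\<forall>x\<in>set xs. x \<in> X (m + 2 * length xs)"
  shows "foldr (\<otimes>) xs \<one> \<in> X m \<inter> carrier G"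
  using assms
proof (induction xs arbitrary: m)
  case Nil
  then show ?case using one by simp
next
  case (Cons a xs)
  have "foldr (\<otimes>) xs \<one> \<in> X (m + 2) \<inter> carrier G"
    using Cons.prems by (intro Cons.IH) auto
  moreover have "a \<in> X (m + 2)"
    using Cons.prems by (intro mono_mem[of a "m + 2 * length (a # xs)" "m + 2"]) auto
  ultimately show ?case
    using Cons.prems mult_mem[of a "foldr (\<otimes>) xs \<one>" m] by auto
qed

text \<open>Cancelling \<open>y\<close> costs one level by \<open>diff\<close>, cancelling
  \<open>x\<close> two more by \<open>mult_mem\<close>; this is the 3. Level \<open>m + 4\<close>
  leaves room for inverting \<open>x\<close>.\<close>

lemma mult3_not_mem:
  assumes "x \<in> carrier G" "a \<in> carrier G" "y \<in> carrier G"
    and "x \<in> X (m + 4)" "y \<in> X (m + 4)" "a \<notin> X m"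
  shows "x \<otimes> (a \<otimes> y) \<notin> X (m + 3)"
proof
  assume h: "x \<otimes> (a \<otimes> y) \<in> X (m + 3)"
  have "inv x \<in> X (m + 3)"
    using assms inv_mem[of x "m + 3"] by (simp add: numeral_eq_Suc)
  then have "inv x \<otimes> (x \<otimes> (a \<otimes> y)) \<in> X (m + 1)"
    using assms h by - (rule mult_mem, simp_all add: numeral_eq_Suc)
  then have "a \<otimes> y \<in> X (m + 1)"
    using assms by (simp flip: m_assoc)
  then have "a \<otimes> y \<otimes> inv y \<in> X m"
    using assms mono_mem[of y "m + 4" "m + 1"] by - (rule diff, simp_all)
  then show False
    using assms by (simp add: m_assoc)
qed

end

context group
begin

text \<open>\<open>V\<close> indexes the approximate groups at each \<open>j\<close>,
  \<open>W\<close> the elements at each \<open>i\<close>, and \<open>P\<close> marks the pairs that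
  have to fail. The information on \<open>c\<close> is triangular (\<open>j \<le> i\<close>);
  thinning out and taking differences makes it square. The quantifiers put \<open>R\<close> before
  \<open>X\<close> and \<open>c\<close> because \<open>separated_step\<close> uses \<open>R\<close>
  in order to choose its elements.\<close>

definition difference_bound ::
    "(nat \<Rightarrow> nat) \<Rightarrow> nat \<Rightarrow> nat \<Rightarrow> nat \<Rightarrow> 'v set \<Rightarrow> 'w set \<Rightarrow> ('w \<Rightarrow> 'v \<Rightarrow> bool) \<Rightarrow> nat \<Rightarrow> bool" where
  "difference_bound q N M t V W P R \<longleftrightarrow> (\<forall>X c.
     (\<forall>j. \<forall>v\<in>V. approx_chain G (\<lambda>m. X m j v) \<and> (\<forall>m. thick (q m) (X m j v))) \<longrightarrow>
     (\<forall>i<R. \<forall>w\<in>W. c i w \<in> carrier G) \<longrightarrow>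
     (\<forall>i<R. \<forall>j\<le>i. \<forall>w\<in>W. \<forall>v\<in>V.
        if j = i \<and> P w v then c i w \<notin> X t j v else c i w \<in> X (M + t + 2) j v) \<longrightarrow>
     (\<exists>z c'. \<forall>i<N. \<forall>w\<in>W. c' i w \<in> carrier G \<and> (\<forall>j<N. \<forall>v\<in>V.
        if j = i \<and> P w v then c' i w \<notin> X (Suc t) (z j) v else c' i w \<in> X M (z j) v)))"

lemma difference_boundD:
  assumes "difference_bound q N M t V W P R"
    and "\<And>j v. v \<in> V \<Longrightarrow> approx_chain G (\<lambda>m. X m j v)"
    and "\<And>j v m. v \<in> V \<Longrightarrow> thick (q m) (X m j v)"
    and "\<And>i w. i < R \<Longrightarrow> w \<in> W \<Longrightarrow> c i w \<in> carrier G"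
    and "\<And>i j w v. i < R \<Longrightarrow> j \<le> i \<Longrightarrow> w \<in> W \<Longrightarrow> v \<in> V \<Longrightarrow>
      if j = i \<and> P w v then c i w \<notin> X t j v else c i w \<in> X (M + t + 2) j v"
  obtains z c' where "\<And>i w. i < N \<Longrightarrow> w \<in> W \<Longrightarrow> c' i w \<in> carrier G"
    "\<And>i w j v. i < N \<Longrightarrow> w \<in> W \<Longrightarrow> j < N \<Longrightarrow> v \<in> V \<Longrightarrow>
      if j = i \<and> P w v then c' i w \<notin> X (Suc t) (z j) v else c' i w \<in> X M (z j) v"
proof -
  let ?isolated = "\<lambda>z c'. \<forall>i<N. \<forall>w\<in>W. c' i w \<in> carrier G \<and> (\<forall>j<N. \<forall>v\<in>V.
      if j = i \<and> P w v then c' i w \<notin> X (Suc t) (z j) v else c' i w \<in> X M (z j) v)"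
  have "\<exists>z c'. ?isolated z c'"
    by (rule assms(1)[unfolded difference_bound_def, THEN spec, THEN spec, THEN mp, THEN mp, THEN mp, of X c])
      (intro allI ballI impI conjI; rule assms(2-5); assumption)+
  then obtain z c' where "?isolated z c'"
    by (elim exE)
  then show thesis
    by (intro that[of c' z]) simp_all
qed

text \<open>If a triple \<open>a < b < j\<close> is coloured by the first group in which \<open>c a\<close> and \<open>c b\<close> lie in
  different approximate cosets of \<open>X M j v\<close>, then thickness rules out a long homogeneous set
  with a bad colour; differences of consecutive elements of a good one are as required.\<close>

lemma difference_bound_exists:
  fixes V :: "'v set" and W :: "'w set" and P :: "'w \<Rightarrow> 'v \<Rightarrow> bool"
  assumes "finite V" "finite W"
  shows "\<exists>R. difference_bound q N M t V W P R"
proof -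
  obtain R where R: "\<forall>good :: nat \<Rightarrow> nat \<Rightarrow> nat \<Rightarrow> ('w \<times> 'v) \<Rightarrow> bool.
    (\<forall>j<R. \<forall>s\<in>W \<times> V. \<forall>is. length is = q M \<and> sorted_wrt (<) is \<and> set is \<subseteq> {..<j} \<longrightarrow>
       (\<exists>a b. a < b \<and> b < q M \<and> good (is ! a) (is ! b) j s)) \<longrightarrow>
    (\<exists>z. strict_mono_on {..<2 * N} z \<and> z ` {..<2 * N} \<subseteq> {..<R} \<and>
       (\<forall>a b c. a < b \<longrightarrow> b < c \<longrightarrow> c < 2 * N \<longrightarrow> (\<forall>s\<in>W \<times> V. good (z a) (z b) (z c) s)))"
    using ramsey_triples[of "W \<times> V" "q M" "2 * N"] assms by blast
  show ?thesis
    unfolding difference_bound_def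
  proof (rule exI[of _ R], intro allI impI)
    fix X :: "nat \<Rightarrow> nat \<Rightarrow> 'v \<Rightarrow> 'a set" and c :: "nat \<Rightarrow> 'w \<Rightarrow> 'a"
    assume chain: "\<forall>j. \<forall>v\<in>V. approx_chain G (\<lambda>m. X m j v) \<and> (\<forall>m. thick (q m) (X m j v))"
      and cG: "\<forall>i<R. \<forall>w\<in>W. c i w \<in> carrier G"
      and c: "\<forall>i<R. \<forall>j\<le>i. \<forall>w\<in>W. \<forall>v\<in>V.
        if j = i \<and> P w v then c i w \<notin> X t j v else c i w \<in> X (M + t + 2) j v"
    define good where "good a b j s = (case s of (w, v) \<Rightarrow> c a w \<otimes> inv (c b w) \<in> X M j v)"
      for a b j s
    have thick: "\<exists>a b. a < b \<and> b < q M \<and> good (is ! a) (is ! b) j s"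
      if "j < R" "s \<in> W \<times> V" "length is = q M \<and> sorted_wrt (<) is \<and> set is \<subseteq> {..<j}" for j s "is"
    proof -
      obtain w v where s: "s = (w, v)" "w \<in> W" "v \<in> V"
        using \<open>s \<in> W \<times> V\<close> by blast
      let ?xs = "map (\<lambda>i. c i w) is"
      have "length ?xs = q M \<and> set ?xs \<subseteq> carrier G"
        using that s cG by force
      with chain[rule_format, OF s(3), of j] obtain a b where "a < b" "b < length ?xs"
          "?xs ! a \<otimes> inv (?xs ! b) \<in> X M j v"
        unfolding thick_def by blast
      then show ?thesis
        using that s by (intro exI[of _ a] exI[of _ b]) (auto simp: good_def)
    qed
    have "\<forall>j<R. \<forall>s\<in>W \<times> V. \<forall>is. length is = q M \<and> sorted_wrt (<) is \<and> set is \<subseteq> {..<j} \<longrightarrow>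
       (\<exists>a b. a < b \<and> b < q M \<and> good (is ! a) (is ! b) j s)"
      using thick by simp
    from R[THEN spec, of good, THEN mp, OF this]
    obtain z where z: "strict_mono_on {..<2 * N} z" "z ` {..<2 * N} \<subseteq> {..<R}"
        and zg: "\<forall>a b c. a < b \<longrightarrow> b < c \<longrightarrow> c < 2 * N \<longrightarrow> (\<forall>s\<in>W \<times> V. good (z a) (z b) (z c) s)"
      by (elim exE conjE)
    have zlt: "z a < z b" if "a < b" "b < 2 * N" for a b
      using z that by (auto simp: strict_mono_on_def)
    \<comment> \<open>Consecutive points are paired, hence \<open>2 * N\<close>. A pair keeps the
      group at its first point, where \<open>c\<close> may fail; the second point comes after that
      group, so the element there lies in it.\<close>
    define c' where "c' i w = c (z (2 * i)) w \<otimes> inv (c (z (2 * i + 1)) w)" for i w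
    have zR: "z a < R" if "a < 2 * N" for a
      using z(2) that by auto
    have main: "if j = i \<and> P w v then c' i w \<notin> X (Suc t) (z (2 * j)) v else c' i w \<in> X M (z (2 * j)) v"
      if "i < N" "j < N" "w \<in> W" "v \<in> V" for i j w v
    proof -
      interpret approx_chain G "\<lambda>m. X m (z (2 * j)) v"
        using chain that by blast
      have G: "c (z (2 * i)) w \<in> carrier G" "c (z (2 * i + 1)) w \<in> carrier G"
        using that cG zR by auto
      \<comment> \<open>For \<open>j < i\<close> both elements come after the group and lie in it.
        For \<open>i < j\<close> both come before it, and only the Ramsey property compares them.
        For \<open>j = i\<close> level \<open>M + t + 2\<close> serves two purposes:
        \<open>M + 1\<close> makes a difference fall into level \<open>M\<close>, and
        \<open>t + 2\<close> is what \<open>diff_not_mem\<close> asks of the subtracted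
        element.\<close>
      consider "j < i" | "j = i" | "i < j" by linarith
      then show ?thesis
      proof cases
        case 1
        have "c (z a) w \<in> X (M + t + 2) (z (2 * j)) v" if "2 * j < a" "a < 2 * N" for a
          using c[rule_format, OF zR[OF that(2)] less_imp_le[OF zlt[OF that]] \<open>w \<in> W\<close> \<open>v \<in> V\<close>]
            zlt[OF that] by simp
        then have "c (z (2 * i)) w \<in> X (M + t + 2) (z (2 * j)) v"
          "c (z (2 * i + 1)) w \<in> X (M + t + 2) (z (2 * j)) v"
          using 1 that by auto
        then have "c (z (2 * i)) w \<in> X (Suc M) (z (2 * j)) v"
          "c (z (2 * i + 1)) w \<in> X (Suc M) (z (2 * j)) v"
          using mono_mem[OF G(1), of "M + t + 2" "Suc M"] mono_mem[OF G(2), of "M + t + 2" "Suc M"] by simp_all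
        then show ?thesis
          using 1 G diff unfolding c'_def by auto
      next
        case 2
        then have lt: "z (2 * j) < z (2 * i + 1)"
          using that by (auto intro!: zlt)
        have i1: "z (2 * i + 1) < R" "z (2 * i) < R"
          using zR that by auto
        have b: "c (z (2 * i + 1)) w \<in> X (M + t + 2) (z (2 * j)) v"
          using c[rule_format, OF i1(1) less_imp_le[OF lt] that(3,4)] lt by auto
        show ?thesis
        proof (cases "P w v")
          case True
          then have "c (z (2 * i)) w \<notin> X t (z (2 * j)) v"
            using c[rule_format, OF i1(2), of "z (2 * j)" w v] 2 that by auto
          moreover have "c (z (2 * i + 1)) w \<in> X (t + 2) (z (2 * j)) v"
            using mono_mem[OF G(2) b] by simp
          ultimately show ?thesis
            using True 2 G diff_not_mem unfolding c'_def by auto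
        next
          case False
          then have "c (z (2 * i)) w \<in> X (M + t + 2) (z (2 * j)) v"
            using c[rule_format, OF i1(2), of "z (2 * j)" w v] 2 that by auto
          then have "c (z (2 * i)) w \<in> X (Suc M) (z (2 * j)) v"
            "c (z (2 * i + 1)) w \<in> X (Suc M) (z (2 * j)) v"
            using mono_mem[OF G(1), of "M + t + 2" "Suc M"] mono_mem[OF G(2) b, of "Suc M"] by simp_all
          then show ?thesis
            using False G diff unfolding c'_def by auto
        qed
      next
        case 3
        then have "good (z (2 * i)) (z (2 * i + 1)) (z (2 * j)) (w, v)"
          using that by (intro zg[rule_format]) auto
        then show ?thesis
          using 3 by (auto simp: good_def c'_def)
      qed
    qed
    have "c' i w \<in> carrier G" if "i < N" "w \<in> W" for i w
      using that cG zR unfolding c'_def by auto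
    then show "\<exists>z c'. \<forall>i<N. \<forall>w\<in>W. c' i w \<in> carrier G \<and> (\<forall>j<N. \<forall>v\<in>V.
        if j = i \<and> P w v then c' i w \<notin> X (Suc t) (z j) v else c' i w \<in> X M (z j) v)"
      using main by (intro exI[of _ "\<lambda>i. z (2 * i)"] exI[of _ c']) auto
  qed
qed

end

section \<open>Boxes of indices and the reduction to a box, one coordinate at a time\<close>

definition words :: "nat \<Rightarrow> nat \<Rightarrow> nat list set" where
  "words N l = {w. length w = l \<and> set w \<subseteq> {..<N}}"

definition opt_words :: "nat \<Rightarrow> nat \<Rightarrow> nat option list set" where
  "opt_words N l = {u. length u = l \<and> set u \<subseteq> insert None (Some ` {..<N})}"

lemma finite_words: "finite (words N l)"
  unfolding words_def using finite_lists_length_eq[of "{..<N}" l] by (simp add: conj_commute)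

lemma finite_opt_words: "finite (opt_words N l)"
  unfolding opt_words_def
  using finite_lists_length_eq[of "insert None (Some ` {..<N})" l] by (simp add: conj_commute)

lemma replicate_None_in_opt_words: "replicate l None \<in> opt_words N l"
  by (simp add: opt_words_def set_replicate_conv_if)

lemma words_Suc: "words N (Suc l) = {i # w | i w. i < N \<and> w \<in> words N l}"
  by (auto simp: words_def length_Suc_conv)

lemma opt_words_0: "opt_words N 0 = {[]}"
  by (auto simp: opt_words_def)

lemma words_0: "words N 0 = {[]}"
  by (auto simp: words_def)

text \<open>A point of a small box names a vector of conjugates through one reindexing per
  coordinate, namely the \<open>z\<close> delivered by the Ramsey argument for that
  coordinate.\<close>

definition select :: "(nat \<Rightarrow> nat) list \<Rightarrow> nat list \<Rightarrow> nat option list" where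
  "select es w = map2 (\<lambda>e i. Some (e i)) es w"

lemma select_Cons: "select (e # es) (i # w) = Some (e i) # select es w"
  by (simp add: select_def)

lemma select_eq_map_Some: "select es w = map Some (map2 (\<lambda>e i. e i) es w)"
  by (simp add: select_def comp_def case_prod_unfold)

text \<open>In a vector of length \<open>p + 1\<close> the last entry selects a group of the sequence; an entry
  \<open>Some i\<close> at \<open>r < p\<close> stands for the \<open>i\<close>-th conjugate of the tuple \<open>b r\<close>, and \<open>None\<close> for \<open>b r\<close>
  itself.\<close>

locale coset_array = group G for G (structure) +
  fixes p :: nat and \<Phi> :: "nat \<Rightarrow> nat option list \<Rightarrow> 'a set" and q :: "nat \<Rightarrow> nat"
    and \<sigma> :: "nat \<Rightarrow> nat \<Rightarrow> 'a \<Rightarrow> 'a" and c :: "nat \<Rightarrow> 'a"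
  assumes chain: "length u = p \<Longrightarrow> approx_chain G (\<lambda>m. \<Phi> m (u @ [Some j]))"
    and thick: "length u = p \<Longrightarrow> thick (q m) (\<Phi> m (u @ [Some j]))"
    and \<sigma>_closed: "r < p \<Longrightarrow> x \<in> carrier G \<Longrightarrow> \<sigma> r i x \<in> carrier G"
    and \<sigma>_move: "r < p \<Longrightarrow> x \<in> carrier G \<Longrightarrow> length u = r \<Longrightarrow> length w = p - r \<Longrightarrow>
      \<sigma> r i x \<in> \<Phi> m (u @ Some i # map Some w) \<longleftrightarrow> x \<in> \<Phi> m (u @ None # map Some w)"
    and \<sigma>_fix: "r < p \<Longrightarrow> x \<in> carrier G \<Longrightarrow> length u = r \<Longrightarrow> length w = p - r \<Longrightarrow> j < i \<Longrightarrow>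
      \<sigma> r i x \<in> \<Phi> m (u @ Some j # map Some w) \<longleftrightarrow> x \<in> \<Phi> m (u @ Some j # map Some w)"
    and c_closed: "c i \<in> carrier G"
    and c_mem: "length u = p \<Longrightarrow> u \<noteq> replicate p None \<or> j < i \<Longrightarrow> c i \<in> \<Phi> m (u @ [Some j])"
    and c_not_mem: "c i \<notin> \<Phi> 0 (replicate p None @ [Some i])"
begin

text \<open>The situation after the coordinates \<open>\<ge> r\<close> have been restricted to a box. A step costs one level
  of the chain, whence the level \<open>Suc p - r\<close>.\<close>

definition separated :: "nat \<Rightarrow> nat \<Rightarrow> nat \<Rightarrow> nat \<Rightarrow> bool" where
  "separated r M L N \<longleftrightarrow> (\<exists>es d. length es = Suc p - r \<and>
     (\<forall>w\<in>words N (Suc p - r). d w \<in> carrier G \<and>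
        (\<forall>u\<in>opt_words L r. \<forall>w'\<in>words N (Suc p - r).
           if w' = w \<and> u = replicate r None then d w \<notin> \<Phi> (Suc p - r) (u @ select es w')
           else d w \<in> \<Phi> M (u @ select es w'))))"

text \<open>Only the last coordinate is treated, so there is one element per index, whence
  \<open>W = {()}\<close>. Vectors with a replaced entry cause no failure: for these
  \<open>c_mem\<close> gives membership for every \<open>j\<close>, not only for
  \<open>j < i\<close>.\<close>

lemma separated_top: "separated p M L N"
proof -
  let ?X = "\<lambda>m j u. \<Phi> m (u @ [Some j])" and ?P = "\<lambda>_ u. u = replicate p None"
  obtain R where R: "difference_bound q N M 0 (opt_words L p) {()} ?P R"
    using difference_bound_exists[OF finite_opt_words, of "{()}"] by blast
  have len: "length v = p" if "v \<in> opt_words L p" for v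
    using that by (simp add: opt_words_def)
  obtain z c' where zG: "\<And>i w. i < N \<Longrightarrow> w \<in> {()} \<Longrightarrow> c' i w \<in> carrier G"
    and zc: "\<And>i w j v. i < N \<Longrightarrow> w \<in> {()} \<Longrightarrow> j < N \<Longrightarrow> v \<in> opt_words L p \<Longrightarrow>
      if j = i \<and> ?P w v then c' i w \<notin> ?X (Suc 0) (z j) v else c' i w \<in> ?X M (z j) v"
    by (rule difference_boundD[OF R, where X = ?X and c = "\<lambda>i _. c i"])
      (use len chain thick c_closed c_mem c_not_mem in \<open>auto simp: le_less\<close>)
  have bad: "c' i () \<notin> \<Phi> (Suc 0) (replicate p None @ [Some (z i)])" if "i < N" for i
    using zc[OF that _ that replicate_None_in_opt_words, of "()"] by simp
  have good: "c' i () \<in> \<Phi> M (u @ [Some (z j)])"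
    if "i < N" "j < N" "u \<in> opt_words L p" "\<not> (j = i \<and> u = replicate p None)" for i j u
    using zc[OF that(1) _ that(2,3), of "()"] that(4) by (simp split: if_splits)
  show ?thesis
    unfolding separated_def
  proof (intro exI[of _ "[z]"] exI[of _ "\<lambda>w. c' (hd w) ()"] conjI ballI)
    fix w assume "w \<in> words N (Suc p - p)"
    then obtain i where i: "i < N" "w = [i]"
      by (auto simp: words_Suc words_0)
    then show "c' (hd w) () \<in> carrier G"
      using zG by simp
    fix u w' assume u: "u \<in> opt_words L p" and "w' \<in> words N (Suc p - p)"
    then obtain i' where i': "i' < N" "w' = [i']"
      by (auto simp: words_Suc words_0)
    show "if w' = w \<and> u = replicate p None then c' (hd w) () \<notin> \<Phi> (Suc p - p) (u @ select [z] w')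
           else c' (hd w) () \<in> \<Phi> M (u @ select [z] w')"
      using bad[OF i(1)] good[OF i(1) i'(1) u] i i' by (auto simp: select_def)
  qed simp
qed

text \<open>The elements \<open>\<sigma> r i (d w)\<close> form the sequence to be thinned out. By
  \<open>\<sigma>_move\<close>, conjugate \<open>i\<close> in coordinate \<open>r\<close> sees
  \<open>\<sigma> r i (d w)\<close> as \<open>None\<close> sees \<open>d w\<close>, so the failure
  of \<open>d w\<close> is carried over to \<open>j = i\<close>. By \<open>\<sigma>_fix\<close>
  nothing changes at \<open>j < i\<close>, where the entry \<open>Some j\<close> already guarantees
  membership of \<open>d w\<close>. The case \<open>j > i\<close> is left to
  \<open>difference_bound\<close>.\<close>

lemma separated_step:
  assumes "Suc r \<le> p" and IH: "\<And>M L N. separated (Suc r) M L N"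
  shows "separated r M L N"
proof -
  define l where "l = p - r"
  have l: "Suc p - Suc r = l" "Suc p - r = Suc l"
    using assms(1) by (simp_all add: l_def)
  let ?V = "opt_words L r \<times> words N l" and ?W = "words N l"
  let ?P = "\<lambda>w v. snd v = w \<and> fst v = replicate r None"
  obtain R where R: "difference_bound q N M l ?V ?W ?P R"
    using difference_bound_exists[of ?V ?W] finite_words finite_opt_words by blast
  \<comment> \<open>Coordinate \<open>r\<close> will take the values \<open>Some j\<close> with
    \<open>j < R\<close>, so \<open>d\<close> must be controlled there as well as on the entries
    below \<open>L\<close> that the conclusion asks for. Level \<open>M + l + 2\<close> is the one
    demanded by \<open>difference_bound\<close> for \<open>t = l\<close>.\<close>
  obtain es d where es: "length es = l"
    and d: "\<forall>w\<in>?W. d w \<in> carrier G \<and> (\<forall>u\<in>opt_words (max L R) (Suc r). \<forall>w'\<in>?W.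
           if w' = w \<and> u = replicate (Suc r) None then d w \<notin> \<Phi> l (u @ select es w')
           else d w \<in> \<Phi> (M + l + 2) (u @ select es w'))"
    using IH[of "M + l + 2" "max L R" N, unfolded separated_def l]
    by (elim exE conjE)
  define X where "X m j v = \<Phi> m (fst v @ Some j # select es (snd v))" for m j and v :: "nat option list \<times> nat list"
  \<comment> \<open>\<open>chain\<close> and \<open>thick\<close> speak of vectors whose last entry,
    the index of the group, is split off.\<close>
  have app: "\<exists>u' j'. length u' = p \<and> u @ Some j # select es w = u' @ [Some j']"
    if "length u = r" "length w = l" for u j w
  proof -
    define w' where "w' = j # map2 (\<lambda>e i. e i) es w"
    have "length w' = Suc l"
      using es that by (simp add: w'_def)
    then obtain x y where xy: "w' = x @ [y]" "length x = l"
      by (auto simp: length_Suc_conv_rev)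
    have "u @ Some j # select es w = u @ map Some w'"
      unfolding select_eq_map_Some by (simp add: w'_def)
    also have "\<dots> = (u @ map Some x) @ [Some y]"
      using xy by simp
    finally have "u @ Some j # select es w = (u @ map Some x) @ [Some y]" .
    then show ?thesis
      using that xy assms(1) by (intro exI[of _ "u @ map Some x"] exI[of _ y]) (simp add: l_def)
  qed
  have chainX: "approx_chain G (\<lambda>m. X m j v)" and thickX: "thick (q m) (X m j v)"
    if "v \<in> ?V" for j v m
  proof -
    have "length (fst v) = r" "length (snd v) = l"
      using that by (auto simp: opt_words_def words_def)
    from app[OF this, of j]
    obtain u' j' where "length u' = p" "fst v @ Some j # select es (snd v) = u' @ [Some j']"
      by blast
    then show "approx_chain G (\<lambda>m. X m j v)" "thick (q m) (X m j v)"
      using chain thick unfolding X_def by simp_all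
  qed
  have pr: "r < p" using assms(1) by simp
  have move: "\<sigma> r i x \<in> X m i (u, w) \<longleftrightarrow> x \<in> \<Phi> m (u @ None # select es w)"
    and fix_lower: "j < i \<Longrightarrow> \<sigma> r i x \<in> X m j (u, w) \<longleftrightarrow> x \<in> X m j (u, w)"
    if "x \<in> carrier G" "u \<in> opt_words L r" "w \<in> words N l" for i j m x u w
    using \<sigma>_move[OF pr that(1), of u "map2 (\<lambda>e i. e i) es w" i m]
      \<sigma>_fix[OF pr that(1), of u "map2 (\<lambda>e i. e i) es w" j i m] that es
    by (simp_all add: X_def select_eq_map_Some words_def opt_words_def l_def)
  have None_in: "u @ [None] \<in> opt_words (max L R) (Suc r)"
    and Some_in: "j < R \<Longrightarrow> u @ [Some j] \<in> opt_words (max L R) (Suc r)" if "u \<in> opt_words L r" for u j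
    using that by (auto simp: opt_words_def)
  have ci: "if j = i \<and> ?P w v then \<sigma> r i (d w) \<notin> X l j v else \<sigma> r i (d w) \<in> X (M + l + 2) j v"
    if "i < R" "j \<le> i" "w \<in> ?W" and vV: "v \<in> ?V" for i j w v
  proof -
    obtain u w' where v: "v = (u, w')" "u \<in> opt_words L r" "w' \<in> words N l"
      using vV by blast
    have dw: "d w \<in> carrier G"
      using d that by blast
    show ?thesis
    proof (cases "j = i")
      case True
      have eq: "u @ [None] = replicate (Suc r) None \<longleftrightarrow> u = replicate r None"
        using v(2) by (simp add: opt_words_def flip: replicate_append_same)
      have "if w' = w \<and> u = replicate r None then d w \<notin> \<Phi> l (u @ None # select es w')
        else d w \<in> \<Phi> (M + l + 2) (u @ None # select es w')"
        using d[THEN bspec, OF that(3), THEN conjunct2, rule_format, OF None_in[OF v(2)] v(3)]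
        unfolding eq by (auto split: if_splits)
      then show ?thesis
        unfolding True v(1) move[OF dw v(2,3)] by simp
    next
      case False
      then have "u @ [Some j] \<noteq> replicate (Suc r) None" "j < i"
        using that by (auto simp: replicate_append_same[symmetric])
      then show ?thesis
        using d[THEN bspec, OF that(3), THEN conjunct2, rule_format, OF Some_in[OF v(2), of j] v(3)] that
        by (simp add: v(1) fix_lower[OF dw v(2,3)]) (simp add: X_def)
    qed
  qed
  have closed: "\<sigma> r i (d w) \<in> carrier G" if "w \<in> ?W" for i w
    using d \<sigma>_closed[OF pr] that by simp
  obtain z c' where zG: "\<And>i w. i < N \<Longrightarrow> w \<in> ?W \<Longrightarrow> c' i w \<in> carrier G"
    and zc: "\<And>i w j v. i < N \<Longrightarrow> w \<in> ?W \<Longrightarrow> j < N \<Longrightarrow> v \<in> ?V \<Longrightarrow>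
      if j = i \<and> ?P w v then c' i w \<notin> X (Suc l) (z j) v else c' i w \<in> X M (z j) v"
    by (rule difference_boundD[OF R, where X = X and c = "\<lambda>i w. \<sigma> r i (d w)"];
        rule chainX thickX closed ci that; assumption)
  have main: "if i' # w' = i # w \<and> u = replicate r None
        then c' i w \<notin> \<Phi> (Suc l) (u @ select (z # es) (i' # w'))
        else c' i w \<in> \<Phi> M (u @ select (z # es) (i' # w'))"
    if "i < N" "w \<in> ?W" "i' < N" "w' \<in> ?W" "u \<in> opt_words L r" for i w i' w' u
    using zc[OF that(1-3), of "(u, w')"] that by (auto simp: X_def select_Cons)
  show ?thesis
    unfolding separated_def l
  proof (intro exI[of _ "z # es"] exI[of _ "\<lambda>w. c' (hd w) (tl w)"] conjI ballI)
    fix v assume "v \<in> words N (Suc l)"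
    then obtain i w where v: "v = i # w" "i < N" "w \<in> ?W"
      by (auto simp: words_Suc)
    then show "c' (hd v) (tl v) \<in> carrier G"
      using zG by simp
    fix u v' assume u: "u \<in> opt_words L r" and "v' \<in> words N (Suc l)"
    then obtain i' w' where v': "v' = i' # w'" "i' < N" "w' \<in> ?W"
      by (auto simp: words_Suc)
    show "if v' = v \<and> u = replicate r None then c' (hd v) (tl v) \<notin> \<Phi> (Suc l) (u @ select (z # es) v')
           else c' (hd v) (tl v) \<in> \<Phi> M (u @ select (z # es) v')"
      using main[OF v(2,3) v'(2,3) u] by (simp only: v v' list.sel)
  qed (use es in simp)
qed

lemma separated_all: "r \<le> p \<Longrightarrow> separated r M L N"
proof (induction r arbitrary: M L N rule: inc_induct)
  case base
  then show ?case by (rule separated_top)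
next
  case (step r)
  show ?case by (rule separated_step) (use step in auto)
qed

text \<open>The group need not be commutative, so the \<open>d w\<close> with
  \<open>w \<in> S\<close> are multiplied along a list without repetitions. At a point outside
  \<open>S\<close> all factors lie deep in the chain. At a point of \<open>S\<close> exactly one
  factor fails, and \<open>mult3_not_mem\<close> cancels the products before and after it.\<close>

lemma independent_pattern:
  "\<exists>es. length es = Suc p \<and> (\<forall>S\<subseteq>words N (Suc p). \<exists>g\<in>carrier G. \<forall>w\<in>words N (Suc p).
     g \<in> \<Phi> (p + 4) (select es w) \<longleftrightarrow> w \<notin> S)"
proof -
  \<comment> \<open>\<open>d w\<close> fails at level \<open>p + 1\<close>, so
    \<open>mult3_not_mem\<close> wants the neighbouring products at level \<open>p + 5\<close>; a
    product loses two levels per factor.\<close>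
  define M where "M = p + 5 + 2 * card (words N (Suc p))"
  obtain es d where es: "length es = Suc p"
    and d: "\<forall>w\<in>words N (Suc p). d w \<in> carrier G \<and> (\<forall>u\<in>opt_words 0 0. \<forall>w'\<in>words N (Suc p).
           if w' = w \<and> u = replicate 0 None then d w \<notin> \<Phi> (Suc p) (u @ select es w')
           else d w \<in> \<Phi> M (u @ select es w'))"
    using separated_all[OF le0, of M 0 N, unfolded separated_def diff_zero]
    by (elim exE conjE)
  have dG: "d w \<in> carrier G" if "w \<in> words N (Suc p)" for w
    using d that by blast
  have d_mem: "if w' = w then d w \<notin> \<Phi> (Suc p) (select es w') else d w \<in> \<Phi> M (select es w')"
    if "w \<in> words N (Suc p)" "w' \<in> words N (Suc p)" for w w'
    using d[THEN bspec, OF that(1), THEN conjunct2, THEN bspec, of "[]", THEN bspec, OF _ that(2)]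
    by (auto simp: opt_words_0 split: if_splits)
  have "\<exists>g\<in>carrier G. \<forall>w\<in>words N (Suc p). g \<in> \<Phi> (p + 4) (select es w) \<longleftrightarrow> w \<notin> S"
    if S: "S \<subseteq> words N (Suc p)" for S
  proof -
    obtain ws where ws: "set ws = S" "distinct ws"
      using finite_distinct_list[OF finite_subset[OF S finite_words]] by blast
    let ?g = "\<lambda>vs. foldr (\<otimes>) (map d vs) \<one>"
    have dsG: "set (map d vs) \<subseteq> carrier G" if "set vs \<subseteq> S" for vs
      using that S dG by auto
    have lenw: "length ws \<le> card (words N (Suc p))"
      using card_mono[OF finite_words S] distinct_card[OF ws(2)] ws(1) by simp
    have mem: "?g vs \<in> \<Phi> (p + 5) (select es w) \<inter> carrier G"
      if "set vs \<subseteq> S" "w \<notin> set vs" "w \<in> words N (Suc p)" "length vs \<le> length ws"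
        "approx_chain G (\<lambda>m. \<Phi> m (select es w))" for vs w
    proof -
      interpret approx_chain G "\<lambda>m. \<Phi> m (select es w)"
        by fact
      have "d x \<in> \<Phi> (p + 5 + 2 * length vs) (select es w)" if "x \<in> set vs" for x
      proof (rule mono_mem)
        have x: "x \<in> words N (Suc p)" "w \<noteq> x"
          using S that \<open>set vs \<subseteq> S\<close> \<open>w \<notin> set vs\<close> by auto
        show "d x \<in> carrier G" "d x \<in> \<Phi> M (select es w)"
          using dG[OF x(1)] d_mem[OF x(1) \<open>w \<in> words N (Suc p)\<close>] x(2) by simp_all
        show "p + 5 + 2 * length vs \<le> M"
          using lenw \<open>length vs \<le> length ws\<close> by (simp add: M_def)
      qed
      then show ?thesis
        using foldr_mem[of "map d vs" "p + 5"] dsG[OF that(1)] by auto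
    qed
    have "?g ws \<in> \<Phi> (p + 4) (select es w) \<longleftrightarrow> w \<notin> S" if w: "w \<in> words N (Suc p)" for w
    proof -
      have "length w = Suc p"
        using w by (simp add: words_def)
      then have "length (map2 (\<lambda>e i. e i) es w) = Suc p"
        using es by simp
      then obtain x y where xy: "map2 (\<lambda>e i. e i) es w = x @ [y]" "length x = p"
        unfolding length_Suc_conv_rev by blast
      have ch: "approx_chain G (\<lambda>m. \<Phi> m (select es w))"
        using chain[of "map Some x" y] xy unfolding select_eq_map_Some by simp
      interpret approx_chain G "\<lambda>m. \<Phi> m (select es w)"
        by (rule ch)
      show ?thesis
      proof (cases "w \<in> S")
        case False
        then show ?thesis
          using mem[of ws w] ws ch w mono_mem[of "?g ws" "p + 5" "p + 4"] by auto
      next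
        case True
        then obtain xs ys where xys: "ws = xs @ w # ys"
          using ws by (metis split_list)
        have "set xs \<subseteq> S" "set ys \<subseteq> S" "w \<notin> set xs" "w \<notin> set ys" "length xs \<le> length ws" "length ys \<le> length ws"
          using ws xys by auto
        then have "?g xs \<in> \<Phi> (p + 5) (select es w) \<inter> carrier G" "?g ys \<in> \<Phi> (p + 5) (select es w) \<inter> carrier G"
          using mem[OF _ _ w _ ch] by simp_all
        moreover have "d w \<in> carrier G" "d w \<notin> \<Phi> (Suc p) (select es w)"
          using dG[OF w] d_mem[OF w w] by simp_all
        ultimately have "?g xs \<otimes> (d w \<otimes> ?g ys) \<notin> \<Phi> (p + 4) (select es w)"
          using mult3_not_mem[of "?g xs" "d w" "?g ys" "Suc p"] by (simp add: eval_nat_numeral)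
        moreover have "?g ws = ?g xs \<otimes> (d w \<otimes> ?g ys)"
          using foldr_append_mult[of "map d xs" "map d (w # ys)"] dsG[of xs] dsG[of "w # ys"] True
            \<open>set xs \<subseteq> S\<close> \<open>set ys \<subseteq> S\<close> xys by simp
        ultimately show ?thesis
          using True by simp
      qed
    qed
    moreover have "?g ws \<in> carrier G"
      using dsG[of ws] ws by (simp add: foldr_closed)
    ultimately show ?thesis
      by blast
  qed
  then show ?thesis
    using es by blast
qed

end

section \<open>Definable sets\<close>

fun rename_tm :: "(nat \<Rightarrow> nat) \<Rightarrow> 'f tm \<Rightarrow> 'f tm" where
  "rename_tm f (Var i) = Var (f i)"
| "rename_tm f (Fun g ts) = Fun g (map (rename_tm f) ts)"

lemma wf_rename_tm: "wf_tm L t \<Longrightarrow> wf_tm L (rename_tm f t)"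
  by (induction t) auto

lemma fv_rename_tm: "fv_tm (rename_tm f t) = f ` fv_tm t"
  by (induction t) auto

lemma eval_rename_tm: "eval_tm M e (rename_tm f t) = eval_tm M (e \<circ> f) t"
  by (induction t) (auto cong: map_cong)

lemma eval_tm_cong: "(\<And>i. i \<in> fv_tm t \<Longrightarrow> e i = e' i) \<Longrightarrow> eval_tm M e t = eval_tm M e' t"
proof (induction t)
  case (Fun g ts)
  have "map (eval_tm M e) ts = map (eval_tm M e') ts"
    using Fun by (intro map_cong) auto
  then show ?case by (simp only: eval_tm.simps)
qed simp

lemma sat_cong: "(\<And>i. i \<in> fv \<phi> \<Longrightarrow> e i = e' i) \<Longrightarrow> sat M e \<phi> = sat M e' \<phi>"
proof (induction \<phi> arbitrary: e e')
  case (Eq s t)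
  then show ?case using eval_tm_cong[of s e e' M] eval_tm_cong[of t e e' M] by simp
next
  case (Rel r ts)
  have "map (eval_tm M e) ts = map (eval_tm M e') ts"
    using Rel by (intro map_cong[OF refl] eval_tm_cong) auto
  then show ?case by (simp only: sat.simps)
next
  case (Neg \<phi>)
  show ?case using Neg.IH[of e e'] Neg.prems by simp
next
  case (Conj \<phi> \<psi>)
  show ?case using Conj.IH(1)[of e e'] Conj.IH(2)[of e e'] Conj.prems by simp
next
  case (Exists i \<phi>)
  have "sat M (e(i := a)) \<phi> = sat M (e'(i := a)) \<phi>" for a
    using Exists.prems by (intro Exists.IH) auto
  then show ?case by simp
qed

lemma finite_fv_tm: "finite (fv_tm t)"
  by (induction t) auto

lemma finite_fv: "finite (fv \<phi>)"
  by (induction \<phi>) (auto simp: finite_fv_tm)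

text \<open>\<open>f\<close> may identify variables, and a bound variable might capture the image of
  a free one. At a quantifier the bound variable is therefore sent to some \<open>j\<close> outside
  the image of the other free variables; as \<open>j\<close> is arbitrary, existence is claimed
  instead of defining a renaming function.\<close>

lemma rename_fm:
  "wf_fm L \<phi> \<Longrightarrow> \<exists>\<phi>'. wf_fm L \<phi>' \<and> fv \<phi>' \<subseteq> f ` fv \<phi> \<and> (\<forall>M :: ('a, 'f, 'r) fo_struct. \<forall>e. sat M e \<phi>' = sat M (e \<circ> f) \<phi>)"
proof (induction \<phi> arbitrary: f)
  case (Eq s t)
  then show ?case
    by (intro exI[of _ "Eq (rename_tm f s) (rename_tm f t)"])
      (auto simp: wf_rename_tm fv_rename_tm eval_rename_tm comp_def)
next
  case (Rel r ts)
  then show ?case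
    by (intro exI[of _ "Rel r (map (rename_tm f) ts)"])
      (auto simp: wf_rename_tm fv_rename_tm eval_rename_tm comp_def)
next
  case (Neg \<phi>)
  then obtain \<phi>' where "wf_fm L \<phi>'" "fv \<phi>' \<subseteq> f ` fv \<phi>"
      "\<forall>M :: ('a, 'f, 'r) fo_struct. \<forall>e. sat M e \<phi>' = sat M (e \<circ> f) \<phi>"
    by (metis wf_fm.simps(3))
  then show ?case
    by (intro exI[of _ "Neg \<phi>'"]) (simp add: comp_def)
next
  case (Conj \<phi> \<psi>)
  then obtain \<phi>' \<psi>' where "wf_fm L \<phi>'" "fv \<phi>' \<subseteq> f ` fv \<phi>"
      "\<forall>M :: ('a, 'f, 'r) fo_struct. \<forall>e. sat M e \<phi>' = sat M (e \<circ> f) \<phi>"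
      "wf_fm L \<psi>'" "fv \<psi>' \<subseteq> f ` fv \<psi>"
      "\<forall>M :: ('a, 'f, 'r) fo_struct. \<forall>e. sat M e \<psi>' = sat M (e \<circ> f) \<psi>"
    by (metis wf_fm.simps(4))
  then show ?case
    by (intro exI[of _ "Conj \<phi>' \<psi>'"]) (auto simp: comp_def)
next
  case (Exists i \<phi>)
  obtain j where j: "j \<notin> f ` (fv \<phi> - {i})"
    using ex_new_if_finite[of "f ` (fv \<phi> - {i})"] finite_fv[of \<phi>] by auto
  obtain \<phi>' where \<phi>': "wf_fm L \<phi>'" "fv \<phi>' \<subseteq> (f(i := j)) ` fv \<phi>"
      "\<forall>M :: ('a, 'f, 'r) fo_struct. \<forall>e. sat M e \<phi>' = sat M (e \<circ> f(i := j)) \<phi>"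
    using Exists by (metis wf_fm.simps(5))
  have "sat M (e(j := a) \<circ> f(i := j)) \<phi> = sat M ((e \<circ> f)(i := a)) \<phi>"
    for M :: "('a, 'f, 'r) fo_struct" and e a
    using j by (intro sat_cong) auto
  then have "\<forall>M :: ('a, 'f, 'r) fo_struct. \<forall>e. sat M e (Exists j \<phi>') = sat M (e \<circ> f) (Exists i \<phi>)"
    using \<phi>'(3) by simp
  moreover have "fv (Exists j \<phi>') \<subseteq> f ` fv (Exists i \<phi>)"
    using \<phi>'(2) by auto
  ultimately show ?case
    using \<phi>'(1) by (intro exI[of _ "Exists j \<phi>'"]) (simp add: comp_def)
qed

text \<open>Reading the arguments off at positions \<open>is\<close> covers permutations,
  repetitions and dummy variables at once. All later rearrangements of variables and parameters go
  through this lemma.\<close>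

lemma holds_reindex:
  fixes M :: "('a, 'f, 'r) fo_struct"
  assumes "\<phi> \<in> formulas L (length is)" "set is \<subseteq> {..<m}"
  shows "\<exists>\<phi>'\<in>formulas L m. \<forall>x :: 'a list. holds M \<phi>' x = holds M \<phi> (map ((!) x) is)"
proof -
  define f where "f i = (if i < length is then is ! i else i)" for i
  obtain \<phi>' where \<phi>': "wf_fm L \<phi>'" "fv \<phi>' \<subseteq> f ` fv \<phi>"
      "\<forall>e. sat M e \<phi>' = sat M (e \<circ> f) \<phi>"
    using assms(1) rename_fm[of L \<phi> f] unfolding formulas_def by blast
  have "f ` fv \<phi> \<subseteq> {..<m}"
    using assms by (force simp: formulas_def f_def)
  moreover have "sat M (\<lambda>i. x ! i) \<phi>' = sat M (\<lambda>i. map ((!) x) is ! i) \<phi>" for x :: "'a list"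
    unfolding \<phi>'(3)[rule_format]
    using assms by (intro sat_cong) (auto simp: f_def formulas_def)
  ultimately show ?thesis
    using \<phi>' by (intro bexI[of _ \<phi>']) (auto simp: holds_def formulas_def)
qed

lemma holds_append: "\<phi> \<in> formulas L (length x) \<Longrightarrow> holds M \<phi> (x @ y) = holds M \<phi> x"
  unfolding holds_def by (intro sat_cong) (auto simp: formulas_def nth_append)

lemma formulas_mono: "m \<le> m' \<Longrightarrow> formulas L m \<subseteq> formulas L m'"
  by (auto simp: formulas_def)

lemma tuples_Suc: "tuples X (Suc l) = {z @ [a] | z a. z \<in> tuples X l \<and> a \<in> X}"
  by (auto simp: tuples_def length_Suc_conv_rev)

lemma holds_Exists:
  assumes "\<phi> \<in> formulas L (k + l)"
  shows "\<exists>\<psi>\<in>formulas L k. \<forall>x. length x = k \<longrightarrow>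
    (holds M \<psi> x \<longleftrightarrow> (\<exists>z\<in>tuples (universe M) l. holds M \<phi> (x @ z)))"
  using assms
proof (induction l arbitrary: \<phi>)
  case 0
  then show ?case
    by (intro bexI[of _ \<phi>]) (auto simp: tuples_def)
next
  case (Suc l)
  have "Exists (k + l) \<phi> \<in> formulas L (k + l)"
    using Suc.prems by (auto simp: formulas_def)
  then obtain \<psi> where \<psi>: "\<psi> \<in> formulas L k" "\<And>x. length x = k \<Longrightarrow>
    holds M \<psi> x \<longleftrightarrow> (\<exists>z\<in>tuples (universe M) l. holds M (Exists (k + l) \<phi>) (x @ z))"
    using Suc.IH by blast
  have ex: "holds M (Exists (k + l) \<phi>) (x @ z) \<longleftrightarrow> (\<exists>a\<in>universe M. holds M \<phi> (x @ z @ [a]))"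
    if "length x = k" "z \<in> tuples (universe M) l" for x z
  proof -
    have "sat M ((\<lambda>i. (x @ z) ! i)(k + l := a)) \<phi> = sat M (\<lambda>i. (x @ z @ [a]) ! i) \<phi>" for a
      using that Suc.prems
      by (intro sat_cong) (auto simp: formulas_def tuples_def nth_append less_Suc_eq)
    then show ?thesis
      by (simp add: holds_def)
  qed
  have "holds M \<psi> x \<longleftrightarrow> (\<exists>z\<in>tuples (universe M) (Suc l). holds M \<phi> (x @ z))" if "length x = k" for x
    using \<psi>(2)[OF that] ex[OF that] unfolding tuples_Suc by fastforce
  then show ?case
    using \<psi>(1) by blast
qed

text \<open>Definability is handled through sets, so that formulas have to be manipulated only in
  the closure properties below.\<close>

definition Def :: "('f, 'r) lang \<Rightarrow> ('a, 'f, 'r) fo_struct \<Rightarrow> 'a set \<Rightarrow> nat \<Rightarrow> 'a list set set" where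
  "Def L M C k = {{x \<in> tuples (universe M) k. holds M \<phi> (x @ c)} | \<phi> c.
     set c \<subseteq> C \<and> \<phi> \<in> formulas L (k + length c)}"

lemma DefI: "set c \<subseteq> C \<Longrightarrow> \<phi> \<in> formulas L (k + length c) \<Longrightarrow>
    X = {x \<in> tuples (universe M) k. holds M \<phi> (x @ c)} \<Longrightarrow> X \<in> Def L M C k"
  unfolding Def_def by blast

lemma DefE:
  assumes "X \<in> Def L M C k"
  obtains \<phi> c where "set c \<subseteq> C" "\<phi> \<in> formulas L (k + length c)"
    "X = {x \<in> tuples (universe M) k. holds M \<phi> (x @ c)}"
  using assms unfolding Def_def by blast

lemma Def_subset: "X \<in> Def L M C k \<Longrightarrow> X \<subseteq> tuples (universe M) k"
  by (auto simp: Def_def)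

lemma Def_mono: "C \<subseteq> C' \<Longrightarrow> X \<in> Def L M C k \<Longrightarrow> X \<in> Def L M C' k"
  by (fastforce simp: Def_def)

lemma map_nth_upt: "j \<le> length xs \<Longrightarrow> map ((!) xs) [i..<j] = take (j - i) (drop i xs)"
  by (intro nth_equalityI) auto

lemma Def_reindex:
  fixes M :: "('a, 'f, 'r) fo_struct"
  assumes "X \<in> Def L M C (length is)" "set is \<subseteq> {..<m}"
  shows "{x \<in> tuples (universe M) m. map ((!) x) is \<in> X} \<in> Def L M C m"
proof -
  obtain \<phi> c where \<phi>: "set c \<subseteq> C" "\<phi> \<in> formulas L (length is + length c)"
      "X = {x \<in> tuples (universe M) (length is). holds M \<phi> (x @ c)}"
    using assms(1) by (rule DefE)
  let ?is = "is @ [m..<m + length c]"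
  have sub: "set ?is \<subseteq> {..<m + length c}"
    using assms(2) by auto
  obtain \<phi>' where \<phi>': "\<phi>' \<in> formulas L (m + length c)"
      "\<forall>x :: 'a list. holds M \<phi>' x = holds M \<phi> (map ((!) x) ?is)"
    using holds_reindex[of \<phi> L ?is "m + length c" M, OF _ sub] \<phi>(2) assms(2) by auto
  have "holds M \<phi>' (x @ c) \<longleftrightarrow> map ((!) x) is \<in> X" if "x \<in> tuples (universe M) m" for x
  proof -
    have eq: "map ((!) (x @ c)) is = map ((!) x) is" and "map ((!) x) is \<in> tuples (universe M) (length is)"
      using that assms(2) by (auto simp: tuples_def nth_append subset_eq intro!: nth_mem)
    moreover have "map ((!) (x @ c)) [m..<m + length c] = c"
      using that by (simp add: tuples_def map_nth_upt)
    ultimately show ?thesis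
      unfolding \<phi>(3) \<phi>'(2)[rule_format] map_append eq by simp
  qed
  then show ?thesis
    using \<phi> \<phi>' by (intro DefI[of c _ \<phi>']) auto
qed

lemma Def_pull:
  assumes "X \<in> Def L M C l" "C \<subseteq> B" "length is = l" "set is \<subseteq> {..<m}"
  shows "{w \<in> tuples (universe M) m. map ((!) w) is \<in> X} \<in> Def L M B m"
  using Def_reindex[of X L M C "is" m] Def_mono[OF assms(2)] assms by blast

lemma Def_Int:
  fixes M :: "('a, 'f, 'r) fo_struct"
  assumes "X \<in> Def L M C k" "Y \<in> Def L M C k"
  shows "X \<inter> Y \<in> Def L M C k"
proof -
  obtain \<phi> c where \<phi>: "set c \<subseteq> C" "\<phi> \<in> formulas L (k + length c)"
      "X = {x \<in> tuples (universe M) k. holds M \<phi> (x @ c)}"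
    using assms(1) by (rule DefE)
  obtain \<psi> d where \<psi>: "set d \<subseteq> C" "\<psi> \<in> formulas L (k + length d)"
      "Y = {x \<in> tuples (universe M) k. holds M \<psi> (x @ d)}"
    using assms(2) by (rule DefE)
  \<comment> \<open>The parameters are concatenated to \<open>c @ d\<close>, so
    \<open>\<psi>\<close> has to skip the block \<open>c\<close>.\<close>
  let ?is = "[0..<k] @ [k + length c..<k + length c + length d]"
  have sub: "set ?is \<subseteq> {..<k + length c + length d}"
    by auto
  obtain \<psi>' where \<psi>': "\<psi>' \<in> formulas L (k + length c + length d)"
      "\<forall>x :: 'a list. holds M \<psi>' x = holds M \<psi> (map ((!) x) ?is)"
    using holds_reindex[of \<psi> L ?is "k + length c + length d" M, OF _ sub] \<psi>(2) by auto
  have "holds M \<psi>' (x @ c @ d) = holds M \<psi> (x @ d)" "holds M \<phi> (x @ c @ d) = holds M \<phi> (x @ c)"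
    if "x \<in> tuples (universe M) k" for x
    using that \<psi>'(2) \<phi>(2) holds_append[of \<phi> L "x @ c" M d]
    by (simp_all add: tuples_def map_nth_upt)
  then show ?thesis
    using \<phi> \<psi> \<psi>'(1) by (intro DefI[of "c @ d" _ "Conj \<phi> \<psi>'"]) (auto simp: holds_def formulas_def)
qed

lemma Def_Diff:
  assumes "X \<in> Def L M C k"
  shows "tuples (universe M) k - X \<in> Def L M C k"
proof -
  obtain \<phi> c where \<phi>: "set c \<subseteq> C" "\<phi> \<in> formulas L (k + length c)"
      "X = {x \<in> tuples (universe M) k. holds M \<phi> (x @ c)}"
    using assms(1) by (rule DefE)
  then show ?thesis
    by (intro DefI[of c _ "Neg \<phi>"]) (auto simp: holds_def formulas_def)
qed

lemma Def_Un:
  assumes "X \<in> Def L M C k" "Y \<in> Def L M C k"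
  shows "X \<union> Y \<in> Def L M C k"
proof -
  let ?U = "tuples (universe M) k"
  have "X \<union> Y = ?U - ((?U - X) \<inter> (?U - Y))"
    using assms[THEN Def_subset] by auto
  then show ?thesis
    using assms by (simp add: Def_Diff Def_Int)
qed

lemma Def_UNIV: "tuples (universe M) k \<in> Def L M C k"
\<comment> \<open>A true sentence, and not \<open>Eq (Var 0) (Var 0)\<close>: for
  \<open>k = 0\<close> no free variable is available.\<close>
proof (intro DefI[of "[]" C "Neg (Exists 0 (Neg (Eq (Var 0) (Var 0))))"])
qed (auto simp: formulas_def holds_def)

lemma Def_INT:
  assumes "finite I" "\<And>i. i \<in> I \<Longrightarrow> X i \<in> Def L M C k"
  shows "tuples (universe M) k \<inter> (\<Inter>i\<in>I. X i) \<in> Def L M C k"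
  using assms
proof (induction I)
  case empty
  then show ?case by (simp add: Def_UNIV)
next
  case (insert i I)
  have "tuples (universe M) k \<inter> (\<Inter>i\<in>insert i I. X i) = X i \<inter> (tuples (universe M) k \<inter> (\<Inter>i\<in>I. X i))"
    by auto
  then show ?case
    using insert by (simp add: Def_Int)
qed

lemma Def_proj:
  fixes M :: "('a, 'f, 'r) fo_struct"
  assumes "X \<in> Def L M C (m + l)"
  shows "{x \<in> tuples (universe M) m. \<exists>z\<in>tuples (universe M) l. x @ z \<in> X} \<in> Def L M C m"
proof -
  obtain \<phi> c where \<phi>: "set c \<subseteq> C" "\<phi> \<in> formulas L (m + l + length c)"
      "X = {x \<in> tuples (universe M) (m + l). holds M \<phi> (x @ c)}"
    using assms(1) by (rule DefE)
  \<comment> \<open>\<open>holds_Exists\<close> quantifies over the last variables, but the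
    parameters stand last; the block to be projected away is moved behind them.\<close>
  let ?is = "[0..<m] @ [m + length c..<m + length c + l] @ [m..<m + length c]"
  have sub: "set ?is \<subseteq> {..<m + length c + l}"
    by auto
  obtain \<phi>' where \<phi>': "\<phi>' \<in> formulas L (m + length c + l)"
      "\<forall>x :: 'a list. holds M \<phi>' x = holds M \<phi> (map ((!) x) ?is)"
    using holds_reindex[of \<phi> L ?is "m + length c + l" M, OF _ sub] \<phi>(2) by (auto simp: add_ac)
  obtain \<psi> where \<psi>: "\<psi> \<in> formulas L (m + length c)" "\<And>x. length x = m + length c \<Longrightarrow>
    holds M \<psi> x \<longleftrightarrow> (\<exists>z\<in>tuples (universe M) l. holds M \<phi>' (x @ z))"
    using holds_Exists[OF \<phi>'(1)] by blast
  have "holds M \<psi> (x @ c) \<longleftrightarrow> (\<exists>z\<in>tuples (universe M) l. x @ z \<in> X)"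
    if "x \<in> tuples (universe M) m" for x
  proof -
    have "holds M \<phi>' ((x @ c) @ z) \<longleftrightarrow> x @ z \<in> X" if "z \<in> tuples (universe M) l" for z
      using that \<open>x \<in> tuples (universe M) m\<close> \<phi>'(2) \<phi>(3)
      by (simp add: tuples_def map_nth_upt)
    then show ?thesis
      using \<psi>(2)[of "x @ c"] that by (simp add: tuples_def)
  qed
  then show ?thesis
    using \<phi>(1) \<psi>(1) by (intro DefI[of c _ \<psi>]) auto
qed

lemma Def_fiber:
  assumes "X \<in> Def L M C (m + l)" "y \<in> tuples (universe M) l"
  shows "{x \<in> tuples (universe M) m. x @ y \<in> X} \<in> Def L M (C \<union> set y) m"
proof -
  obtain \<phi> c where \<phi>: "set c \<subseteq> C" "\<phi> \<in> formulas L (m + l + length c)"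
      "X = {x \<in> tuples (universe M) (m + l). holds M \<phi> (x @ c)}"
    using assms(1) by (rule DefE)
  then show ?thesis
    using assms(2) by (intro DefI[of "y @ c" _ \<phi>]) (auto simp: tuples_def add.assoc)
qed

text \<open>The parameters taken from \<open>y\<close> may occur in any order and number. Here they
  are replaced by the whole of \<open>y\<close> as one block in a fixed place, so that conjugates of
  \<open>y\<close> can be substituted later.\<close>

lemma Def_unfiber:
  fixes M :: "('a, 'f, 'r) fo_struct"
  assumes "X \<in> Def L M (C \<union> set y) k"
  shows "\<exists>\<phi> d. set d \<subseteq> C \<and> \<phi> \<in> formulas L (k + length y + length d) \<and>
    X = {x \<in> tuples (universe M) k. holds M \<phi> (x @ y @ d)}"
proof -
  obtain \<phi> c where \<phi>: "set c \<subseteq> C \<union> set y" "\<phi> \<in> formulas L (k + length c)"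
      "X = {x \<in> tuples (universe M) k. holds M \<phi> (x @ c)}"
    using assms(1) by (rule DefE)
  define d where "d = filter (\<lambda>z. z \<in> C) c"
  have "\<forall>z\<in>set c. \<exists>i<length (y @ d). (y @ d) ! i = z"
  proof
    fix z assume "z \<in> set c"
    then have "z \<in> set (y @ d)"
      using \<phi>(1) by (auto simp: d_def)
    then show "\<exists>i<length (y @ d). (y @ d) ! i = z"
      by (metis in_set_conv_nth)
  qed
  then obtain f where f: "\<And>z. z \<in> set c \<Longrightarrow> f z < length (y @ d) \<and> (y @ d) ! f z = z"
    by metis
  let ?is = "[0..<k] @ map (\<lambda>z. k + f z) c"
  have "set ?is \<subseteq> {..<k + length y + length d}"
    using f by fastforce
  then obtain \<phi>' where \<phi>': "\<phi>' \<in> formulas L (k + length y + length d)"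
      "\<forall>x :: 'a list. holds M \<phi>' x = holds M \<phi> (map ((!) x) ?is)"
    using holds_reindex[of \<phi> L ?is "k + length y + length d" M] \<phi>(2) by auto
  have "map ((!) (x @ y @ d)) ?is = x @ c" if "x \<in> tuples (universe M) k" for x
  proof -
    have "map ((!) (x @ y @ d)) (map (\<lambda>z. k + f z) c) = map (\<lambda>z. z) c"
      unfolding map_map using f that by (intro map_cong) (auto simp: nth_append tuples_def)
    then show ?thesis
      using that by (simp add: tuples_def map_nth_upt)
  qed
  then show ?thesis
    using \<phi> \<phi>' by (intro exI[of _ \<phi>'] exI[of _ d]) (auto simp: d_def)
qed

lemma Def_eq_proj:
  fixes M :: "('a, 'f, 'r) fo_struct"
  assumes "i < m" "j < m"
  shows "{x \<in> tuples (universe M) m. x ! i = x ! j} \<in> Def L M C m"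
  using assms
  by (intro DefI[of "[]" C "Eq (Var i) (Var j)"]) (auto simp: formulas_def holds_def)

section \<open>Compactness from saturation\<close>

definition solutions :: "('a, 'f, 'r) fo_struct \<Rightarrow> nat \<Rightarrow> ('f, 'r) fm \<times> 'a list \<Rightarrow> 'a list set" where
  "solutions M k s = {x \<in> tuples (universe M) k. holds M (fst s) (x @ snd s)}"

lemma realizations_eq_solutions: "realizations M k \<Sigma> = tuples (universe M) k \<inter> (\<Inter>s\<in>\<Sigma>. solutions M k s)"
  by (auto simp: realizations_def solutions_def split_beta)

lemma Def_eq_solutions: "Def L M C k = solutions M k ` formulas_over L C k"
proof (intro equalityI subsetI)
  fix X assume "X \<in> Def L M C k"
  then obtain \<phi> c where "set c \<subseteq> C" "\<phi> \<in> formulas L (k + length c)"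
      "X = {x \<in> tuples (universe M) k. holds M \<phi> (x @ c)}"
    by (rule DefE)
  then show "X \<in> solutions M k ` formulas_over L C k"
    by (intro image_eqI[of _ _ "(\<phi>, c)"]) (simp_all add: solutions_def formulas_over_def)
next
  fix X assume "X \<in> solutions M k ` formulas_over L C k"
  then show "X \<in> Def L M C k"
    by (auto simp: formulas_over_def solutions_def intro: DefI[OF _ _ refl])
qed

lemma type_definable_iff:
  "type_definable L M k B X \<longleftrightarrow> (\<exists>F\<subseteq>Def L M B k. X = tuples (universe M) k \<inter> \<Inter>F)"
  unfolding type_definable_def realizations_eq_solutions Def_eq_solutions subset_image_iff
  by blast

lemma saturated_compact:
  assumes sat: "saturated L \<kappa> M" and C: "C \<subseteq> universe M" "|C| <o \<kappa>" and F: "F \<subseteq> Def L M C k"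
    and fin: "\<And>F0. F0 \<subseteq> F \<Longrightarrow> finite F0 \<Longrightarrow> \<exists>x\<in>tuples (universe M) k. \<forall>Y\<in>F0. x \<in> Y"
  shows "\<exists>x\<in>tuples (universe M) k. \<forall>Y\<in>F. x \<in> Y"
proof -
  obtain \<Sigma> where \<Sigma>: "\<Sigma> \<subseteq> formulas_over L C k" "F = solutions M k ` \<Sigma>"
    using F unfolding Def_eq_solutions subset_image_iff by blast
  have "realizations M k \<Sigma>0 \<noteq> {}" if "\<Sigma>0 \<subseteq> \<Sigma>" "finite \<Sigma>0" for \<Sigma>0
  proof -
    obtain x where "x \<in> tuples (universe M) k" "\<forall>Y\<in>solutions M k ` \<Sigma>0. x \<in> Y"
      using fin[of "solutions M k ` \<Sigma>0"] \<open>\<Sigma>0 \<subseteq> \<Sigma>\<close> \<open>finite \<Sigma>0\<close> \<Sigma>(2) by blast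
    then show ?thesis
      unfolding realizations_eq_solutions by blast
  qed
  then have "realizations M k \<Sigma> \<noteq> {}"
    using sat C \<Sigma>(1) unfolding saturated_def by blast
  then show ?thesis
    unfolding realizations_eq_solutions \<Sigma>(2) by blast
qed

section \<open>Automorphisms and equality of types\<close>

lemma eval_tm_closed:
  assumes "is_struct L M" "\<And>i. e i \<in> universe M"
  shows "wf_tm L t \<Longrightarrow> eval_tm M e t \<in> universe M"
proof (induction t)
  case (Fun f ts)
  then have "map (eval_tm M e) ts \<in> tuples (universe M) (length ts)"
    by (auto simp: tuples_def)
  then show ?case
    using Fun.prems assms(1) by (fastforce simp: is_struct_def)
qed (use assms in simp)

lemma automorphism_eval_tm:
  assumes "is_struct L M" "automorphism L M g" "\<And>i. e i \<in> universe M"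
  shows "wf_tm L t \<Longrightarrow> eval_tm M (\<lambda>i. g (e i)) t = g (eval_tm M e t)"
proof (induction t)
  case (Fun f ts)
  then have "map (eval_tm M e) ts \<in> tuples (universe M) (length ts)"
    using eval_tm_closed[OF assms(1,3)] by (auto simp: tuples_def)
  moreover have "map (eval_tm M (\<lambda>i. g (e i))) ts = map g (map (eval_tm M e) ts)"
    using Fun by auto
  ultimately show ?case
    using Fun.prems assms(2) unfolding automorphism_def by (fastforce simp del: map_map)
qed simp

lemma automorphism_sat:
  assumes "is_struct L M" "automorphism L M g"
  shows "wf_fm L \<phi> \<Longrightarrow> (\<And>i. e i \<in> universe M) \<Longrightarrow> sat M (\<lambda>i. g (e i)) \<phi> = sat M e \<phi>"
proof (induction \<phi> arbitrary: e)
  case (Eq s t)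
  then have "eval_tm M e s \<in> universe M" "eval_tm M e t \<in> universe M"
    using eval_tm_closed[OF assms(1)] by auto
  then show ?case
    using automorphism_eval_tm[OF assms, of e] Eq assms(2)
    by (auto simp: automorphism_def bij_betw_def inj_on_def)
next
  case (Rel r ts)
  then have "map (eval_tm M e) ts \<in> tuples (universe M) (length ts)"
    using eval_tm_closed[OF assms(1)] by (auto simp: tuples_def)
  moreover have "map (eval_tm M (\<lambda>i. g (e i))) ts = map g (map (eval_tm M e) ts)"
    using automorphism_eval_tm[OF assms, of e] Rel by auto
  ultimately show ?case
    using Rel.prems assms(2) unfolding automorphism_def by (fastforce simp del: map_map)
next
  case (Exists i \<phi>)
  have bij: "g ` universe M = universe M"
    using assms(2) by (auto simp: automorphism_def bij_betw_def)
  have "sat M (e(i := a)) \<phi> = sat M ((\<lambda>i. g (e i))(i := g a)) \<phi>" if "a \<in> universe M" for a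
  proof -
    have "sat M (\<lambda>k. g ((e(i := a)) k)) \<phi> = sat M (e(i := a)) \<phi>"
      using Exists.prems that by (intro Exists.IH) auto
    moreover have "(\<lambda>k. g ((e(i := a)) k)) = (\<lambda>i. g (e i))(i := g a)"
      by auto
    ultimately show ?thesis by simp
  qed
  then have "(\<exists>a\<in>universe M. sat M (e(i := a)) \<phi>) \<longleftrightarrow> (\<exists>a\<in>g ` universe M. sat M ((\<lambda>i. g (e i))(i := a)) \<phi>)"
    by auto
  then show ?case
    using bij by simp
qed auto

lemma automorphism_holds:
  assumes "is_struct L M" "automorphism L M g" "\<phi> \<in> formulas L (length x)" "set x \<subseteq> universe M"
  shows "holds M \<phi> (map g x) = holds M \<phi> x"
proof -
  \<comment> \<open>\<open>x ! i\<close> is unspecified beyond the length of \<open>x\<close>,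
    whereas \<open>automorphism_sat\<close> requires all values of the valuation to lie in the
    universe; \<open>a\<close> pads it.\<close>
  obtain a where a: "a \<in> universe M"
    using assms(1) by (auto simp: is_struct_def)
  define e where "e i = (if i < length x then x ! i else a)" for i
  have "holds M \<phi> x = sat M e \<phi>" "holds M \<phi> (map g x) = sat M (\<lambda>i. g (e i)) \<phi>"
    unfolding holds_def using assms(3) by (auto intro!: sat_cong simp: e_def formulas_def subset_eq)
  moreover have "e i \<in> universe M" for i
    using assms(4) a by (auto simp: e_def)
  ultimately show ?thesis
    using automorphism_sat[OF assms(1,2)] assms(3) by (simp add: formulas_def)
qed

text \<open>Homogeneity needs a map on elements, while the types speak of tuples. The map that fixes
  \<open>C\<close> and sends \<open>a\<close> entrywise to \<open>a'\<close> is well defined because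
  the types contain the equations among entries of \<open>a\<close> and between entries and elements
  of \<open>C\<close>.\<close>

lemma automorphism_of_tp:
  fixes M :: "('a, 'f, 'r) fo_struct"
  assumes hom: "homogeneous L \<kappa> M" and small: "|C \<union> set a| <o \<kappa>"
    and sub: "C \<subseteq> universe M" "set a \<subseteq> universe M" "set a' \<subseteq> universe M" "length a' = length a"
    and tp: "tp L M a' C = tp L M a C"
  shows "\<exists>g. automorphism L M g \<and> (\<forall>c\<in>C. g c = c) \<and> map g a = a'"
proof -
  have transfer: "holds M \<phi> (a' @ c) = holds M \<phi> (a @ c)"
    if "set c \<subseteq> C" "\<phi> \<in> formulas L (length a + length c)" for \<phi> c
  proof -
    have "(\<phi>, c) \<in> tp L M a C \<longleftrightarrow> holds M \<phi> (a @ c)" "(\<phi>, c) \<in> tp L M a' C \<longleftrightarrow> holds M \<phi> (a' @ c)"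
      using that sub by (auto simp: tp_def formulas_over_def)
    then show ?thesis using tp by simp
  qed
  have eq: "a' ! i = a' ! j" if "i < length a" "j < length a" "a ! i = a ! j" for i j
    using transfer[of "[]" "Eq (Var i) (Var j)"] that sub by (auto simp: formulas_def holds_def)
  have eqC: "a' ! i = a ! i" if "i < length a" "a ! i \<in> C" for i
    using transfer[of "[a ! i]" "Eq (Var i) (Var (length a))"] that sub
    by (auto simp: formulas_def holds_def nth_append)
  define h where "h x = (if x \<in> C then x else a' ! (SOME i. i < length a \<and> a ! i = x))" for x
  have ha: "h (a ! i) = a' ! i" if i: "i < length a" for i
  proof (cases "a ! i \<in> C")
    case True
    then show ?thesis using eqC i by (simp add: h_def)
  next
    case False
    define j where "j = (SOME j. j < length a \<and> a ! j = a ! i)"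
    have "j < length a \<and> a ! j = a ! i"
      unfolding j_def by (rule someI[of _ i]) (use i in simp)
    then show ?thesis
      using eq[of j i] i False by (simp add: h_def flip: j_def)
  qed
  have map_h: "map h a = a'"
    using ha sub by (intro nth_equalityI) auto
  have hC: "h c = c" if "c \<in> C" for c
    using that by (simp add: h_def)
  have "holds M \<phi> x = holds M \<phi> (map h x)"
    if "\<phi> \<in> formulas L k" "x \<in> tuples (C \<union> set a) k" for k \<phi> x
  proof -
    have x: "length x = k" "set x \<subseteq> C \<union> set a"
      using that by (auto simp: tuples_def)
    \<comment> \<open>\<open>x\<close> may mix entries of \<open>a\<close> with elements of
      \<open>C\<close> in any order; it is read off from the tuple \<open>a @ c\<close>, to which
      the equality of types applies.\<close>
    define c where "c = filter (\<lambda>z. z \<in> C) x"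
    have "\<forall>z\<in>set x. \<exists>i<length (a @ c). (a @ c) ! i = z"
    proof
      fix z assume "z \<in> set x"
      then have "z \<in> set (a @ c)"
        using x(2) by (auto simp: c_def)
      then show "\<exists>i<length (a @ c). (a @ c) ! i = z"
        by (metis in_set_conv_nth)
    qed
    then obtain f where f: "\<And>z. z \<in> set x \<Longrightarrow> f z < length (a @ c) \<and> (a @ c) ! f z = z"
      by metis
    have "set (map f x) \<subseteq> {..<length a + length c}"
      using f by fastforce
    then obtain \<phi>' where \<phi>': "\<phi>' \<in> formulas L (length a + length c)"
        "\<forall>y :: 'a list. holds M \<phi>' y = holds M \<phi> (map ((!) y) (map f x))"
      using holds_reindex[of \<phi> L "map f x" "length a + length c" M] \<open>\<phi> \<in> formulas L k\<close> x(1) by auto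
    have 1: "map ((!) (a @ c)) (map f x) = x"
      unfolding map_map using f by (intro map_idI) auto
    have "map h c = c"
      using hC by (intro map_idI) (simp add: c_def)
    then have "map ((!) (a' @ c)) (map f x) = map ((!) (map h (a @ c))) (map f x)"
      using map_h by (simp only: map_append)
    also have "\<dots> = map (\<lambda>i. h ((a @ c) ! i)) (map f x)"
      using f by (intro map_cong[OF refl] nth_map) fastforce
    also have "\<dots> = map h (map ((!) (a @ c)) (map f x))"
      by simp
    finally have 2: "map ((!) (a' @ c)) (map f x) = map h x"
      unfolding 1 .
    have "holds M \<phi>' (a' @ c) = holds M \<phi>' (a @ c)"
      using \<phi>'(1) by (intro transfer) (auto simp: c_def)
    then show ?thesis
      unfolding \<phi>'(2)[rule_format] 1 2 by simp
  qed
  moreover have "h ` (C \<union> set a) \<subseteq> universe M"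
  proof -
    have "h ` set a = set a'"
      using map_h by (metis list.set_map)
    then show ?thesis
      using hC sub by auto
  qed
  ultimately have "partial_elementary L M (C \<union> set a) h"
    using sub by (auto simp: partial_elementary_def)
  then obtain g where g: "automorphism L M g" "\<forall>c\<in>C \<union> set a. g c = h c"
    using hom small unfolding homogeneous_def by blast
  then have "map g a = map h a" "\<forall>c\<in>C. g c = c"
    using hC by auto
  then show ?thesis
    using g(1) map_h by auto
qed

section \<open>Type-definable groups in the monster model\<close>

text \<open>If no finite \<open>I0\<close> worked, the sets \<open>h i\<close> together with the
  complement of \<open>Z\<close> would be finitely satisfiable, and saturation would contradict
  \<open>cover\<close>. The family is indexed because its members are assembled from several
  definable sets, which a finite \<open>I0\<close> has to give back.\<close>

lemma compact_cover:
  assumes sat: "saturated L \<kappa> M" and C: "C \<subseteq> universe M" "|C| <o \<kappa>"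
    and h: "\<And>i. i \<in> I \<Longrightarrow> h i \<in> Def L M C k" and Z: "Z \<in> Def L M C k"
    and cover: "\<And>x. x \<in> tuples (universe M) k \<Longrightarrow> (\<And>i. i \<in> I \<Longrightarrow> x \<in> h i) \<Longrightarrow> x \<in> Z"
  obtains I0 where "I0 \<subseteq> I" "finite I0"
    "\<And>x. x \<in> tuples (universe M) k \<Longrightarrow> (\<And>i. i \<in> I0 \<Longrightarrow> x \<in> h i) \<Longrightarrow> x \<in> Z"
proof (rule ccontr)
  assume contra: "\<not> thesis"
  note found = that
  let ?F = "insert (tuples (universe M) k - Z) (h ` I)"
  have "?F \<subseteq> Def L M C k"
    using h Def_Diff[OF Z] by auto
  moreover have "\<exists>x\<in>tuples (universe M) k. \<forall>Y\<in>F0. x \<in> Y" if F0: "F0 \<subseteq> ?F" "finite F0" for F0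
  proof -
    have "F0 - {tuples (universe M) k - Z} \<subseteq> h ` I" "finite (F0 - {tuples (universe M) k - Z})"
      using F0 by auto
    then obtain I0 where I0: "I0 \<subseteq> I" "finite I0" "F0 - {tuples (universe M) k - Z} = h ` I0"
      by (meson finite_subset_image)
    have "\<not> (\<forall>x\<in>tuples (universe M) k. (\<forall>i\<in>I0. x \<in> h i) \<longrightarrow> x \<in> Z)"
      using contra found[OF I0(1,2)] by blast
    then obtain x where "x \<in> tuples (universe M) k" "\<forall>i\<in>I0. x \<in> h i" "x \<notin> Z"
      by blast
    then show ?thesis
      using I0(3) by (intro bexI[of _ x]) auto
  qed
  ultimately obtain x where x: "x \<in> tuples (universe M) k" "\<forall>Y\<in>?F. x \<in> Y"
    using saturated_compact[OF sat C, of ?F k] by blast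
  have "x \<in> Z"
    by (rule cover) (use x in auto)
  then show False
    using x(2) by auto
qed

lemma type_definable_supersets:
  assumes "type_definable L M k B X" "x \<in> tuples (universe M) k"
    "\<And>Y. Y \<in> Def L M B k \<Longrightarrow> X \<subseteq> Y \<Longrightarrow> x \<in> Y"
  shows "x \<in> X"
  using assms unfolding type_definable_iff by blast

lemma type_definable_mono: "B \<subseteq> B' \<Longrightarrow> type_definable L M k B X \<Longrightarrow> type_definable L M k B' X"
  unfolding type_definable_iff using Def_mono[of B B' _ L M k] by blast

lemma type_definable_subset: "type_definable L M k B X \<Longrightarrow> X \<subseteq> tuples (universe M) k"
  unfolding type_definable_iff by blast

lemma type_definable_Int:
  "type_definable L M k B X \<Longrightarrow> type_definable L M k B Y \<Longrightarrow> type_definable L M k B (X \<inter> Y)"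
proof -
  assume "type_definable L M k B X" "type_definable L M k B Y"
  then obtain F F' where "F \<subseteq> Def L M B k" "X = tuples (universe M) k \<inter> \<Inter>F"
      "F' \<subseteq> Def L M B k" "Y = tuples (universe M) k \<inter> \<Inter>F'"
    unfolding type_definable_iff by blast
  then show ?thesis
    unfolding type_definable_iff by (intro exI[of _ "F \<union> F'"]) blast
qed

lemma tuplesD: "x \<in> tuples X m \<Longrightarrow> length x = m"
  by (simp add: tuples_def)

lemma append_in_tuples: "x \<in> tuples X m \<Longrightarrow> y \<in> tuples X l \<Longrightarrow> x @ y \<in> tuples X (m + l)"
  by (auto simp: tuples_def)

lemma tuples_addE:
  assumes "w \<in> tuples X (m + l)"
  obtains x y where "w = x @ y" "x \<in> tuples X m" "y \<in> tuples X l"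
proof
  show "w = take m w @ drop m w" by simp
  show "take m w \<in> tuples X m" "drop m w \<in> tuples X l"
    using assms set_take_subset[of m w] set_drop_subset[of m w] by (auto simp: tuples_def)
qed

lemma automorphism_tuples:
  assumes "automorphism L M g" "x \<in> tuples (universe M) k"
  shows "map g x \<in> tuples (universe M) k"
proof -
  have "g ` universe M = universe M"
    using assms(1) by (simp add: automorphism_def bij_betw_def)
  then show ?thesis
    using assms(2) by (auto simp: tuples_def)
qed

lemma automorphism_type_definable:
  assumes "is_struct L M" "automorphism L M g" "\<And>c. c \<in> B \<Longrightarrow> g c = c" "B \<subseteq> universe M"
    and "type_definable L M k B X" "x \<in> tuples (universe M) k"
  shows "map g x \<in> X \<longleftrightarrow> x \<in> X"
proof -
  have gx: "map g x \<in> tuples (universe M) k"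
    using assms by (intro automorphism_tuples)
  have "map g x \<in> Y \<longleftrightarrow> x \<in> Y" if Y: "Y \<in> Def L M B k" for Y
  proof -
    obtain \<phi> c where \<phi>: "set c \<subseteq> B" "\<phi> \<in> formulas L (k + length c)"
        "Y = {x \<in> tuples (universe M) k. holds M \<phi> (x @ c)}"
      using Y by (rule DefE)
    have "map g c = c"
      using \<phi>(1) assms(3) by (intro map_idI) auto
    moreover have "holds M \<phi> (map g (x @ c)) = holds M \<phi> (x @ c)"
      using assms \<phi> by (intro automorphism_holds[of L]) (auto simp: tuples_def)
    ultimately show ?thesis
      using gx assms(6) \<phi>(3) by simp
  qed
  then show ?thesis
    using assms(5,6) gx unfolding type_definable_iff by blast
qed

lemma finite_card_of_ordLess: "finite X \<Longrightarrow> Cinfinite r \<Longrightarrow> |X| <o r"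
  by (rule Cfinite_ordLess_Cinfinite) (simp_all add: cfinite_def Field_card_of card_of_card_order_on)

locale monster_group = group G for G :: "'a list monoid" (structure) +
  fixes L :: "('f, 'r) lang" and \<kappa> :: "'k rel" and M :: "('a, 'f, 'r) fo_struct"
    and k :: nat and A :: "'a set"
  assumes struct: "is_struct L M"
    and regular: "Cinfinite \<kappa>" "regularCard \<kappa>"
    and saturated: "saturated L \<kappa> M" and homogeneous: "homogeneous L \<kappa> M"
    and A: "A \<subseteq> universe M" "|A| <o \<kappa>"
    and type_definable_group: "type_definable_group L M k A G"
begin

abbreviation U :: "nat \<Rightarrow> 'a list set" where "U m \<equiv> tuples (universe M) m"

lemma carrier_type_definable: "type_definable L M k A (carrier G)"
  using type_definable_group by (simp add: type_definable_group_def)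

lemma carrier_subset: "carrier G \<subseteq> U k"
  by (rule type_definable_subset[OF carrier_type_definable])

abbreviation graph :: "'a list set" where
  "graph \<equiv> {x @ y @ (x \<otimes> y) | x y. x \<in> carrier G \<and> y \<in> carrier G}"

lemma graph_type_definable: "type_definable L M (k + k + k) A graph"
  using type_definable_group by (simp add: type_definable_group_def)

lemma length_carrier: "x \<in> carrier G \<Longrightarrow> length x = k"
  using carrier_subset tuplesD by blast

lemma graph_iff:
  assumes "x \<in> U k" "y \<in> U k"
  shows "x @ y @ z \<in> graph \<longleftrightarrow> x \<in> carrier G \<and> y \<in> carrier G \<and> z = x \<otimes> y"
proof
  assume "x @ y @ z \<in> graph"
  then obtain x' y' where xy: "x @ y @ z = x' @ y' @ (x' \<otimes> y')" "x' \<in> carrier G" "y' \<in> carrier G"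
    by blast
  have "length x = length x'" "length y = length y'"
    using assms xy(2,3) by (simp_all add: length_carrier tuplesD)
  then show "x \<in> carrier G \<and> y \<in> carrier G \<and> z = x \<otimes> y"
    using xy by simp
qed blast

text \<open>That a product is unique is an inclusion: if \<open>x @ y @ z\<close> and
  \<open>x @ y @ z'\<close> lie in all definable supersets of the graph, then \<open>z = z'\<close>.
  By compactness finitely many supersets force this already. Their intersection contains the graph,
  so over \<open>x\<close> and \<open>y\<close> in the carrier it holds of the product and of
  nothing else.\<close>

lemma mult_definable:
  "\<exists>\<mu>\<in>Def L M A (k + k + k). \<forall>x\<in>carrier G. \<forall>y\<in>carrier G. \<forall>z\<in>U k. x @ y @ z \<in> \<mu> \<longleftrightarrow> z = x \<otimes> y"
proof -
  let ?S = "{Y \<in> Def L M A (k + k + k). graph \<subseteq> Y}"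
  let ?p = "[0..<k + k] @ [k + k + k..<k + k + k + k]"
  let ?h = "\<lambda>Y. {w \<in> U (k + k + k + k). map ((!) w) [0..<k + k + k] \<in> Y} \<inter>
    {w \<in> U (k + k + k + k). map ((!) w) ?p \<in> Y}"
  let ?Z = "U (k + k + k + k) \<inter> (\<Inter>i\<in>{..<k}. {w \<in> U (k + k + k + k). w ! (k + k + i) = w ! (k + k + k + i)})"
  have h_Def: "?h Y \<in> Def L M A (k + k + k + k)" if Y: "Y \<in> ?S" for Y
    by (intro Def_Int Def_pull[of Y L M A "k + k + k"]) (use Y in auto)
  have Z_Def: "?Z \<in> Def L M A (k + k + k + k)"
    by (intro Def_INT Def_eq_proj) auto
  have h_iff: "x @ y @ z @ z' \<in> ?h Y \<longleftrightarrow> x @ y @ z \<in> Y \<and> x @ y @ z' \<in> Y"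
    if "x \<in> U k" "y \<in> U k" "z \<in> U k" "z' \<in> U k" for x y z z' Y
    using that by (auto simp: tuples_def map_nth_upt)
  have Z_iff: "x @ y @ z @ z' \<in> ?Z \<longleftrightarrow> z = z'"
    if "x \<in> U k" "y \<in> U k" "z \<in> U k" "z' \<in> U k" for x y z z'
  proof -
    have "x @ y @ z @ z' \<in> ?Z \<longleftrightarrow> (\<forall>i<k. z ! i = z' ! i)"
      using that by (auto simp: tuples_def nth_append)
    then show ?thesis
      using that by (auto simp: tuples_def list_eq_iff_nth_eq)
  qed
  have split: "\<exists>x y z z'. w = x @ y @ z @ z' \<and> x \<in> U k \<and> y \<in> U k \<and> z \<in> U k \<and> z' \<in> U k"
    if "w \<in> U (k + k + k + k)" for w
    using that by (elim tuples_addE) (metis append_assoc)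
  obtain S0 where S0: "S0 \<subseteq> ?S" "finite S0"
    and cover: "\<And>w. w \<in> U (k + k + k + k) \<Longrightarrow> (\<And>Y. Y \<in> S0 \<Longrightarrow> w \<in> ?h Y) \<Longrightarrow> w \<in> ?Z"
  proof (rule compact_cover[OF saturated A h_Def Z_Def])
    fix w assume w: "w \<in> U (k + k + k + k)" and h: "\<And>Y. Y \<in> ?S \<Longrightarrow> w \<in> ?h Y"
    obtain x y z z' where xyz: "w = x @ y @ z @ z'" "x \<in> U k" "y \<in> U k" "z \<in> U k" "z' \<in> U k"
      using split[OF w] by blast
    have mem: "x @ y @ z \<in> Y \<and> x @ y @ z' \<in> Y" if "Y \<in> ?S" for Y
      using h[OF that] unfolding xyz(1) h_iff[OF xyz(2-5)] .
    have "v = x \<otimes> y" if "v \<in> {z, z'}" for v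
    proof -
      have "x @ y @ v \<in> graph"
        by (rule type_definable_supersets[OF graph_type_definable])
          (use that xyz mem in \<open>auto intro!: append_in_tuples simp: add.assoc\<close>)
      then show ?thesis
        using graph_iff[OF xyz(2,3)] by blast
    qed
    from this[of z] this[of z'] have "z = z'"
      by simp
    then show "w \<in> ?Z"
      using Z_iff xyz by simp
  qed auto
  show ?thesis
  proof (intro bexI[of _ "U (k + k + k) \<inter> (\<Inter>Y\<in>S0. Y)"] ballI)
    show "U (k + k + k) \<inter> (\<Inter>Y\<in>S0. Y) \<in> Def L M A (k + k + k)"
      using S0 by (intro Def_INT) auto
    fix x y z assume xyz: "x \<in> carrier G" "y \<in> carrier G" "z \<in> U k"
    then have U: "x \<in> U k" "y \<in> U k" "x \<otimes> y \<in> U k"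
      using carrier_subset by auto
    have m: "x @ y @ (x \<otimes> y) \<in> Y" if "Y \<in> S0" for Y
      using that S0(1) xyz by blast
    show "x @ y @ z \<in> U (k + k + k) \<inter> (\<Inter>Y\<in>S0. Y) \<longleftrightarrow> z = x \<otimes> y"
    proof
      assume "x @ y @ z \<in> U (k + k + k) \<inter> (\<Inter>Y\<in>S0. Y)"
      then have "x @ y @ z @ (x \<otimes> y) \<in> ?h Y" if "Y \<in> S0" for Y
        using m[OF that] that by (subst h_iff[OF U(1,2) xyz(3) U(3)]) auto
      moreover have "x @ y @ z @ (x \<otimes> y) \<in> U (k + k + k + k)"
        using U xyz(3) by (auto simp: tuples_def)
      ultimately have "x @ y @ z @ (x \<otimes> y) \<in> ?Z"
        by (intro cover)
      then show "z = x \<otimes> y"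
        using Z_iff[OF U(1,2) xyz(3) U(3)] by simp
    next
      assume "z = x \<otimes> y"
      then show "x @ y @ z \<in> U (k + k + k) \<inter> (\<Inter>Y\<in>S0. Y)"
        using m U by (auto simp: tuples_def)
    qed
  qed
qed

lemma coset_representative:
  assumes "subgroup H G"
  obtains R where "R \<subseteq> carrier G" "|R| \<le>o |rcosets H|"
    "\<And>x. x \<in> carrier G \<Longrightarrow> \<exists>r\<in>R. x \<otimes> inv r \<in> H"
proof -
  interpret H: subgroup H G by fact
  define rep where "rep C = (SOME a. a \<in> carrier G \<and> C = H #> a)" for C
  have rep: "rep C \<in> carrier G \<and> C = H #> rep C" if "C \<in> rcosets H" for C
    using that unfolding rep_def RCOSETS_def by - (rule someI_ex, blast)
  show thesis
  proof (rule that[of "rep ` (rcosets H)"])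
    show "rep ` (rcosets H) \<subseteq> carrier G"
      using rep by blast
    show "|rep ` (rcosets H)| \<le>o |rcosets H|"
      by (rule card_of_image)
    fix x assume x: "x \<in> carrier G"
    define r where "r = rep (H #> x)"
    have C: "H #> x \<in> rcosets H"
      using x by (auto simp: RCOSETS_def)
    have r: "r \<in> carrier G" "H #> x = H #> r"
      using rep[OF C] by (simp_all add: r_def)
    have "x \<in> H #> r"
      using r(2) rcos_self[OF x assms] by simp
    then obtain h where h: "h \<in> H" "x = h \<otimes> r"
      by (auto simp: r_coset_def)
    then have "x \<otimes> inv r = h"
      using r(1) H.mem_carrier by (simp add: m_assoc)
    then have "x \<otimes> inv (rep (H #> x)) \<in> H"
      using h(1) by (simp add: r_def)
    then show "\<exists>r\<in>rep ` (rcosets H). x \<otimes> inv r \<in> H"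
      using C by blast
  qed
qed

text \<open>The statement for \<open>H\<close> itself is that \<open>x\<close>, \<open>y\<close> in
  \<open>H\<close> and \<open>z\<close> in the carrier with \<open>z \<otimes> y = x\<close> imply
  \<open>z \<in> X\<close>. Stated in this way it uses only the definable relation
  \<open>\<mu>\<close>, with no inverse. Compactness replaces \<open>H\<close> and the carrier by
  finitely many definable supersets, and \<open>Y\<close> is the intersection of those of
  \<open>H\<close>.\<close>

lemma difference_definable:
  assumes B: "A \<subseteq> B" "B \<subseteq> universe M" "|B| <o \<kappa>"
    and H: "subgroup H G" "type_definable L M k B H" and X: "X \<in> Def L M B k" "H \<subseteq> X"
  shows "\<exists>Y\<in>Def L M B k. H \<subseteq> Y \<and> (\<forall>x\<in>carrier G. \<forall>y\<in>carrier G. x \<in> Y \<longrightarrow> y \<in> Y \<longrightarrow> x \<otimes> inv y \<in> X)"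
proof -
  obtain \<mu> where \<mu>: "\<mu> \<in> Def L M A (k + k + k)"
    "\<forall>x\<in>carrier G. \<forall>y\<in>carrier G. \<forall>z\<in>U k. x @ y @ z \<in> \<mu> \<longleftrightarrow> z = x \<otimes> y"
    using mult_definable by blast
  let ?I = "{Y \<in> Def L M B k. H \<subseteq> Y} \<times> {Y \<in> Def L M A k. carrier G \<subseteq> Y}"
  let ?c1 = "[0..<k]" and ?c2 = "[k..<k + k]" and ?c3 = "[k + k..<k + k + k]"
  let ?pull = "\<lambda>Y is. {w \<in> U (k + k + k). map ((!) w) is \<in> Y}"
  let ?h = "\<lambda>(Y, Y'). ?pull Y ?c1 \<inter> (?pull Y ?c2 \<inter> ?pull Y' ?c3)"
  let ?Z = "(U (k + k + k) - ?pull \<mu> (?c3 @ ?c2 @ ?c1)) \<union> ?pull X ?c3"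
  have h_Def: "?h i \<in> Def L M B (k + k + k)" if i: "i \<in> ?I" for i
  proof -
    obtain Y Y' where Y: "i = (Y, Y')" "Y \<in> Def L M B k" "Y' \<in> Def L M A k"
      using i by auto
    show ?thesis
      unfolding Y(1) prod.case
      by (intro Def_Int Def_pull[OF Y(2)] Def_pull[OF Y(3)]) (use B in auto)
  qed
  have Z_Def: "?Z \<in> Def L M B (k + k + k)"
    by (intro Def_Un Def_Diff Def_pull[OF \<mu>(1)] Def_pull[OF X(1)]) (use B in auto)
  have pulls: "x @ y @ z \<in> ?pull Y ?c1 \<longleftrightarrow> x \<in> Y" "x @ y @ z \<in> ?pull Y ?c2 \<longleftrightarrow> y \<in> Y"
    "x @ y @ z \<in> ?pull Y ?c3 \<longleftrightarrow> z \<in> Y" "x @ y @ z \<in> ?pull Y (?c3 @ ?c2 @ ?c1) \<longleftrightarrow> z @ y @ x \<in> Y"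
    "x @ y @ z \<in> U (k + k + k)"
    if "x \<in> U k" "y \<in> U k" "z \<in> U k" for x y z Y
    using that by (auto simp: tuples_def map_nth_upt)
  obtain I0 where I0: "I0 \<subseteq> ?I" "finite I0"
    and cover: "\<And>w. w \<in> U (k + k + k) \<Longrightarrow> (\<And>i. i \<in> I0 \<Longrightarrow> w \<in> ?h i) \<Longrightarrow> w \<in> ?Z"
  proof (rule compact_cover[OF saturated B(2,3) h_Def Z_Def])
    fix w assume w: "w \<in> U (k + k + k)" and h: "\<And>i. i \<in> ?I \<Longrightarrow> w \<in> ?h i"
    obtain x y z where xyz: "w = x @ y @ z" "x \<in> U k" "y \<in> U k" "z \<in> U k"
      using w by (elim tuples_addE) auto
    have mem: "x \<in> Y" "y \<in> Y" "z \<in> Y'" if "(Y, Y') \<in> ?I" for Y Y'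
      using h[OF that] unfolding xyz(1) prod.case Int_iff pulls[OF xyz(2-4)] by blast+
    \<comment> \<open>The indices are pairs; the full set \<open>U k\<close> as partner makes each
      component available by itself.\<close>
    have UI: "U k \<in> {Y \<in> Def L M B k. H \<subseteq> Y}" "U k \<in> {Y \<in> Def L M A k. carrier G \<subseteq> Y}"
      using carrier_subset type_definable_subset[OF H(2)] by (auto simp: Def_UNIV)
    have memH: "x \<in> Y \<and> y \<in> Y" if "Y \<in> Def L M B k" "H \<subseteq> Y" for Y
      using mem(1,2)[of Y "U k"] that UI(2) by simp
    have memG: "z \<in> Y" if "Y \<in> Def L M A k" "carrier G \<subseteq> Y" for Y
      using mem(3)[of "U k" Y] that UI(1) by simp
    have "x \<in> H" "y \<in> H"
      using memH xyz by (auto intro: type_definable_supersets[OF H(2)])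
    moreover have "z \<in> carrier G"
      using memG xyz by (auto intro: type_definable_supersets[OF carrier_type_definable])
    moreover have "x \<otimes> inv y \<in> H" "x \<in> carrier G" "y \<in> carrier G"
      using calculation subgroup.mem_carrier[OF H(1)] subgroup.m_closed[OF H(1)] subgroup.m_inv_closed[OF H(1)]
      by auto
    ultimately have "z @ y @ x \<in> \<mu> \<Longrightarrow> z \<in> X"
      using \<mu>(2)[rule_format, of z y x] xyz X(2) by (auto simp: m_assoc)
    then show "w \<in> ?Z"
      unfolding xyz(1) Un_iff Diff_iff pulls[OF xyz(2-4)] using pulls(5)[OF xyz(2-4)] by blast
  qed auto
  define Y where "Y = U k \<inter> (\<Inter>i\<in>I0. fst i)"
  have "Y \<in> Def L M B k"
    unfolding Y_def using I0 by (intro Def_INT) auto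
  moreover have "H \<subseteq> Y"
    unfolding Y_def using I0(1) type_definable_subset[OF H(2)] by fastforce
  moreover have "x \<otimes> inv y \<in> X" if xy: "x \<in> carrier G" "y \<in> carrier G" "x \<in> Y" "y \<in> Y" for x y
  proof -
    let ?z = "x \<otimes> inv y"
    have z: "?z \<in> carrier G"
      using xy by simp
    then have U: "x \<in> U k" "y \<in> U k" "?z \<in> U k"
      using xy carrier_subset by auto
    have "x @ y @ ?z \<in> ?h i" if i: "i \<in> I0" for i
    proof -
      obtain Y1 Y2 where Y12: "i = (Y1, Y2)" "carrier G \<subseteq> Y2"
        using I0(1) i by auto
      have "\<forall>i\<in>I0. x \<in> fst i \<and> y \<in> fst i"
        using xy(3,4) by (simp add: Y_def)
      then have "x \<in> Y1" "y \<in> Y1"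
        using i Y12(1) by auto
      then show ?thesis
        unfolding Y12(1) prod.case Int_iff pulls[OF U] using z Y12(2) by blast
    qed
    then have "x @ y @ ?z \<in> ?Z"
      by (rule cover[OF pulls(5)[OF U]])
    moreover have "?z @ y @ x \<in> \<mu>"
      using \<mu>(2)[rule_format, OF z xy(2) U(1)] xy by (simp add: m_assoc)
    ultimately show ?thesis
      unfolding Un_iff Diff_iff pulls[OF U] by blast
  qed
  ultimately show ?thesis
    by blast
qed

text \<open>The carrier is covered by the sets of all \<open>x\<close> with
  \<open>x \<otimes> inv r \<in> Y\<close>, where \<open>r\<close> runs through a small set of coset
  representatives of \<open>H\<close>. By compactness finitely many \<open>r\<close> suffice. Two
  elements with the same \<open>r\<close> have their difference in \<open>X\<close>, so the
  pigeonhole principle gives \<open>q\<close>.\<close>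

lemma thick_definable:
  assumes B: "A \<subseteq> B" "B \<subseteq> universe M" "|B| <o \<kappa>"
    and H: "subgroup H G" "bounded_index \<kappa> G H" and Y: "Y \<in> Def L M B k" "H \<subseteq> Y"
    and X: "\<forall>x\<in>carrier G. \<forall>y\<in>carrier G. x \<in> Y \<longrightarrow> y \<in> Y \<longrightarrow> x \<otimes> inv y \<in> X"
  shows "\<exists>q. thick q X"
proof -
  obtain \<mu> where \<mu>: "\<mu> \<in> Def L M A (k + k + k)"
    "\<forall>x\<in>carrier G. \<forall>y\<in>carrier G. \<forall>z\<in>U k. x @ y @ z \<in> \<mu> \<longleftrightarrow> z = x \<otimes> y"
    using mult_definable by blast
  obtain R where R: "R \<subseteq> carrier G" "|R| \<le>o |rcosets H|"
    "\<And>x. x \<in> carrier G \<Longrightarrow> \<exists>r\<in>R. x \<otimes> inv r \<in> H"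
    using coset_representative[OF H(1)] by blast
  let ?D = "B \<union> (\<Union>r\<in>R. set (inv r))"
  have rU: "inv r \<in> U k" if "r \<in> R" for r
    using that R(1) carrier_subset by auto
  have D_U: "?D \<subseteq> universe M"
    using B(2) rU by (auto simp: tuples_def)
  have "|R| <o \<kappa>"
    using R(2) H(2) ordLeq_ordLess_trans unfolding bounded_index_def by blast
  moreover have "|set (inv r)| <o \<kappa>" for r
    using regular(1) by (intro finite_card_of_ordLess) simp_all
  \<comment> \<open>Regularity of \<open>\<kappa>\<close> keeps the parameters of all
    representatives together small.\<close>
  ultimately have D_small: "|?D| <o \<kappa>"
    using B(3) regular by (intro Un_Cinfinite_bound_strict card_of_UNION_ordLess_infinite_Field_regularCard) auto
  define W where "W r = {x \<in> U k. \<exists>z\<in>U k. x @ inv r @ z \<in> \<mu> \<and> z \<in> Y}" for r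
  have W_Def: "W r \<in> Def L M ?D k" if r: "r \<in> R" for r
  proof -
    let ?E = "{w \<in> U (k + k + k). map ((!) w) ([0..<k] @ [k + k..<k + k + k] @ [k..<k + k]) \<in> \<mu>} \<inter>
      {w \<in> U (k + k + k). map ((!) w) [k..<k + k] \<in> Y}"
    have "?E \<in> Def L M ?D (k + k + k)"
      by (intro Def_Int Def_pull[OF \<mu>(1)] Def_pull[OF Y(1)]) (use B in auto)
    then have "{w \<in> U (k + k). w @ inv r \<in> ?E} \<in> Def L M (?D \<union> set (inv r)) (k + k)"
      using rU[OF r] by (rule Def_fiber)
    moreover have "?D \<union> set (inv r) = ?D"
      using r by auto
    ultimately have "{x \<in> U k. \<exists>z\<in>U k. x @ z \<in> {w \<in> U (k + k). w @ inv r \<in> ?E}} \<in> Def L M ?D k"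
      by (intro Def_proj) simp
    moreover have "(x @ z \<in> {w \<in> U (k + k). w @ inv r \<in> ?E}) \<longleftrightarrow> x @ inv r @ z \<in> \<mu> \<and> z \<in> Y"
      if "x \<in> U k" "z \<in> U k" for x z
      using that rU[OF r] by (auto simp: tuples_def map_nth_upt)
    ultimately show ?thesis
      unfolding W_def by (simp cong: conj_cong)
  qed
  \<comment> \<open>\<open>Inl\<close> supplies the definable supersets of the carrier,
    \<open>Inr\<close> the complements of the sets \<open>W r\<close>. That the \<open>W r\<close>
    cover the carrier means that all these have empty intersection, whence the target
    \<open>{}\<close> below.\<close>
  let ?I = "Inl ` {Y \<in> Def L M A k. carrier G \<subseteq> Y} \<union> Inr ` R"
  let ?h = "case_sum (\<lambda>Y. Y) (\<lambda>r. U k - W r)"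
  have h_Def: "?h i \<in> Def L M ?D k" if i: "i \<in> ?I" for i
  proof -
    have "A \<subseteq> ?D"
      using B(1) by blast
    then show ?thesis
      using i Def_mono[of A ?D _ L M k] Def_Diff[OF W_Def] by (elim UnE imageE) simp_all
  qed
  have Z_Def: "{} \<in> Def L M ?D k"
    using Def_Diff[OF Def_UNIV[of M k L ?D]] by simp
  obtain I0 where I0: "I0 \<subseteq> ?I" "finite I0"
    and cover: "\<And>x. x \<in> U k \<Longrightarrow> (\<And>i. i \<in> I0 \<Longrightarrow> x \<in> ?h i) \<Longrightarrow> x \<in> {}"
  proof (rule compact_cover[OF saturated D_U D_small h_Def Z_Def])
    fix x assume x: "x \<in> U k" and h: "\<And>i. i \<in> ?I \<Longrightarrow> x \<in> ?h i"
    have "x \<in> carrier G"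
    proof (rule type_definable_supersets[OF carrier_type_definable x])
      fix Y assume "Y \<in> Def L M A k" "carrier G \<subseteq> Y"
      then show "x \<in> Y"
        using h[of "Inl Y"] by auto
    qed
    then obtain r where r: "r \<in> R" "x \<otimes> inv r \<in> H"
      using R(3) by blast
    have rG: "inv r \<in> carrier G" "x \<otimes> inv r \<in> carrier G"
      using r(1) R(1) \<open>x \<in> carrier G\<close> by auto
    then have "x \<otimes> inv r \<in> U k"
      using carrier_subset by blast
    moreover from this have "x @ inv r @ (x \<otimes> inv r) \<in> \<mu>"
      using \<mu>(2)[rule_format, OF \<open>x \<in> carrier G\<close> rG(1)] by simp
    ultimately have "x \<in> W r"
      using x r(2) Y(2) unfolding W_def by blast
    then show "x \<in> {}"
      using h[of "Inr r"] r(1) by auto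
  qed auto
  define R0 where "R0 = {r \<in> R. Inr r \<in> I0}"
  have "finite (Inr -` I0 :: 'a list set)"
    by (rule finite_vimageI[OF I0(2)]) simp
  then have "finite R0"
    by (rule rev_finite_subset) (auto simp: R0_def)
  have "\<exists>r\<in>R0. x \<otimes> inv r \<in> Y" if x: "x \<in> carrier G" for x
  proof -
    have "\<exists>i\<in>I0. x \<notin> ?h i"
      using cover[of x] x carrier_subset by blast
    then obtain i where i: "i \<in> I0" "x \<notin> ?h i"
      by blast
    then have "i \<in> ?I"
      using I0(1) by blast
    then obtain r where r: "i = Inr r" "r \<in> R"
      using i(2) x by (elim UnE imageE) auto
    then have "x \<in> W r"
      using i(2) x carrier_subset by auto
    then obtain z where "z \<in> U k" "x @ inv r @ z \<in> \<mu>" "z \<in> Y"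
      by (auto simp: W_def)
    then have "x \<otimes> inv r \<in> Y"
      using \<mu>(2)[rule_format, of x "inv r" z] x r(2) R(1) by auto
    then show ?thesis
      using r i(1) by (auto simp: R0_def)
  qed
  then obtain f where f: "\<And>x. x \<in> carrier G \<Longrightarrow> f x \<in> R0 \<and> x \<otimes> inv (f x) \<in> Y"
    by metis
  \<comment> \<open>One more element than \<open>R0\<close> has forces a repeated representative,
    which cancels in the difference.\<close>
  have "\<exists>a b. a < b \<and> b < length xs \<and> xs ! a \<otimes> inv (xs ! b) \<in> X"
    if xs: "length xs = Suc (card R0)" "set xs \<subseteq> carrier G" for xs
  proof -
    have "\<not> inj_on (\<lambda>a. f (xs ! a)) {..<length xs}"
    proof
      assume "inj_on (\<lambda>a. f (xs ! a)) {..<length xs}"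
      moreover have "(\<lambda>a. f (xs ! a)) ` {..<length xs} \<subseteq> R0"
        using f xs(2) by (auto simp: subset_eq)
      ultimately have "card {..<length xs} \<le> card R0"
        using card_inj_on_le \<open>finite R0\<close> by blast
      then show False
        using xs(1) by simp
    qed
    then obtain a b where ab: "a < b" "b < length xs" "f (xs ! a) = f (xs ! b)"
      unfolding inj_on_def by (metis lessThan_iff nat_neq_iff)
    let ?r = "f (xs ! a)"
    have G: "xs ! a \<in> carrier G" "xs ! b \<in> carrier G"
      using ab xs(2) by auto
    then have r: "?r \<in> carrier G"
      using f R(1) by (auto simp: R0_def)
    have "xs ! a \<otimes> inv ?r \<otimes> inv (xs ! b \<otimes> inv ?r) \<in> X"
      using X f[OF G(1)] f[OF G(2)] ab(3) G r by auto
    moreover have "xs ! a \<otimes> inv ?r \<otimes> inv (xs ! b \<otimes> inv ?r) = xs ! a \<otimes> inv (xs ! b)"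
    proof -
      have "inv ?r \<otimes> (?r \<otimes> inv (xs ! b)) = inv (xs ! b)"
        using G r by (simp flip: m_assoc)
      then show ?thesis
        using G r by (simp add: inv_mult_group m_assoc)
    qed
    ultimately show ?thesis
      using ab by auto
  qed
  then show ?thesis
    unfolding thick_def by blast
qed

text \<open>\<open>difference_definable\<close> is iterated by dependent choice. Each
  \<open>X m\<close> is thick because it contains the differences of \<open>X (Suc m)\<close>, a
  definable superset of a group of bounded index.\<close>

lemma definable_chain:
  assumes B: "A \<subseteq> B" "B \<subseteq> universe M" "|B| <o \<kappa>"
    and H: "subgroup H G" "type_definable L M k B H" "bounded_index \<kappa> G H"
    and X0: "X0 \<in> Def L M B k" "H \<subseteq> X0"
  shows "\<exists>X q. X 0 = X0 \<and> (\<forall>m. X m \<in> Def L M B k \<and> H \<subseteq> X m) \<and> approx_chain G X \<and>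
    (\<forall>m. thick (q m) (X m))"
proof -
  let ?P = "\<lambda>m X. X \<in> Def L M B k \<and> H \<subseteq> X \<and> (m = 0 \<longrightarrow> X = X0)"
  let ?Q = "\<lambda>m X Y. \<forall>x\<in>carrier G. \<forall>y\<in>carrier G. x \<in> Y \<longrightarrow> y \<in> Y \<longrightarrow> x \<otimes> inv y \<in> X"
  have "\<exists>X. \<forall>m. ?P m (X m) \<and> ?Q m (X m) (X (Suc m))"
  proof (rule dependent_nat_choice)
    show "\<exists>X. ?P 0 X" using X0 by blast
    show "\<exists>Y. ?P (Suc m) Y \<and> ?Q m X Y" if "?P m X" for X m
      using difference_definable[OF B H(1,2), of X] that by auto
  qed
  then obtain X where "\<forall>m. ?P m (X m) \<and> ?Q m (X m) (X (Suc m))"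
    by (elim exE)
  then have X: "\<And>m. ?P m (X m)" "\<And>m. ?Q m (X m) (X (Suc m))"
    by simp_all
  have "\<exists>q. thick q (X m)" for m
    by (rule thick_definable[OF B H(1,3) _ _ X(2)]) (use X(1)[of "Suc m"] in simp_all)
  then obtain q where q: "\<And>m. thick (q m) (X m)"
    by metis
  have "approx_chain G X"
  proof unfold_locales
    show "\<one> \<in> X m" for m
      using X(1) subgroup.one_closed[OF H(1)] by blast
  qed (use X(2) in blast)
  then show ?thesis
    using X(1) q by (intro exI[of _ X] exI[of _ q] conjI) simp_all
qed

section \<open>Automorphisms of the group and bounded index\<close>

lemma automorphism_carrier:
  assumes g: "automorphism L M g" "\<And>c. c \<in> A \<Longrightarrow> g c = c"
  shows "x \<in> U k \<Longrightarrow> map g x \<in> carrier G \<longleftrightarrow> x \<in> carrier G"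
    and "x \<in> carrier G \<Longrightarrow> map g x \<in> carrier G"
    and "x \<in> carrier G \<Longrightarrow> y \<in> carrier G \<Longrightarrow> map g (x \<otimes> y) = map g x \<otimes> map g y"
proof -
  show iff: "map g x \<in> carrier G \<longleftrightarrow> x \<in> carrier G" if "x \<in> U k" for x
    using automorphism_type_definable[OF struct g A(1) carrier_type_definable that] .
  show closed: "map g x \<in> carrier G" if "x \<in> carrier G" for x
    using iff that carrier_subset by blast
  assume xy: "x \<in> carrier G" "y \<in> carrier G"
  then have "x @ y @ (x \<otimes> y) \<in> graph" "x @ y @ (x \<otimes> y) \<in> U (k + k + k)"
    using type_definable_subset[OF graph_type_definable] by blast+
  then have "map g (x @ y @ (x \<otimes> y)) \<in> graph"
    using automorphism_type_definable[OF struct g A(1) graph_type_definable] by blast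
  then show "map g (x \<otimes> y) = map g x \<otimes> map g y"
    using graph_iff[of "map g x" "map g y"] closed xy carrier_subset by auto
qed

lemma automorphism_surj:
  assumes "automorphism L M g" "y \<in> U m"
  shows "\<exists>x\<in>U m. y = map g x"
proof -
  have g: "g ` universe M = universe M"
    using assms(1) by (simp add: automorphism_def bij_betw_def)
  have "set y \<subseteq> g ` universe M"
    using assms(2) g by (simp add: tuples_def)
  then have "y \<in> lists (g ` universe M)"
    by auto
  then obtain x where "x \<in> lists (universe M)" "y = map g x"
    unfolding lists_image by blast
  then show ?thesis
    using assms(2) by (intro bexI[of _ x]) (auto simp: tuples_def)
qed

lemma bounded_index_automorphism:
  assumes g: "automorphism L M g" "\<And>c. c \<in> A \<Longrightarrow> g c = c" and H: "H \<subseteq> carrier G" "bounded_index \<kappa> G H"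
  shows "bounded_index \<kappa> G (map g ` H)"
proof -
  have "rcosets (map g ` H) \<subseteq> (`) (map g) ` (rcosets H)"
  proof
    fix C assume "C \<in> rcosets (map g ` H)"
    then obtain a where a: "a \<in> carrier G" "C = map g ` H #> a"
      by (auto simp: RCOSETS_def)
    have "a \<in> U k"
      using a(1) carrier_subset by blast
    then obtain b where b: "b \<in> U k" "a = map g b"
      using automorphism_surj[OF g(1)] by blast
    then have bG: "b \<in> carrier G"
      using automorphism_carrier(1)[OF g b(1)] a(1) by simp
    have "map g (h \<otimes> b) = map g h \<otimes> map g b" if "h \<in> H" for h
      using automorphism_carrier(3)[OF g _ bG] H(1) that by blast
    then have "C = map g ` (H #> b)"
      unfolding a(2) b(2) r_coset_def by (auto simp: image_UN)
    then show "C \<in> (`) (map g) ` (rcosets H)"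
      using bG by (auto simp: RCOSETS_def)
  qed
  then have "|rcosets (map g ` H)| \<le>o |rcosets H|"
    using card_of_mono1 card_of_image ordLeq_transitive by metis
  then show ?thesis
    using H(2) ordLeq_ordLess_trans unfolding bounded_index_def by blast
qed

text \<open>Multiplying by \<open>K\<close> maps the cosets of \<open>H\<close> onto those of
  \<open>K\<close>.\<close>

lemma bounded_index_mono:
  assumes H: "subgroup H G" "bounded_index \<kappa> G H" and K: "subgroup K G" "H \<subseteq> K"
  shows "bounded_index \<kappa> G K"
proof -
  interpret H: subgroup H G by fact
  interpret K: subgroup K G by fact
  have "K <#> (H #> a) = K #> a" if a: "a \<in> carrier G" for a
  proof -
    have "x \<otimes> (h \<otimes> a) \<in> K #> a" if "x \<in> K" "h \<in> H" for x h
    proof -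
      have "x \<otimes> (h \<otimes> a) = x \<otimes> h \<otimes> a" "x \<otimes> h \<in> K"
        using that a K(2) K.mem_carrier by (auto simp: m_assoc)
      then show ?thesis
        by (auto simp: r_coset_def)
    qed
    moreover have "x \<otimes> a \<in> K <#> (H #> a)" if "x \<in> K" for x
    proof -
      have "\<one> \<otimes> a \<in> H #> a"
        using H.one_closed by (auto simp: r_coset_def)
      then have "a \<in> H #> a"
        using a by simp
      then show ?thesis
        using that by (auto simp: set_mult_def)
    qed
    ultimately show ?thesis
      by (auto simp: set_mult_def r_coset_def)
  qed
  then have "rcosets K \<subseteq> (\<lambda>C. K <#> C) ` (rcosets H)"
    by (fastforce simp: RCOSETS_def)
  then have "|rcosets K| \<le>o |rcosets H|"
    using card_of_mono1 card_of_image ordLeq_transitive by metis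
  then show ?thesis
    using H(2) ordLeq_ordLess_trans unfolding bounded_index_def by blast
qed

end

section \<open>Arrays of coheirs\<close>

lemma countable_card_of_ordLeq: "countable X \<Longrightarrow> infinite Y \<Longrightarrow> |X| \<le>o |Y|"
proof -
  assume "countable X" "infinite Y"
  then have "|X| \<le>o |UNIV :: nat set|"
    unfolding countable_def by (auto simp flip: card_of_ordLeq)
  also have "|UNIV :: nat set| \<le>o |Y|"
    using \<open>infinite Y\<close> infinite_iff_card_of_nat by blast
  finally show ?thesis .
qed

primrec differs_from :: "nat \<Rightarrow> nat \<Rightarrow> ('f, 'r) fm" where
  "differs_from m 0 = Eq (Var m) (Var m)"
| "differs_from m (Suc l) = Conj (differs_from m l) (Neg (Eq (Var m) (Var l)))"

lemma sat_differs_from: "sat M e (differs_from m l) \<longleftrightarrow> (\<forall>i<l. e m \<noteq> e i)"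
  by (induction l) (auto simp: less_Suc_eq)

lemma differs_from_formula: "l \<le> m \<Longrightarrow> differs_from m l \<in> formulas L (Suc m)"
  by (induction l) (auto simp: formulas_def)

text \<open>At an enumeration of a finite \<open>X\<close>, the formula saying that there is an
  element different from all entries fails in \<open>X\<close>, hence also in
  \<open>Y\<close>.\<close>

lemma elem_sub_finite:
  fixes M :: "('a, 'f, 'r) fo_struct"
  assumes "elem_sub L M X Y" "finite X"
  shows "X = Y"
proof (rule ccontr)
  assume "X \<noteq> Y"
  obtain x where x: "set x = X"
    using finite_list[OF assms(2)] by blast
  let ?m = "length x"
  let ?\<phi> = "Exists ?m (differs_from ?m ?m) :: ('f, 'r) fm"
  have holds: "holds (M \<restriction> Z) ?\<phi> x \<longleftrightarrow> (\<exists>a\<in>Z. a \<notin> X)" for Z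
    unfolding x[symmetric] holds_def
    by (simp add: sat_differs_from restrict_to_def in_set_conv_nth) metis
  have "?\<phi> \<in> formulas L ?m"
    using differs_from_formula[of ?m ?m L] by (auto simp: formulas_def)
  moreover have "x \<in> tuples X ?m"
    using x by (simp add: tuples_def)
  ultimately have "holds (M \<restriction> X) ?\<phi> x \<longleftrightarrow> holds (M \<restriction> Y) ?\<phi> x"
    using assms(1) unfolding elem_sub_def by blast
  then show False
    using assms(1) \<open>X \<noteq> Y\<close> unfolding holds elem_sub_def by blast
qed

lemma automorphism_tp:
  assumes "is_struct L M" "automorphism L M g" "\<And>c. c \<in> C \<Longrightarrow> g c = c" "C \<subseteq> universe M" "set a \<subseteq> universe M"
  shows "tp L M (map g a) C = tp L M a C"
proof -
  have "holds M \<phi> (map g a @ c) = holds M \<phi> (a @ c)" if "(\<phi>, c) \<in> formulas_over L C (length a)" for \<phi> c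
  proof -
    have "map g c = c"
      using that assms(3) by (intro map_idI) (auto simp: formulas_over_def)
    moreover have "holds M \<phi> (map g (a @ c)) = holds M \<phi> (a @ c)"
      using that assms(4,5) by (intro automorphism_holds[OF assms(1,2)]) (auto simp: formulas_over_def)
    ultimately show ?thesis by simp
  qed
  then show ?thesis
    unfolding tp_def length_map by blast
qed

text \<open>Indices are shifted by one: \<open>\<mu> i\<close> and \<open>b i\<close> are \<open>\<kappa>\<^sub>i\<^sub>+\<^sub>1\<close> and \<open>b\<^sub>i\<^sub>+\<^sub>1\<close>.\<close>

locale generic_group = monster_group G L \<kappa> M k A
  for G :: "'a list monoid" (structure) and L :: "('f, 'r) lang" and \<kappa> :: "'k rel"
    and M :: "('a, 'f, 'r) fo_struct" and k :: nat and A :: "'a set" +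
  fixes p :: nat and N :: "nat \<Rightarrow> 'a set" and \<mu> :: "nat \<Rightarrow> 'k rel" and b :: "nat \<Rightarrow> 'a list"
  assumes N_elem: "i < p \<Longrightarrow> elem_sub L M (N i) (N (Suc i))"
    and N_top: "elem_submodel L M (N p)" "|N p| <o \<kappa>" and A_N: "A \<subseteq> N 0"
    and \<mu>: "i < p \<Longrightarrow> regular_cardinal (\<mu> i)" "i < p \<Longrightarrow> cardSuc (beth2 |N i| ) \<le>o \<mu> i"
    and b_universe: "i < p \<Longrightarrow> set (b i) \<subseteq> universe M"
    and b_coheir: "i < p \<Longrightarrow> coheir L M (\<mu> i) (N (Suc i)) (b i) ((\<Union>j<i. set (b j)) \<union> N p)"
begin

lemma N_mono: "i \<le> j \<Longrightarrow> j \<le> p \<Longrightarrow> N i \<subseteq> N j"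
proof (induction j rule: dec_induct)
  case (step j)
  then show ?case
    using N_elem[of j] by (auto simp: elem_sub_def)
qed simp

lemma N_universe: "i \<le> p \<Longrightarrow> N i \<subseteq> universe M"
  using N_mono[of i p] N_top(1) by (auto simp: elem_sub_def)

text \<open>Only needed when the universe is finite: then \<open>beth2 |N i|\<close> is finite and \<open>\<mu> i\<close> may be \<open>\<omega>\<close>.\<close>

lemma N_finite: "i \<le> p \<Longrightarrow> finite (N i) \<Longrightarrow> finite (universe M)"
proof (induction i rule: inc_induct)
  case base
  then show ?case
    using elem_sub_finite[OF N_top(1)] by simp
next
  case (step i)
  then show ?case
    using elem_sub_finite[OF N_elem[of i]] by simp
qed

text \<open>For infinite \<open>N i\<close> the cardinal \<open>\<mu> i\<close> lies above
  \<open>beth2 |N i|\<close>, and a countable set adds nothing. For finite \<open>N i\<close>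
  everything is finite, while \<open>\<mu> i\<close> is infinite.\<close>

lemma small_for_coheir:
  assumes "i < p" "countable F" "F \<subseteq> universe M"
  shows "|N i \<union> F| <o \<mu> i"
proof -
  have inf: "Cinfinite (\<mu> i)"
    using \<mu>(1)[OF assms(1)] by (simp add: regular_cardinal_def cinfinite_def)
  show ?thesis
  proof (cases "finite (N i)")
    case True
    then have "finite (universe M)"
      using N_finite[of i] assms(1) by simp
    then have "finite (N i \<union> F)"
      using N_universe[of i] assms by (meson Un_least finite_subset less_imp_le)
    then show ?thesis
      using inf by (rule finite_card_of_ordLess)
  next
    case False
    let ?c = "two_power |N i|"
    have "|N i| <o ?c"
      by (rule ordLess_ctwo_cexp[OF card_of_Card_order])
    also have "?c <o two_power ?c"
      by (rule ordLess_ctwo_cexp[OF Card_order_cexp])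
    also have "two_power ?c <o cardSuc (two_power ?c)"
      by (rule cardSuc_greater[OF Card_order_cexp])
    finally have N: "|N i| <o \<mu> i"
      using \<mu>(2)[OF assms(1)] ordLess_ordLeq_trans by blast
    have "|F| <o \<mu> i"
      using countable_card_of_ordLeq[OF assms(2) False] N ordLeq_ordLess_trans by blast
    with N show ?thesis
      using inf by (rule Un_Cinfinite_bound_strict)
  qed
qed

text \<open>What has to stay fixed, besides \<open>N r\<close>, when \<open>b r\<close> is moved to
  its conjugate number \<open>i\<close>: the tuples of smaller index, the parameters
  \<open>D\<close>, all conjugates in larger coordinates and the earlier ones in coordinate
  \<open>r\<close>. It is kept apart from \<open>N r\<close> because it is countable for countable
  \<open>D\<close>.\<close>

definition chosen :: "'a set \<Rightarrow> (nat \<Rightarrow> nat \<Rightarrow> 'a list) \<Rightarrow> nat \<Rightarrow> nat \<Rightarrow> 'a set" where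
  "chosen D B r i = (\<Union>j<r. set (b j)) \<union> D \<union> (\<Union>s\<in>{r<..<p}. \<Union>l. set (B s l)) \<union> (\<Union>l<i. set (B r l))"

definition base :: "'a set \<Rightarrow> (nat \<Rightarrow> nat \<Rightarrow> 'a list) \<Rightarrow> nat \<Rightarrow> nat \<Rightarrow> 'a set" where
  "base D B r i = N r \<union> chosen D B r i"

lemma base_subset:
  assumes "r < p" "D \<subseteq> N p" "\<And>s l. r < s \<Longrightarrow> s < p \<Longrightarrow> set (B s l) \<subseteq> N p" "\<And>l. l < i \<Longrightarrow> set (B r l) \<subseteq> N p"
  shows "base D B r i \<subseteq> (\<Union>j<r. set (b j)) \<union> N p"
  using assms N_mono[of r p] unfolding base_def chosen_def by fastforce

lemma countable_chosen: "countable D \<Longrightarrow> countable (chosen D B r i)"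
  unfolding chosen_def by (intro countable_Un countable_UN) (auto intro: countable_finite)

text \<open>The chosen tuples stay inside \<open>N p\<close>, so each \<open>base\<close> is covered
  by the set over which \<open>b r\<close> satisfies its coheir condition, and it has fewer than
  \<open>\<mu> r\<close> elements.\<close>

lemma coheir_array:
  assumes "countable D" "D \<subseteq> N p"
  obtains B where "\<And>r i. r < p \<Longrightarrow> B r i \<in> tuples (N (Suc r)) (length (b r)) \<and>
    tp L M (B r i) (base D B r i) = tp L M (b r) (base D B r i)"
proof -
  \<comment> \<open>Large \<open>r\<close> first, then \<open>i\<close> upwards: exactly the entries
    on which \<open>base\<close> depends come earlier.\<close>
  define R where "R = inv_image (less_than <*lex*> less_than) (\<lambda>(r, i :: nat). (p - r, i))"
  let ?P = "\<lambda>f (r, i) y. r < p \<longrightarrow> y \<in> tuples (N (Suc r)) (length (b r)) \<and>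
    tp L M y (base D (curry f) r i) = tp L M (b r) (base D (curry f) r i)"
  have "\<exists>f. \<forall>x. ?P f x (f x)"
  proof (rule dependent_wf_choice[of R])
    show "wf R"
      unfolding R_def by (intro wf_inv_image wf_lex_prod wf_less_than)
    fix f :: "nat \<times> nat \<Rightarrow> 'a list" and x :: "nat \<times> nat"
    obtain r i where x: "x = (r, i)" by force
    have less: "((s, l), x) \<in> R" if "r < s \<and> s < p \<or> s = r \<and> l < i" for s l
      using that by (auto simp: R_def x)
    {
      fix g :: "nat \<times> nat \<Rightarrow> 'a list" and y
      assume eq: "\<And>z. (z, x) \<in> R \<Longrightarrow> f z = g z"
      have "(\<Union>s\<in>{r<..<p}. \<Union>l. set (curry f s l)) = (\<Union>s\<in>{r<..<p}. \<Union>l. set (curry g s l))"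
        "(\<Union>l<i. set (curry f r l)) = (\<Union>l<i. set (curry g r l))"
        using eq[OF less] by simp_all
      then have "base D (curry f) r i = base D (curry g) r i"
        unfolding base_def chosen_def by simp
      then show "?P f x y = ?P g x y"
        by (simp add: x)
    }
    assume IH: "\<And>y. (y, x) \<in> R \<Longrightarrow> ?P f y (f y)"
    show "\<exists>y. ?P f x y"
    proof (cases "r < p")
      case True
      have sub: "set (f (s, l)) \<subseteq> N p" if "r < s \<and> s < p \<or> s = r \<and> l < i" for s l
      proof -
        have "s < p" using that True by auto
        then have "set (f (s, l)) \<subseteq> N (Suc s)" "N (Suc s) \<subseteq> N p"
          using IH[OF less[OF that]] N_mono[of "Suc s" p] by (auto simp: tuples_def)
        then show ?thesis by blast
      qed
      have subset: "base D (curry f) r i \<subseteq> (\<Union>j<r. set (b j)) \<union> N p"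
        using True assms(2) sub by (intro base_subset) auto
      have "(\<Union>j<r. set (b j)) \<union> N p \<subseteq> universe M"
        using True by (intro Un_least UN_least b_universe N_universe) auto
      then have "chosen D (curry f) r i \<subseteq> universe M"
        using subset unfolding base_def by blast
      then have "|base D (curry f) r i| <o \<mu> r"
        unfolding base_def by (intro small_for_coheir[OF True] countable_chosen assms(1))
      then have "\<exists>y\<in>tuples (N (Suc r)) (length (b r)).
          tp L M y (base D (curry f) r i) = tp L M (b r) (base D (curry f) r i)"
        using b_coheir[OF True] subset unfolding coheir_def by (meson le_supI1)
      then show ?thesis
        by (auto simp: x)
    qed (simp add: x)
  qed
  then obtain f where f: "\<forall>x. ?P f x (f x)"
    by (elim exE)
  show thesis
  proof (rule that[of "curry f"])
    show "curry f r i \<in> tuples (N (Suc r)) (length (b r)) \<and>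
      tp L M (curry f r i) (base D (curry f) r i) = tp L M (b r) (base D (curry f) r i)" if "r < p" for r i
      using f[THEN spec, of "(r, i)"] that by simp
  qed
qed

definition slice :: "('f, 'r) fm \<Rightarrow> 'a list \<Rightarrow> 'a list set" where
  "slice \<psi> d = {x \<in> U k. holds M \<psi> (x @ concat (map b [0..<p]) @ d)}"

text \<open>The form in which a group enters the combinatorial argument: the tuples \<open>b\<close>
  occupy one block, so that conjugates can replace them, and all other parameters \<open>d m\<close>
  lie in \<open>N p\<close>.\<close>

definition subgroup_chain :: "'a list set \<Rightarrow> (nat \<Rightarrow> ('f, 'r) fm) \<Rightarrow> (nat \<Rightarrow> 'a list) \<Rightarrow> (nat \<Rightarrow> nat) \<Rightarrow> bool" where
  "subgroup_chain H \<psi> d q \<longleftrightarrow>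
    (\<forall>m. \<psi> m \<in> formulas L (k + length (concat (map b [0..<p])) + length (d m)) \<and> set (d m) \<subseteq> N p \<and> H \<subseteq> slice (\<psi> m) (d m)) \<and>
    approx_chain G (\<lambda>m. slice (\<psi> m) (d m)) \<and> (\<forall>m. thick (q m) (slice (\<psi> m) (d m)))"

text \<open>The carrier is intersected so that \<open>p = 0\<close>, with its empty family of
  components, gives the whole group.\<close>

definition common_00 :: "'a list set" where
  "common_00 = carrier G \<inter> (\<Inter>s\<in>{..<p}. G00 L \<kappa> M k G (N p \<union> (\<Union>j\<in>{..<p} - {s}. set (b j))))"

end

locale generic_array = generic_group G L \<kappa> M k A p N \<mu> b
  for G :: "'a list monoid" (structure) and L :: "('f, 'r) lang" and \<kappa> :: "'k rel"
    and M :: "('a, 'f, 'r) fo_struct" and k :: nat and A :: "'a set" and p :: nat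
    and N :: "nat \<Rightarrow> 'a set" and \<mu> :: "nat \<Rightarrow> 'k rel" and b :: "nat \<Rightarrow> 'a list" +
  fixes D :: "'a set" and B :: "nat \<Rightarrow> nat \<Rightarrow> 'a list"
  assumes D: "countable D" "D \<subseteq> N p"
    and B_tuples: "r < p \<Longrightarrow> B r i \<in> tuples (N (Suc r)) (length (b r))"
    and B_tp: "r < p \<Longrightarrow> tp L M (B r i) (base D B r i) = tp L M (b r) (base D B r i)"
begin

lemma B_N: "r < p \<Longrightarrow> set (B r i) \<subseteq> N p"
  using B_tuples[of r i] N_mono[of "Suc r" p] by (auto simp: tuples_def)

lemma shift_automorphism:
  assumes "r < p"
  shows "\<exists>g. automorphism L M g \<and> (\<forall>c\<in>base D B r i. g c = c) \<and> map g (b r) = B r i"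
proof (rule automorphism_of_tp[OF homogeneous])
  have sub: "base D B r i \<subseteq> (\<Union>j<r. set (b j)) \<union> N p"
    using assms D(2) B_N by (intro base_subset) auto
  have "finite ((\<Union>j<r. set (b j)) \<union> set (b r))"
    by simp
  then have "|((\<Union>j<r. set (b j)) \<union> set (b r)) \<union> N p| <o \<kappa>"
    by (intro Un_Cinfinite_bound_strict finite_card_of_ordLess regular(1) N_top(2))
  moreover have "base D B r i \<union> set (b r) \<subseteq> ((\<Union>j<r. set (b j)) \<union> set (b r)) \<union> N p"
    using sub by blast
  ultimately show "|base D B r i \<union> set (b r)| <o \<kappa>"
    using card_of_mono1 ordLeq_ordLess_trans by blast
  have "(\<Union>j<r. set (b j)) \<union> N p \<subseteq> universe M"
    using assms by (intro Un_least UN_least b_universe N_universe) auto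
  then show "base D B r i \<subseteq> universe M"
    using sub by blast
  show "set (b r) \<subseteq> universe M"
    using b_universe assms by simp
  show "set (B r i) \<subseteq> universe M"
    using B_N[OF assms, of i] N_universe[of p] by blast
  show "length (B r i) = length (b r)"
    using B_tuples[OF assms] by (simp add: tuples_def)
qed (rule B_tp[OF assms])

definition shift :: "nat \<Rightarrow> nat \<Rightarrow> 'a \<Rightarrow> 'a" where
  "shift r i = (SOME g. automorphism L M g \<and> (\<forall>c\<in>base D B r i. g c = c) \<and> map g (b r) = B r i)"

lemma shift:
  assumes "r < p"
  shows "automorphism L M (shift r i)" "\<And>c. c \<in> base D B r i \<Longrightarrow> shift r i c = c"
    "map (shift r i) (b r) = B r i"
  using someI_ex[OF shift_automorphism[OF assms, of i]] unfolding shift_def by blast+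

lemma shift_A: "r < p \<Longrightarrow> c \<in> A \<Longrightarrow> shift r i c = c"
  using shift(2)[of r c i] A_N N_mono[of 0 r] by (auto simp: base_def chosen_def)

section \<open>Parameter vectors and their conjugates\<close>

definition entry :: "nat \<Rightarrow> nat option \<Rightarrow> 'a list" where
  "entry r x = (case x of None \<Rightarrow> b r | Some i \<Rightarrow> B r i)"

text \<open>Only the first \<open>p\<close> entries contribute parameters; entry \<open>p\<close>
  selects a group and is used by \<open>fiber\<close>.\<close>

definition params :: "nat option list \<Rightarrow> 'a list" where
  "params v = concat (map (\<lambda>r. entry r (v ! r)) [0..<p])"

lemma params_replicate: "params (replicate p None @ w) = concat (map b [0..<p])"
  unfolding params_def by (intro arg_cong[of _ _ concat] map_cong) (auto simp: entry_def nth_append)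

lemma length_entry: "r < p \<Longrightarrow> length (entry r x) = length (b r)"
  using B_tuples[of r] by (auto simp: entry_def tuples_def split: option.split)

lemma length_params: "length (params v) = length (concat (map b [0..<p]))"
  unfolding params_def length_concat map_map
  by (intro arg_cong[of _ _ sum_list] map_cong) (auto simp: length_entry)

lemma params_universe: "set (params v) \<subseteq> universe M"
proof -
  have "set (entry r x) \<subseteq> universe M" if "r < p" for r x
    using b_universe[OF that] B_N[OF that] N_universe[of p] by (auto simp: entry_def split: option.split)
  then show ?thesis
    by (fastforce simp: params_def)
qed

text \<open>To the left of \<open>r\<close> both kinds of entry are fixed: \<open>b s\<close>
  belongs to \<open>chosen\<close>, and conjugates of \<open>b s\<close> lie in
  \<open>N (Suc s)\<close>, hence in \<open>N r\<close>. To the right only conjugates are known to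
  be fixed, which is why the vector continues with \<open>map Some w\<close>. This asymmetry
  dictates that coordinates are replaced from the largest to the smallest.\<close>

lemma shift_entry:
  assumes r: "r < p" "length u = r" and s: "s < p" "s \<noteq> r" and w: "length w = p - r"
  shows "map (shift r i) (entry s ((u @ x # map Some w) ! s)) = entry s ((u @ x # map Some w) ! s)"
proof (rule map_idI)
  fix c assume c: "c \<in> set (entry s ((u @ x # map Some w) ! s))"
  have "c \<in> base D B r i"
  proof (cases "s < r")
    case True
    then have "B s l \<in> tuples (N r) (length (b s))" for l
      using B_tuples[OF s(1), of l] N_mono[of "Suc s" r] r(1) by (auto simp: tuples_def)
    then show ?thesis
      using c True unfolding entry_def base_def chosen_def by (auto simp: tuples_def split: option.splits)
  next
    case False
    then have "s - Suc r < length w" "s = length u + Suc (s - Suc r)"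
      using s r w by auto
    then have "(u @ x # map Some w) ! s = Some (w ! (s - Suc r))"
      by (metis nth_append_length_plus nth_Cons_Suc nth_map)
    then show ?thesis
      using c False s unfolding entry_def base_def chosen_def by auto
  qed
  then show "shift r i c = c"
    by (rule shift(2)[OF r(1)])
qed

lemma shift_params_None:
  assumes "r < p" "length u = r" "length w = p - r"
  shows "map (shift r i) (params (u @ None # map Some w)) = params (u @ Some i # map Some w)"
proof -
  have "map (shift r i) (entry s ((u @ None # map Some w) ! s)) = entry s ((u @ Some i # map Some w) ! s)"
    if s: "s < p" for s
  proof (cases "s = r")
    case True
    then show ?thesis
      using shift(3)[OF assms(1), of i] assms(2) by (simp add: entry_def nth_append)
  next
    case False
    then have "(u @ None # map Some w) ! s = (u @ Some i # map Some w) ! s"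
      using assms(2) by (auto simp: nth_append nth_Cons')
    then show ?thesis
      using shift_entry[OF assms(1,2) s False assms(3)] by simp
  qed
  then show ?thesis
    by (auto simp: params_def map_concat comp_def intro!: arg_cong[of _ _ concat] map_cong)
qed

lemma shift_params_Some:
  assumes "r < p" "length u = r" "length w = p - r" "j < i"
  shows "map (shift r i) (params (u @ Some j # map Some w)) = params (u @ Some j # map Some w)"
proof -
  have "map (shift r i) (entry s ((u @ Some j # map Some w) ! s)) = entry s ((u @ Some j # map Some w) ! s)"
    if s: "s < p" for s
  proof (cases "s = r")
    case True
    have "shift r i c = c" if "c \<in> set (B r j)" for c
      using that assms(4) by (intro shift(2)[OF assms(1)]) (auto simp: base_def chosen_def)
    then show ?thesis
      using True assms(2) by (auto simp: entry_def nth_append intro!: map_idI)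
  next
    case False
    show ?thesis
      by (rule shift_entry[OF assms(1,2) s False assms(3)])
  qed
  then show ?thesis
    by (auto simp: params_def map_concat comp_def intro!: arg_cong[of _ _ concat] map_cong)
qed

lemma shift_D: "r < p \<Longrightarrow> c \<in> D \<Longrightarrow> shift r i c = c"
  by (rule shift(2)) (auto simp: base_def chosen_def)

definition conjugate :: "nat option list \<Rightarrow> nat option list \<Rightarrow> bool" where
  "conjugate v v' \<longleftrightarrow> tp L M (params v) (A \<union> D) = tp L M (params v') (A \<union> D)"

lemma A_D_N: "A \<union> D \<subseteq> N p"
  using A_N N_mono[of 0 p] D(2) by auto

lemma conjugate_automorphism:
  assumes "conjugate v v'"
  shows "\<exists>g. automorphism L M g \<and> (\<forall>c\<in>A \<union> D. g c = c) \<and> map g (params v) = params v'"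
proof (rule automorphism_of_tp[OF homogeneous])
  have "|N p \<union> set (params v)| <o \<kappa>"
    by (rule Un_Cinfinite_bound_strict[OF N_top(2) finite_card_of_ordLess[OF _ regular(1)] regular(1)]) simp
  moreover have "A \<union> D \<union> set (params v) \<subseteq> N p \<union> set (params v)"
    using A_D_N by blast
  ultimately show "|A \<union> D \<union> set (params v)| <o \<kappa>"
    using card_of_mono1 ordLeq_ordLess_trans by blast
  show "A \<union> D \<subseteq> universe M"
    using A_D_N N_universe[of p] by blast
qed (use assms params_universe in \<open>auto simp: conjugate_def length_params\<close>)

lemma conjugate_step:
  assumes "r < p" "length u = r" "length w = p - r"
  shows "conjugate (u @ None # map Some w) (u @ Some i # map Some w)"
proof -
  have "tp L M (map (shift r i) (params (u @ None # map Some w))) (A \<union> D) = tp L M (params (u @ None # map Some w)) (A \<union> D)"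
  proof (rule automorphism_tp[OF struct shift(1)[OF assms(1)] _ _ params_universe])
    show "shift r i c = c" if "c \<in> A \<union> D" for c
      using that shift_A[OF assms(1)] shift_D[OF assms(1)] by blast
    show "A \<union> D \<subseteq> universe M"
      using A_D_N N_universe[of p] by blast
  qed
  then show ?thesis
    unfolding conjugate_def shift_params_None[OF assms] by simp
qed

text \<open>\<open>conjugate_step\<close> changes an entry only if all entries to its right are
  \<open>Some\<close>, so one works from right to left. An entry that is to remain
  \<open>None\<close> is first set to \<open>Some 0\<close>, for the sake of the entries to its
  left, and set back at the end.\<close>

lemma conjugate_replicate:
  "r \<le> p \<Longrightarrow> length u = r \<Longrightarrow> length w = Suc p - r \<Longrightarrow>
    conjugate (replicate r None @ map Some w) (u @ map Some w)"
proof (induction r arbitrary: u w)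
  case 0
  then show ?case
    by (simp add: conjugate_def)
next
  case (Suc r)
  obtain u' x where u: "u = u' @ [x]" "length u' = r"
    using Suc.prems(2) by (auto simp: length_Suc_conv_rev)
  have w: "r < p" "length w = p - r"
    using Suc.prems by auto
  have Some: "conjugate (replicate (Suc r) None @ map Some w) (u' @ Some i # map Some w)" for i
  proof -
    have "conjugate (replicate (Suc r) None @ map Some w) (replicate r None @ Some i # map Some w)"
      using conjugate_step[of r "replicate r None" w i] w by (simp add: replicate_app_Cons_same)
    moreover have "conjugate (replicate r None @ Some i # map Some w) (u' @ Some i # map Some w)"
      using Suc.IH[of u' "i # w"] u(2) w by simp
    ultimately show ?thesis
      by (simp add: conjugate_def)
  qed
  show ?case
  proof (cases x)
    case (Some i)
    then show ?thesis
      using \<open>conjugate _ (u' @ Some i # map Some w)\<close> u by simp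
  next
    case None
    then show ?thesis
      using Some[of 0] conjugate_step[OF w(1) u(2) w(2), of 0] u by (simp add: conjugate_def)
  qed
qed

end

section \<open>Finite patterns and the independence property\<close>

lemma concat_upt_split:
  assumes "j < n"
  shows "concat (map f [0..<n]) = concat (map f [0..<j]) @ f j @ concat (map f [Suc j..<n])"
proof -
  have "[0..<n] = [0..<j] @ j # [Suc j..<n]"
    using assms upt_add_eq_append[of 0 j "n - j"] by (simp add: upt_conv_Cons)
  then show ?thesis
    by simp
qed

lemma concat_in_tuples:
  "(\<And>j. j < n \<Longrightarrow> f j \<in> tuples X (g j)) \<Longrightarrow> concat (map f [0..<n]) \<in> tuples X (sum_list (map g [0..<n]))"
  by (induction n) (auto simp: tuples_def)

lemma take_drop_concat_blocks:
  assumes "\<And>i. i < N \<Longrightarrow> length (t i) = l" "i < N"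
  shows "take l (drop (i * l) (concat (map t [0..<N]))) = t i"
proof -
  have "length (concat (map t [0..<i])) = i * l"
    using concat_in_tuples[of i t UNIV "\<lambda>_. l"] assms by (simp add: tuples_def sum_list_triv)
  then show ?thesis
    unfolding concat_upt_split[OF assms(2)] using assms by simp
qed

definition block :: "nat list \<Rightarrow> nat \<Rightarrow> 'a list \<Rightarrow> 'a list" where
  "block q j t = take (q ! j) (drop (sum_list (take j q)) t)"

lemma sum_list_take: "j \<le> length q \<Longrightarrow> sum_list (take j q) = sum_list (map ((!) q) [0..<j])"
  by (simp add: map_nth_upt)

lemma block_concat:
  assumes "\<And>j. j < length q \<Longrightarrow> length (f j) = q ! j" "j < length q"
  shows "block q j (concat (map f [0..<length q])) = f j"
proof -
  have "length (concat (map f [0..<j])) = sum_list (take j q)"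
    unfolding length_concat map_map sum_list_take[OF less_imp_le[OF assms(2)]]
    using assms by (intro arg_cong[of _ _ sum_list] map_cong) auto
  then show ?thesis
    unfolding block_def concat_upt_split[OF assms(2), of f] using assms by simp
qed

lemma block_bound:
  fixes q :: "nat list"
  shows "j < length q \<Longrightarrow> sum_list (take j q) + q ! j \<le> sum_list q"
proof -
  assume "j < length q"
  then have "sum_list q = sum_list (take j q) + (q ! j + sum_list (drop (Suc j) q))"
    by (metis id_take_nth_drop sum_list.append sum_list.Cons)
  then show ?thesis by linarith
qed

text \<open>A Koenig argument in which saturation replaces finite branching: a prefix is extended so
  that it remains a prefix of members of every later \<open>P N\<close>.\<close>

lemma realize_sequence:
  fixes M :: "('a, 'f, 'r) fo_struct"
  assumes sat: "saturated L \<kappa> M" and small: "\<And>C. countable C \<Longrightarrow> |C :: 'a set| <o \<kappa>"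
    and P: "\<And>N. P N \<in> Def L M {} (N * l)" "\<And>N. P N \<noteq> {}"
    and prefix: "\<And>N y. y \<in> P (Suc N) \<Longrightarrow> take (N * l) y \<in> P N"
  obtains t where "\<And>i. t i \<in> tuples (universe M) l" "\<And>N. concat (map t [0..<N]) \<in> P N"
proof -
  let ?U = "tuples (universe M)"
  have prefixes: "take (N * l) y \<in> P N" if "y \<in> P N'" "N \<le> N'" for N N' y
    using that(2,1)
  proof (induction N' arbitrary: y rule: dec_induct)
    case base
    then show ?case using Def_subset[OF P(1)[of N]] tuplesD by (metis order_refl subsetD take_all)
  next
    case (step N')
    have "take (N * l) (take (N' * l) y) \<in> P N"
      using step by (intro step.IH prefix)
    moreover have "N * l \<le> N' * l"
      using step by simp
    ultimately show ?case
      by (simp add: min_absorb1)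
  qed
  \<comment> \<open>The invariant asks for an extension into each \<open>P N\<close> separately; one
    extension for all \<open>N\<close> is what has to be built.\<close>
  define good where "good i y \<longleftrightarrow> y \<in> ?U (i * l) \<and> (\<forall>N\<ge>i. \<exists>z\<in>P N. take (i * l) z = y)" for i y
  have step: "\<exists>y'. good (Suc i) y' \<and> (\<exists>t\<in>?U l. y' = y @ t)" if y: "good i y" for i y
  proof -
    have yU: "y \<in> ?U (i * l)"
      using y by (simp add: good_def)
    define X where "X N = {t \<in> ?U l. \<exists>z\<in>?U ((N - Suc i) * l). y @ t @ z \<in> P N}" for N
    have X_Def: "X N \<in> Def L M (set y) l" if N: "N \<in> {Suc i..}" for N
    proof -
      let ?r = "(N - Suc i) * l"
      \<comment> \<open>\<open>Def_fiber\<close> and \<open>Def_proj\<close> remove variables from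
        the end, so the order is \<open>t\<close>, \<open>z\<close>, \<open>y\<close>;
        \<open>?is\<close> restores \<open>y @ t @ z\<close>.\<close>
      let ?is = "[l + ?r..<l + ?r + i * l] @ [0..<l] @ [l..<l + ?r]"
      have len: "length ?is = N * l"
      proof -
        obtain e where "N = Suc i + e"
          using N le_Suc_ex by blast
        then show ?thesis
          by (simp add: algebra_simps)
      qed
      let ?Q = "{w \<in> ?U (l + ?r + i * l). map ((!) w) ?is \<in> P N}"
      have "?Q \<in> Def L M {} (l + ?r + i * l)"
        using len by (intro Def_pull[OF P(1)]) auto
      then have "{w \<in> ?U (l + ?r). w @ y \<in> ?Q} \<in> Def L M ({} \<union> set y) (l + ?r)"
        using yU by (rule Def_fiber)
      then have "{t \<in> ?U l. \<exists>z\<in>?U ?r. t @ z \<in> {w \<in> ?U (l + ?r). w @ y \<in> ?Q}}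
        \<in> Def L M (set y) l"
        by (intro Def_proj) simp
      moreover have "t @ z \<in> {w \<in> ?U (l + ?r). w @ y \<in> ?Q} \<longleftrightarrow> y @ t @ z \<in> P N"
        if "t \<in> ?U l" "z \<in> ?U ?r" for t z
        using that yU by (auto simp: tuples_def map_nth_upt)
      ultimately show ?thesis
        unfolding X_def by (simp cong: conj_cong)
    qed
    \<comment> \<open>Since prefixes of members are members, one extension of \<open>y\<close> into
      the largest \<open>P N\<close> provides a next tuple for all smaller ones.\<close>
    have X_mem: "\<exists>t. \<forall>N'\<in>{Suc i..N}. t \<in> X N'" for N
    proof (cases "Suc i \<le> N")
      case True
      then obtain z where z: "z \<in> P N" "take (i * l) z = y"
        using y unfolding good_def by (meson Suc_leD)
      have zU: "z \<in> ?U (N * l)"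
        using z(1) Def_subset[OF P(1)] by blast
      have "take l (drop (i * l) z) \<in> X N'" if N': "N' \<in> {Suc i..N}" for N'
      proof -
        have le: "i * l + l \<le> N' * l" "N' * l \<le> N * l"
          using N' by (metis add.commute atLeastAtMost_iff mult_Suc mult_le_mono1, auto)
        have "take (N' * l) z \<in> P N'"
          using prefixes[OF z(1), of N'] N' by simp
        moreover have "take (N' * l) z = y @ take l (drop (i * l) z) @ drop (i * l + l) (take (N' * l) z)"
        proof -
          have "take (N' * l) z = take (i * l) (take (N' * l) z) @ take l (drop (i * l) (take (N' * l) z)) @
            drop (i * l + l) (take (N' * l) z)"
            by (metis add.commute append_take_drop_id drop_drop)
          moreover have "take (i * l) (take (N' * l) z) = y"
            using z(2) add_leD1[OF le(1)] by (simp only: take_take min_absorb1)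
          moreover have "take l (drop (i * l) (take (N' * l) z)) = take l (drop (i * l) z)"
            using le(1) by (simp add: drop_take min_absorb1 del: mult_le_cancel2)
          ultimately show ?thesis by simp
        qed
        moreover have "drop (i * l + l) (take (N' * l) z) \<in> ?U ((N' - Suc i) * l)"
          using zU le set_drop_subset[of "i * l + l" "take (N' * l) z"] set_take_subset[of "N' * l" z]
          by (auto simp: tuples_def diff_mult_distrib add.commute)
        moreover have "l \<le> N * l - i * l"
          using le by linarith
        then have "take l (drop (i * l) z) \<in> ?U l"
          using zU set_take_subset[of l "drop (i * l) z"] set_drop_subset[of "i * l" z]
          by (auto simp: tuples_def)
        ultimately show ?thesis
          unfolding X_def mem_Collect_eq by metis
      qed
      then show ?thesis by blast
    qed auto
    have "\<exists>t\<in>?U l. \<forall>Y\<in>X ` {Suc i..}. t \<in> Y"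
    proof (rule saturated_compact[OF sat])
      show "set y \<subseteq> universe M"
        using yU by (simp add: tuples_def)
      show "|set y| <o \<kappa>"
        by (intro small countable_finite) simp
      show "X ` {Suc i..} \<subseteq> Def L M (set y) l"
        using X_Def by blast
      fix F0 assume "F0 \<subseteq> X ` {Suc i..}" "finite F0"
      then obtain I0 where I0: "I0 \<subseteq> {Suc i..}" "finite I0" "F0 = X ` I0"
        by (meson finite_subset_image)
      obtain N where "I0 \<subseteq> {..N}"
        using finite_nat_iff_bounded_le[of I0] I0(2) by blast
      then obtain t where t: "\<forall>N'\<in>insert (Suc i) I0. t \<in> X N'"
        using X_mem[of "max (Suc i) N"] I0(1) by (fastforce simp: le_max_iff_disj)
      then have "t \<in> ?U l"
        by (auto simp: X_def)
      then show "\<exists>t\<in>?U l. \<forall>Y\<in>F0. t \<in> Y"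
        using t I0(3) by blast
    qed
    then obtain t where t: "t \<in> ?U l" "\<And>N. Suc i \<le> N \<Longrightarrow> t \<in> X N"
      by auto
    have len: "length (y @ t) = Suc i * l"
      using yU t(1) by (simp add: tuples_def)
    have "good (Suc i) (y @ t)"
      unfolding good_def
    proof (intro conjI allI impI)
      show "y @ t \<in> ?U (Suc i * l)"
        using yU t(1) by (auto simp: tuples_def)
      fix N assume "Suc i \<le> N"
      then obtain z where "y @ t @ z \<in> P N"
        using t(2) unfolding X_def by blast
      moreover have "take (Suc i * l) (y @ t @ z) = y @ t"
        using len by (metis append.assoc append_eq_conv_conj)
      ultimately show "\<exists>z\<in>P N. take (Suc i * l) z = y @ t"
        by blast
    qed
    then show ?thesis
      using t(1) by blast
  qed
  have "\<exists>Y. \<forall>i. good i (Y i) \<and> (\<exists>t\<in>?U l. Y (Suc i) = Y i @ t)"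
  proof (rule dependent_nat_choice)
    show "\<exists>y. good 0 y"
      using P(2) by (intro exI[of _ "[]"]) (auto simp: good_def tuples_def)
  qed (rule step)
  then obtain Y where Y: "\<forall>i. good i (Y i) \<and> (\<exists>t\<in>?U l. Y (Suc i) = Y i @ t)"
    by (elim exE)
  then have "\<forall>i. \<exists>t\<in>?U l. Y (Suc i) = Y i @ t"
    by blast
  then obtain t where t: "\<And>i. t i \<in> ?U l" "\<And>i. Y (Suc i) = Y i @ t i"
    by metis
  have "concat (map t [0..<N]) = Y N" for N
  proof (induction N)
    case 0
    have "Y 0 \<in> ?U (0 * l)"
      using Y unfolding good_def by blast
    then show ?case by (simp add: tuples_def)
  qed (simp add: t(2))
  moreover have "Y N \<in> P N" for N
  proof -
    have g: "good N (Y N)"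
      using Y by blast
    then obtain z where z: "z \<in> P N" "take (N * l) z = Y N"
      unfolding good_def by blast
    then have "length z = N * l"
      using Def_subset[OF P(1)[of N]] tuplesD by blast
    then show ?thesis
      using z by simp
  qed
  ultimately show thesis
    using that[of t] t(1) by simp
qed

lemma words_nth:
  assumes "w \<in> words N l" "j < l"
  shows "w ! j < N"
proof -
  have "w ! j \<in> set w" "set w \<subseteq> {..<N}"
    using assms by (auto simp: words_def)
  then show ?thesis by blast
qed

text \<open>Row \<open>t i\<close> packs the tuples number \<open>i\<close> of all coordinates
  together. The array thereby becomes a single sequence, to which \<open>realize_sequence\<close>
  applies.\<close>

definition args :: "nat list \<Rightarrow> (nat \<Rightarrow> 'a list) \<Rightarrow> nat list \<Rightarrow> 'a list" where
  "args q t w = concat (map (\<lambda>j. block q j (t (w ! j))) [0..<length q])"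

definition row :: "nat \<Rightarrow> 'a list \<Rightarrow> nat \<Rightarrow> 'a list" where
  "row l y i = take l (drop (i * l) y)"

definition arg_positions :: "nat list \<Rightarrow> nat list \<Rightarrow> nat list" where
  "arg_positions q w = concat (map (\<lambda>j. [w ! j * sum_list q + sum_list (take j q)..<
     w ! j * sum_list q + sum_list (take j q) + q ! j]) [0..<length q])"

lemma arg_position_less:
  assumes "w \<in> words N (length q)" "j < length q"
  shows "w ! j * sum_list q + sum_list (take j q) + q ! j \<le> N * sum_list q"
proof -
  have "w ! j < N"
    using words_nth[OF assms] .
  then have "Suc (w ! j) * sum_list q \<le> N * sum_list q"
    by (intro mult_le_mono1) simp
  then show ?thesis
    using block_bound[OF assms(2)] by simp
qed

lemma set_arg_positions: "w \<in> words N (length q) \<Longrightarrow> set (arg_positions q w) \<subseteq> {..<N * sum_list q}"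
  unfolding arg_positions_def by (auto dest!: arg_position_less)

lemma length_arg_positions: "length (arg_positions q w) = sum_list q"
  unfolding arg_positions_def length_concat map_map comp_def by (simp add: map_nth)

lemma map_arg_positions:
  assumes "w \<in> words N (length q)" "length y = N * sum_list q"
  shows "map ((!) (y @ x)) (arg_positions q w) = args q (row (sum_list q) y) w"
proof -
  have "map ((!) (y @ x)) [w ! j * sum_list q + sum_list (take j q)..<w ! j * sum_list q + sum_list (take j q) + q ! j] =
      block q j (row (sum_list q) y (w ! j))" if j: "j < length q" for j
  proof -
    have "sum_list (take j q) + q ! j \<le> sum_list q"
      by (rule block_bound[OF j])
    then have "min (q ! j) (sum_list q - sum_list (take j q)) = q ! j"
      by linarith
    then show ?thesis
      using arg_position_less[OF assms(1) j] assms(2)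
      by (simp add: map_nth_upt block_def row_def drop_take add.commute)
  qed
  then show ?thesis
    unfolding arg_positions_def args_def map_concat map_map by (intro arg_cong[of _ _ concat] map_cong) auto
qed

lemma args_universe:
  assumes "\<And>i. t i \<in> tuples X (sum_list q)"
  shows "args q t w \<in> tuples X (sum_list q)" "j < length q \<Longrightarrow> block q j (t i) \<in> tuples X (q ! j)"
proof -
  show block: "block q j (t i) \<in> tuples X (q ! j)" if j: "j < length q" for i j
  proof -
    have "set (block q j (t i)) \<subseteq> set (t i)"
      unfolding block_def by (meson order_trans set_drop_subset set_take_subset)
    then show ?thesis
      using assms[of i] block_bound[OF j] by (auto simp: tuples_def block_def)
  qed
  then show "args q t w \<in> tuples X (sum_list q)"
    using concat_in_tuples[of "length q" "\<lambda>j. block q j (t (w ! j))" X "(!) q"] by (simp add: args_def map_nth)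
qed

text \<open>Two uses of saturation: \<open>realize_sequence\<close> turns finite patterns of all
  sizes into an infinite array each of whose finite parts is shattered, and saturation over this
  array then realises arbitrary subsets of the infinite box.\<close>

lemma has_IP_of_finite_patterns:
  fixes M :: "('a, 'f, 'r) fo_struct"
  assumes model: "model L T M" and sat: "saturated L \<kappa> M"
    and small: "\<And>C. countable C \<Longrightarrow> |C :: 'a set| <o \<kappa>"
    and \<phi>: "\<phi> \<in> formulas L (k + sum_list q)"
    and fin: "\<And>N. \<exists>a. (\<forall>j<length q. \<forall>i<N. a j i \<in> tuples (universe M) (q ! j)) \<and>
      (\<forall>S\<subseteq>words N (length q). \<exists>x\<in>tuples (universe M) k. \<forall>w\<in>words N (length q).
        holds M \<phi> (x @ concat (map (\<lambda>j. a j (w ! j)) [0..<length q])) \<longleftrightarrow> w \<in> S)"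
  shows "has_IP TYPE('a) L T \<phi> k q"
proof -
  let ?U = "tuples (universe M)" and ?n = "length q" and ?l = "sum_list q"
  let ?args = "\<lambda>y. args q (row ?l y)"
  let ?\<Phi> = "{x \<in> ?U (k + ?l). holds M \<phi> x}"
  have \<Phi>_Def: "?\<Phi> \<in> Def L M C (k + ?l)" for C
    using \<phi> by (intro DefI[of "[]" _ \<phi>]) auto
  \<comment> \<open>The rows packed into \<open>y\<close> shatter the box of side \<open>N\<close>.
    Only finitely many \<open>S\<close> and \<open>w\<close> are involved, so this is definable
    without parameters.\<close>
  define P where "P N = {y \<in> ?U (N * ?l). \<forall>S\<in>Pow (words N ?n). \<exists>x\<in>?U k. \<forall>w\<in>words N ?n.
    x @ ?args y w \<in> ?\<Phi> \<longleftrightarrow> w \<in> S}" for N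
  have P_Def: "P N \<in> Def L M {} (N * ?l)" for N
  proof -
    let ?is = "\<lambda>w. [N * ?l..<N * ?l + k] @ arg_positions q w"
    define E where "E w = {z \<in> ?U (N * ?l + k). map ((!) z) (?is w) \<in> ?\<Phi>}" for w
    have E_Def: "E w \<in> Def L M {} (N * ?l + k)" if w: "w \<in> words N ?n" for w
      unfolding E_def using set_arg_positions[OF w]
      by (intro Def_pull[OF \<Phi>_Def[of "{}"]]) (auto simp: length_arg_positions)
    have E_iff: "y @ x \<in> E w \<longleftrightarrow> x @ ?args y w \<in> ?\<Phi>"
      if "w \<in> words N ?n" "y \<in> ?U (N * ?l)" "x \<in> ?U k" for w x y
    proof -
      have "map ((!) (y @ x)) (?is w) = x @ ?args y w"
        using that map_arg_positions[OF that(1) tuplesD[OF that(2)], of x]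
        by (simp add: map_nth_upt tuples_def)
      moreover have "y @ x \<in> ?U (N * ?l + k)"
        using that by (intro append_in_tuples)
      ultimately show ?thesis
        unfolding E_def by (simp only: mem_Collect_eq simp_thms)
    qed
    define F where "F S = {y \<in> ?U (N * ?l). \<exists>x\<in>?U k. y @ x \<in> ?U (N * ?l + k) \<inter>
      (\<Inter>w\<in>words N ?n. if w \<in> S then E w else ?U (N * ?l + k) - E w)}" for S
    have F_Def: "F S \<in> Def L M {} (N * ?l)" for S
      unfolding F_def by (intro Def_proj Def_INT finite_words) (auto intro: E_Def Def_Diff)
    have "P N = ?U (N * ?l) \<inter> (\<Inter>S\<in>Pow (words N ?n). F S)"
    proof -
      have F_iff: "y \<in> F S \<longleftrightarrow> (\<exists>x\<in>?U k. \<forall>w\<in>words N ?n. x @ ?args y w \<in> ?\<Phi> \<longleftrightarrow> w \<in> S)"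
        if y: "y \<in> ?U (N * ?l)" for y S
      proof -
        have "y @ x \<in> ?U (N * ?l + k) \<inter> (\<Inter>w\<in>words N ?n. if w \<in> S then E w else ?U (N * ?l + k) - E w) \<longleftrightarrow>
          (\<forall>w\<in>words N ?n. x @ ?args y w \<in> ?\<Phi> \<longleftrightarrow> w \<in> S)" if x: "x \<in> ?U k" for x
        proof -
          have "y @ x \<in> ?U (N * ?l + k)"
            using y x by (rule append_in_tuples)
          then have "y @ x \<in> (if w \<in> S then E w else ?U (N * ?l + k) - E w) \<longleftrightarrow>
              (x @ ?args y w \<in> ?\<Phi> \<longleftrightarrow> w \<in> S)" if "w \<in> words N ?n" for w
            using E_iff[OF that y x] by (cases "w \<in> S") (simp_all only: if_True if_False Diff_iff simp_thms)
          then show ?thesis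
            using \<open>y @ x \<in> ?U (N * ?l + k)\<close> by (simp only: Int_iff INT_iff simp_thms cong: ball_cong)
        qed
        then show ?thesis
          unfolding F_def using y by (simp only: mem_Collect_eq simp_thms cong: bex_cong)
      qed
      show ?thesis
      proof (rule Set.set_eqI)
        fix y
        show "y \<in> P N \<longleftrightarrow> y \<in> ?U (N * ?l) \<inter> (\<Inter>S\<in>Pow (words N ?n). F S)"
        proof (cases "y \<in> ?U (N * ?l)")
          case True
          then show ?thesis
            unfolding P_def mem_Collect_eq Int_iff INT_iff F_iff[OF True] by simp
        next
          case False
          then show ?thesis
            unfolding P_def by simp
        qed
      qed
    qed
    then show ?thesis
      using F_Def by (simp add: Def_INT finite_words)
  qed
  have args_cong: "args q t w = args q t' w" if "w \<in> words N ?n" "\<And>i. i < N \<Longrightarrow> t i = t' i" for t t' :: "nat \<Rightarrow> 'a list" and w N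
  proof -
    have "w ! j < N" if "j < ?n" for j
      using words_nth[OF \<open>w \<in> words N ?n\<close> that] .
    then show ?thesis
      unfolding args_def using that(2) by (intro arg_cong[of _ _ concat] map_cong) auto
  qed
  have P_ne: "P N \<noteq> {}" for N
  proof -
    obtain a where a: "\<forall>j<?n. \<forall>i<N. a j i \<in> ?U (q ! j)"
      "\<forall>S\<subseteq>words N ?n. \<exists>x\<in>?U k. \<forall>w\<in>words N ?n.
        holds M \<phi> (x @ concat (map (\<lambda>j. a j (w ! j)) [0..<?n])) \<longleftrightarrow> w \<in> S"
      using fin[of N] by (elim exE conjE)
    define t where "t i = concat (map (\<lambda>j. a j i) [0..<?n])" for i
    have t: "t i \<in> ?U ?l" if "i < N" for i
      using concat_in_tuples[of ?n "\<lambda>j. a j i" _ "(!) q"] a(1) that by (simp add: t_def map_nth)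
    define y where "y = concat (map t [0..<N])"
    have row: "row ?l y i = t i" if "i < N" for i
      unfolding row_def y_def using t that by (intro take_drop_concat_blocks) (auto simp: tuples_def)
    have args: "?args y w = concat (map (\<lambda>j. a j (w ! j)) [0..<?n])" if w: "w \<in> words N ?n" for w
    proof -
      have "block q j (t (w ! j)) = a j (w ! j)" if "j < ?n" for j
      proof -
        have "w ! j < N"
          using words_nth[OF w that] .
        then show ?thesis
          unfolding t_def using a(1) that by (intro block_concat) (auto simp: tuples_def)
      qed
      then have "args q t w = concat (map (\<lambda>j. a j (w ! j)) [0..<?n])"
        unfolding args_def by (intro arg_cong[of _ _ concat] map_cong) auto
      moreover have "?args y w = args q t w"
        using row by (intro args_cong[OF w])
      ultimately show ?thesis
        by simp
    qed
    have y: "y \<in> ?U (N * ?l)"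
      using concat_in_tuples[of N t _ "\<lambda>_. ?l"] t by (simp add: y_def sum_list_triv)
    have concatU: "concat (map (\<lambda>j. a j (w ! j)) [0..<?n]) \<in> ?U ?l" if w: "w \<in> words N ?n" for w
      using concat_in_tuples[of ?n "\<lambda>j. a j (w ! j)" _ "(!) q"] a(1) words_nth[OF w] by (simp add: map_nth)
    have "y \<in> P N"
      unfolding P_def
    proof (intro CollectI conjI ballI y)
      fix S assume "S \<in> Pow (words N ?n)"
      then obtain x where x: "x \<in> ?U k" "\<forall>w\<in>words N ?n.
          holds M \<phi> (x @ concat (map (\<lambda>j. a j (w ! j)) [0..<?n])) \<longleftrightarrow> w \<in> S"
        using a(2) by blast
      have "x @ ?args y w \<in> ?\<Phi> \<longleftrightarrow> w \<in> S" if w: "w \<in> words N ?n" for w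
        using x append_in_tuples[OF x(1) concatU[OF w]] w by (simp add: args)
      then show "\<exists>x\<in>?U k. \<forall>w\<in>words N ?n. x @ ?args y w \<in> ?\<Phi> \<longleftrightarrow> w \<in> S"
        using x(1) by blast
    qed
    then show ?thesis
      by blast
  qed
  have prefix: "take (N * ?l) y \<in> P N" if y: "y \<in> P (Suc N)" for N y
    unfolding P_def
  proof (intro CollectI conjI ballI)
    have yU: "y \<in> ?U (Suc N * ?l)"
      using y by (simp add: P_def)
    then show "take (N * ?l) y \<in> ?U (N * ?l)"
      using set_take_subset[of "N * ?l" y] by (auto simp: tuples_def)
    fix S assume "S \<in> Pow (words N ?n)"
    moreover have sub: "words N ?n \<subseteq> words (Suc N) ?n"
      by (auto simp: words_def)
    ultimately have "S \<in> Pow (words (Suc N) ?n)"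
      by blast
    then obtain x where x: "x \<in> ?U k" "\<forall>w\<in>words (Suc N) ?n. x @ ?args y w \<in> ?\<Phi> \<longleftrightarrow> w \<in> S"
      using y unfolding P_def by blast
    have "row ?l (take (N * ?l) y) i = row ?l y i" if i: "i < N" for i
    proof -
      have "Suc i * ?l \<le> N * ?l"
        using i by (intro mult_le_mono1) simp
      then have "?l \<le> N * ?l - i * ?l"
        by simp
      then show ?thesis
        by (simp add: row_def drop_take min_absorb1)
    qed
    then have "?args (take (N * ?l) y) w = ?args y w" if "w \<in> words N ?n" for w
      using that by (intro args_cong)
    then show "\<exists>x\<in>?U k. \<forall>w\<in>words N ?n. x @ ?args (take (N * ?l) y) w \<in> ?\<Phi> \<longleftrightarrow> w \<in> S"
      using x sub by (intro bexI[OF _ x(1)] ballI) (simp only: subsetD)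
  qed
  obtain t where t: "\<And>i. t i \<in> ?U ?l" and tP: "\<And>N. concat (map t [0..<N]) \<in> P N"
    using realize_sequence[OF sat small P_Def P_ne prefix] by blast
  let ?a = "\<lambda>j i. block q j (t i)"
  \<comment> \<open>The entries of the array form a countable set of parameters, and finitely many
    \<open>w\<close> lie in a finite box, where \<open>tP\<close> supplies a witness.\<close>
  have "\<exists>x\<in>?U k. \<forall>w. length w = ?n \<longrightarrow> (holds M \<phi> (x @ args q t w) \<longleftrightarrow> w \<in> s)" for s
  proof -
    let ?C = "\<Union>i. set (t i)"
    define X where "X w = {x \<in> ?U k. x @ args q t w \<in> ?\<Phi>}" for w
    define Y where "Y w = (if w \<in> s then X w else ?U k - X w)" for w
    have X_Def: "X w \<in> Def L M ?C k" for w
    proof -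
      have "X w \<in> Def L M ({} \<union> set (args q t w)) k"
        unfolding X_def by (rule Def_fiber[OF \<Phi>_Def args_universe(1)[of t, OF t]])
      moreover have "set (args q t w) \<subseteq> ?C"
        unfolding args_def block_def by (auto dest!: in_set_takeD in_set_dropD)
      ultimately show ?thesis
        using Def_mono by (metis sup_bot_left)
    qed
    have set_t: "set (t i) \<subseteq> universe M" for i
      using t[of i] by (simp add: tuples_def)
    have "\<exists>x\<in>?U k. \<forall>Z\<in>Y ` {w. length w = ?n}. x \<in> Z"
    proof (rule saturated_compact[OF sat])
      show "?C \<subseteq> universe M"
        using set_t by blast
      show "|?C| <o \<kappa>"
        by (intro small countable_UN) (auto intro: countable_finite)
      show "Y ` {w. length w = ?n} \<subseteq> Def L M ?C k"
        using X_Def Def_Diff[OF X_Def] by (auto simp: Y_def)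
      fix F0 assume "F0 \<subseteq> Y ` {w. length w = ?n}" "finite F0"
      then obtain W where W: "W \<subseteq> {w. length w = ?n}" "finite W" "F0 = Y ` W"
        by (meson finite_subset_image)
      have "finite (\<Union>w\<in>W. set w)"
        using W(2) by simp
      then obtain N where "(\<Union>w\<in>W. set w) \<subseteq> {..<N}"
        using finite_nat_iff_bounded by blast
      then have WN: "W \<subseteq> words N ?n"
        using W(1) by (auto simp: words_def)
      let ?y = "concat (map t [0..<N])"
      have "s \<inter> words N ?n \<in> Pow (words N ?n)"
        by blast
      then obtain x where x: "x \<in> ?U k"
          "\<forall>w\<in>words N ?n. x @ ?args ?y w \<in> ?\<Phi> \<longleftrightarrow> w \<in> s \<inter> words N ?n"
        using tP[of N] unfolding P_def by blast
      have "row ?l ?y i = t i" if "i < N" for i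
        unfolding row_def using t that by (intro take_drop_concat_blocks) (auto simp: tuples_def)
      then have "?args ?y w = args q t w" if "w \<in> words N ?n" for w
        by (intro args_cong[OF that])
      note eq = this
      have "x \<in> Y w" if "w \<in> W" for w
      proof -
        have w: "w \<in> words N ?n"
          using WN that by blast
        then have "x @ args q t w \<in> ?\<Phi> \<longleftrightarrow> w \<in> s"
          using x(2)[rule_format, OF w] unfolding eq[OF w] by blast
        then show ?thesis
          using x(1) unfolding Y_def X_def by simp
      qed
      then show "\<exists>x\<in>?U k. \<forall>Z\<in>F0. x \<in> Z"
        using x(1) W(3) by blast
    qed
    then obtain x where x: "x \<in> ?U k" "\<And>w. length w = ?n \<Longrightarrow> x \<in> Y w"
      by auto
    have "holds M \<phi> (x @ args q t w) \<longleftrightarrow> w \<in> s" if "length w = ?n" for w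
    proof -
      have "x @ args q t w \<in> ?U (k + ?l)"
        using x(1) args_universe(1)[of t, OF t] by (rule append_in_tuples)
      then show ?thesis
        using x(2)[OF that] by (auto simp: Y_def X_def split: if_splits)
    qed
    then show ?thesis
      using x(1) by blast
  qed
  then show ?thesis
    unfolding has_IP_def args_def using model args_universe(2)[of t, OF t]
    by (intro exI[of _ M] exI[of _ ?a]) blast
qed

section \<open>Independent patterns from a descending sequence of groups\<close>

context generic_array
begin

text \<open>The conjugate of a \<open>slice\<close> along the vector \<open>v\<close>. For entries
  \<open>None\<close> before the last one it is the slice itself, by
  \<open>params_replicate\<close>.\<close>

definition fiber :: "(nat \<Rightarrow> nat \<Rightarrow> ('f, 'r) fm) \<Rightarrow> (nat \<Rightarrow> nat \<Rightarrow> 'a list) \<Rightarrow> nat \<Rightarrow> nat option list \<Rightarrow> 'a list set" where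
  "fiber \<psi> d m v = {x \<in> U k. holds M (\<psi> (the (v ! p)) m) (x @ params v @ d (the (v ! p)) m)}"

lemma automorphism_fiber:
  assumes g: "automorphism L M g" "\<And>c. c \<in> D \<Longrightarrow> g c = c" "map g (params v) = params v'" "v ! p = v' ! p"
    and \<psi>: "\<psi> (the (v ! p)) m \<in> formulas L (k + length (concat (map b [0..<p])) + length (d (the (v ! p)) m))"
      "set (d (the (v ! p)) m) \<subseteq> D"
    and x: "x \<in> U k"
  shows "map g x \<in> fiber \<psi> d m v' \<longleftrightarrow> x \<in> fiber \<psi> d m v"
proof -
  let ?d = "d (the (v ! p)) m"
  have "map g ?d = ?d"
    using \<psi>(2) g(2) by (intro map_idI) auto
  moreover have "holds M (\<psi> (the (v ! p)) m) (map g (x @ params v @ ?d)) = holds M (\<psi> (the (v ! p)) m) (x @ params v @ ?d)"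
  proof (rule automorphism_holds[OF struct g(1)])
    show "\<psi> (the (v ! p)) m \<in> formulas L (length (x @ params v @ ?d))"
      using \<psi>(1) tuplesD[OF x] by (simp add: length_params add.assoc)
    show "set (x @ params v @ ?d) \<subseteq> universe M"
      using x params_universe[of v] \<psi>(2) D(2) N_universe[of p] by (auto simp: tuples_def)
  qed
  ultimately show ?thesis
    using automorphism_tuples[OF g(1) x] x g(3,4) by (simp add: fiber_def)
qed

lemma automorphism_group_hom:
  assumes "automorphism L M g" "\<And>c. c \<in> A \<Longrightarrow> g c = c"
  shows "group_hom G G (map g)"
  by unfold_locales (use automorphism_carrier(2,3)[OF assms] in \<open>auto simp: hom_def\<close>)

lemma automorphism_preimage:
  assumes "automorphism L M g" "\<And>c. c \<in> A \<Longrightarrow> g c = c" "y \<in> carrier G"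
  shows "\<exists>x\<in>carrier G. y = map g x"
proof -
  have "y \<in> U k"
    using assms(3) carrier_subset by blast
  then obtain x where x: "x \<in> U k" "y = map g x"
    using automorphism_surj[OF assms(1)] by blast
  then show ?thesis
    using automorphism_carrier(1)[OF assms(1,2) x(1)] assms(3) by blast
qed

text \<open>The level \<open>p + 4\<close> leaves room for the \<open>p + 1\<close> levels lost by passing to differences and three
  more lost by multiplying the isolated elements.\<close>

lemma finite_patterns:
  fixes \<psi> :: "nat \<Rightarrow> nat \<Rightarrow> ('f, 'r) fm" and d :: "nat \<Rightarrow> nat \<Rightarrow> 'a list" and q :: "nat \<Rightarrow> nat"
    and H :: "nat \<Rightarrow> 'a list set" and c :: "nat \<Rightarrow> 'a list"
  assumes sc: "\<And>j. subgroup_chain (H j) (\<psi> j) (d j) q" and d: "\<And>j m. set (d j m) \<subseteq> D"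
    and H: "\<And>j. subgroup (H j) G" "\<And>j. bounded_index \<kappa> G (H j)"
    and c: "\<And>i. c i \<in> common_00" "\<And>i j. j < i \<Longrightarrow> c i \<in> H j" "\<And>i. c i \<notin> slice (\<psi> i 0) (d i 0)"
    and uniform: "\<And>j. \<psi> j (p + 4) = \<phi>" "\<And>j. length (d j (p + 4)) = l"
  shows "\<exists>a. (\<forall>j<Suc p. \<forall>i<n. a j i \<in> U ((map (\<lambda>j. length (b j)) [0..<p] @ [l]) ! j)) \<and>
    (\<forall>S\<subseteq>words n (Suc p). \<exists>x\<in>U k. \<forall>w\<in>words n (Suc p).
      holds M \<phi> (x @ concat (map (\<lambda>j. a j (w ! j)) [0..<Suc p])) \<longleftrightarrow> w \<in> S)"
proof -
  define Y where "Y j m = slice (\<psi> j m) (d j m)" for j m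
  have \<psi>: "\<psi> j m \<in> formulas L (k + length (concat (map b [0..<p])) + length (d j m))" "set (d j m) \<subseteq> D"
    and chain: "approx_chain G (Y j)" and thick: "thick (q m) (Y j m)" and H_Y: "H j \<subseteq> Y j m" for j m
    using sc[of j] d[of j m] unfolding subgroup_chain_def Y_def by blast+
  have cG: "c i \<in> carrier G" for i
    using c(1)[of i] by (simp add: common_00_def)
  let ?v0 = "\<lambda>j. replicate p None @ [Some j]"
  let ?X = "fiber \<psi> d"
  have X0: "?X m (?v0 j) = Y j m" for m j
    unfolding fiber_def Y_def slice_def params_replicate by (simp add: nth_append)
  \<comment> \<open>Every vector with last entry \<open>Some j\<close> is reached from the
    unreplaced one by an automorphism fixing \<open>A\<close> and \<open>D\<close>, so the
    properties of chain \<open>j\<close> can be transported to it.\<close>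
  have conj: "\<exists>g. automorphism L M g \<and> (\<forall>c\<in>A \<union> D. g c = c) \<and>
      (\<forall>x\<in>U k. \<forall>m. map g x \<in> ?X m (u @ [Some j]) \<longleftrightarrow> x \<in> Y j m)"
    if u: "length u = p" for u j
  proof -
    obtain g where g: "automorphism L M g" "\<forall>c\<in>A \<union> D. g c = c" "map g (params (?v0 j)) = params (u @ [Some j])"
      using conjugate_automorphism[OF conjugate_replicate[of p u "[j]"]] u by auto
    have "map g x \<in> ?X m (u @ [Some j]) \<longleftrightarrow> x \<in> Y j m" if "x \<in> U k" for x m
      unfolding X0[symmetric] by (rule automorphism_fiber[OF g(1) _ g(3) _ \<psi> that]) (use g(2) u in \<open>simp_all add: nth_append\<close>)
    then show ?thesis
      using g(1,2) by blast
  qed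
  have chain': "approx_chain G (\<lambda>m. ?X m (u @ [Some j]))"
    and thick': "\<And>m. thick (q m) (?X m (u @ [Some j]))"
    and bounded: "bounded_index \<kappa> G {x \<in> carrier G. \<forall>m. x \<in> ?X m (u @ [Some j])}"
    if u: "length u = p" for u j
  proof -
    obtain g where g: "automorphism L M g" "\<forall>c\<in>A \<union> D. g c = c"
      and gX: "\<forall>x\<in>U k. \<forall>m. map g x \<in> ?X m (u @ [Some j]) \<longleftrightarrow> x \<in> Y j m"
      using conj[OF u, of j] by (elim exE conjE)
    have gA: "\<And>c. c \<in> A \<Longrightarrow> g c = c"
      using g(2) by blast
    interpret hom: group_hom G G "map g"
      by (rule automorphism_group_hom[OF g(1) gA])
    interpret Y: approx_chain G "Y j"
      by (rule chain)
    have gX': "map g x \<in> ?X m (u @ [Some j]) \<longleftrightarrow> x \<in> Y j m" if "x \<in> carrier G" for x m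
      using gX carrier_subset that by blast
    have pre: "\<exists>x\<in>carrier G. y = map g x" if "y \<in> carrier G" for y
      using automorphism_preimage[OF g(1) gA that] .
    show "approx_chain G (\<lambda>m. ?X m (u @ [Some j]))"
    proof unfold_locales
      show "\<one> \<in> ?X m (u @ [Some j])" for m
        using gX'[OF one_closed, of m] Y.one[of m] hom.hom_one by simp
      fix x y m assume xy: "x \<in> carrier G" "y \<in> carrier G" "x \<in> ?X (Suc m) (u @ [Some j])" "y \<in> ?X (Suc m) (u @ [Some j])"
      obtain x' where x': "x' \<in> carrier G" "x = map g x'"
        using pre[OF xy(1)] by blast
      obtain y' where y': "y' \<in> carrier G" "y = map g y'"
        using pre[OF xy(2)] by blast
      have "x' \<in> Y j (Suc m)" "y' \<in> Y j (Suc m)"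
        using gX'[OF x'(1), of "Suc m"] gX'[OF y'(1), of "Suc m"] x'(2) y'(2) xy(3,4) by simp_all
      then have "x' \<otimes> inv y' \<in> Y j m"
        by (rule Y.diff[OF x'(1) y'(1)])
      moreover have "map g (x' \<otimes> inv y') = x \<otimes> inv y" "x' \<otimes> inv y' \<in> carrier G"
        using x' y' by simp_all
      ultimately show "x \<otimes> inv y \<in> ?X m (u @ [Some j])"
        using gX'[of "x' \<otimes> inv y'" m] by metis
    qed
    show "thick (q m) (?X m (u @ [Some j]))" for m
      unfolding thick_def
    proof (intro allI impI)
      fix xs assume xs: "length xs = q m" "set xs \<subseteq> carrier G"
      obtain h where h: "\<And>y. y \<in> carrier G \<Longrightarrow> h y \<in> carrier G \<and> y = map g (h y)"
        using pre by metis
      have "set (map h xs) \<subseteq> carrier G"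
        using h xs(2) by auto
      then obtain a b where ab: "a < b" "b < length xs" "h (xs ! a) \<otimes> inv (h (xs ! b)) \<in> Y j m"
        using thick[of m j, unfolded thick_def, THEN spec, of "map h xs"] xs(1) by auto
      have G: "xs ! a \<in> carrier G" "xs ! b \<in> carrier G"
        using ab(1,2) xs(2) by auto
      have hG: "h (xs ! a) \<in> carrier G" "h (xs ! b) \<in> carrier G"
        "map g (h (xs ! a)) = xs ! a" "map g (h (xs ! b)) = xs ! b"
        using h[OF G(1)] h[OF G(2)] by simp_all
      then have "map g (h (xs ! a) \<otimes> inv (h (xs ! b))) = xs ! a \<otimes> inv (xs ! b)"
        "h (xs ! a) \<otimes> inv (h (xs ! b)) \<in> carrier G"
        by simp_all
      then have "xs ! a \<otimes> inv (xs ! b) \<in> ?X m (u @ [Some j])"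
        using gX'[of "h (xs ! a) \<otimes> inv (h (xs ! b))" m] ab(3) by metis
      then show "\<exists>a b. a < b \<and> b < length xs \<and> xs ! a \<otimes> inv (xs ! b) \<in> ?X m (u @ [Some j])"
        using ab(1,2) by blast
    qed
    \<comment> \<open>The intersection of the chain contains \<open>H j\<close>, hence has bounded
      index. It takes the place of \<open>H j\<close>, since its parameters are under
      control.\<close>
    let ?K = "{x \<in> carrier G. \<forall>m. x \<in> Y j m}"
    have "bounded_index \<kappa> G ?K"
      using H_Y[of j] subgroup.subset[OF H(1), of j]
      by (intro bounded_index_mono[OF H(1)[of j] H(2)[of j]] Y.subgroup_Inter) blast
    then have "bounded_index \<kappa> G (map g ` ?K)"
      by (intro bounded_index_automorphism[OF g(1) gA]) auto
    moreover have "map g ` ?K = {x \<in> carrier G. \<forall>m. x \<in> ?X m (u @ [Some j])}"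
    proof (intro equalityI subsetI)
      fix y assume "y \<in> map g ` ?K"
      then show "y \<in> {x \<in> carrier G. \<forall>m. x \<in> ?X m (u @ [Some j])}"
        using gX' hom.hom_closed by auto
    next
      fix y assume y: "y \<in> {x \<in> carrier G. \<forall>m. x \<in> ?X m (u @ [Some j])}"
      then obtain x where "x \<in> carrier G" "y = map g x"
        using pre by blast
      then show "y \<in> map g ` ?K"
        using y gX' by auto
    qed
    ultimately show "bounded_index \<kappa> G {x \<in> carrier G. \<forall>m. x \<in> ?X m (u @ [Some j])}"
      by simp
  qed
  have c_mem: "c i \<in> ?X m (u @ [Some j])" if u: "length u = p" and "u \<noteq> replicate p None \<or> j < i" for u i j m
  proof (cases "u = replicate p None")
    case True
    then show ?thesis
      using that(2) c(2)[of j i] subsetD[OF H_Y[of j m], of "c i"] X0 by auto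
  next
    case False
    \<comment> \<open>If entry \<open>s\<close> has been replaced, \<open>b s\<close> no longer
      occurs among the parameters, and the conjugates lie in \<open>N p\<close>. The conjugate
      intersection is thus one of the groups that define the connected component over
      \<open>?B\<close>, so it contains \<open>c i\<close>.\<close>
    then obtain s where s: "s < p" "u ! s \<noteq> None"
      using u by (metis length_replicate nth_equalityI nth_replicate)
    let ?B = "N p \<union> (\<Union>j\<in>{..<p} - {s}. set (b j))"
    let ?K = "{x \<in> carrier G. \<forall>m. x \<in> ?X m (u @ [Some j])}"
    interpret approx_chain G "\<lambda>m. ?X m (u @ [Some j])"
      by (rule chain'[OF u])
    have params_B: "set (params (u @ [Some j])) \<subseteq> ?B"
    proof -
      have "set (entry r ((u @ [Some j]) ! r)) \<subseteq> ?B" if "r < p" for r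
        using s u that B_N[OF that] by (auto simp: entry_def nth_append split: option.splits)
      then show ?thesis
        by (fastforce simp: params_def)
    qed
    have "?X m (u @ [Some j]) \<in> Def L M ?B k" for m
    proof (rule DefI[of "params (u @ [Some j]) @ d j m" _ "\<psi> j m"])
      show "set (params (u @ [Some j]) @ d j m) \<subseteq> ?B"
        using params_B \<psi>(2)[of j m] D(2) by auto
      show "\<psi> j m \<in> formulas L (k + length (params (u @ [Some j]) @ d j m))"
        using \<psi>(1)[of j m] by (simp add: length_params add.assoc)
    qed (use u in \<open>simp add: fiber_def nth_append\<close>)
    then have "range (\<lambda>m. ?X m (u @ [Some j])) \<subseteq> Def L M ?B k"
      by blast
    then have "type_definable L M k ?B (U k \<inter> (\<Inter>m. ?X m (u @ [Some j])))"
      unfolding type_definable_iff by blast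
    moreover have "A \<subseteq> ?B"
      using A_N N_mono[of 0 p] by auto
    then have "type_definable L M k ?B (carrier G)"
      using type_definable_mono carrier_type_definable by blast
    ultimately have "type_definable L M k ?B (carrier G \<inter> (U k \<inter> (\<Inter>m. ?X m (u @ [Some j]))))"
      by - (rule type_definable_Int)
    moreover have "carrier G \<inter> (U k \<inter> (\<Inter>m. ?X m (u @ [Some j]))) = ?K"
      using carrier_subset by blast
    ultimately have "G00 L \<kappa> M k G ?B \<subseteq> ?K"
      using subgroup_Inter bounded[OF u, of j] unfolding G00_def by auto
    then show ?thesis
      using c(1)[of i] s(1) unfolding common_00_def by blast
  qed
  interpret coset_array G p ?X q "\<lambda>r i. map (shift r i)" c
  proof (intro coset_array.intro coset_array_axioms.intro)
    show "group G"
      by (rule is_group)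
    show "approx_chain G (\<lambda>m. ?X m (u @ [Some j]))" if "length u = p" for u j
      by (rule chain'[OF that])
    show "group.thick G (q m) (?X m (u @ [Some j]))" if "length u = p" for u m j
      by (rule thick'[OF that])
    show "map (shift r i) x \<in> carrier G" if "r < p" "x \<in> carrier G" for r i x
      using automorphism_carrier(2)[OF shift(1)[OF that(1)] shift_A[OF that(1)] that(2)] .
    show "map (shift r i) x \<in> ?X m (u @ Some i # map Some w) \<longleftrightarrow> x \<in> ?X m (u @ None # map Some w)"
      if "r < p" "x \<in> carrier G" "length u = r" "length w = p - r" for r i x u w m
    proof (rule automorphism_fiber[OF shift(1)[OF that(1)] shift_D[OF that(1)] shift_params_None[OF that(1,3,4)] _ \<psi>])
      show "(u @ None # map Some w) ! p = (u @ Some i # map Some w) ! p"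
        using that by (simp add: nth_append nth_Cons')
      show "x \<in> U k"
        using that(2) carrier_subset by blast
    qed
    show "map (shift r i) x \<in> ?X m (u @ Some j # map Some w) \<longleftrightarrow> x \<in> ?X m (u @ Some j # map Some w)"
      if "r < p" "x \<in> carrier G" "length u = r" "length w = p - r" "j < i" for r i x u w j m
    proof (rule automorphism_fiber[OF shift(1)[OF that(1)] shift_D[OF that(1)] shift_params_Some[OF that(1,3-5)] refl \<psi>])
      show "x \<in> U k"
        using that(2) carrier_subset by blast
    qed
    show "c i \<in> carrier G" for i
      by (rule cG)
    show "c i \<in> ?X m (u @ [Some j])" if "length u = p" "u \<noteq> replicate p None \<or> j < i" for u i j m
      by (rule c_mem[OF that])
    show "c i \<notin> ?X 0 (replicate p None @ [Some i])" for i
      unfolding X0 Y_def by (rule c(3))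
  qed
  obtain es where es: "length es = Suc p" and pattern: "\<forall>S\<subseteq>words n (Suc p). \<exists>g\<in>carrier G. \<forall>w\<in>words n (Suc p).
     g \<in> ?X (p + 4) (select es w) \<longleftrightarrow> w \<notin> S"
    using independent_pattern[of n] by (elim exE conjE)
  \<comment> \<open>A word names a conjugate of each \<open>b j\<close> and, by its last letter, a
    group, which contributes its parameters at level \<open>p + 4\<close>: \<open>p + 1\<close>
    argument tuples in all.\<close>
  define a where "a j i = (if j < p then B j ((es ! j) i) else d ((es ! p) i) (p + 4))" for j i
  have "a j i \<in> U ((map (\<lambda>j. length (b j)) [0..<p] @ [l]) ! j)" if "j < Suc p" for j i
  proof (cases "j < p")
    case True
    then show ?thesis
      using B_tuples[OF True, of "(es ! j) i"] N_universe[of "Suc j"] by (auto simp: a_def nth_append tuples_def)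
  next
    case False
    then have "j = p" using that by simp
    then show ?thesis
      using uniform(2) \<psi>(2)[of "(es ! p) i" "p + 4"] D(2) N_universe[of p] by (auto simp: a_def nth_append tuples_def)
  qed
  moreover have "\<exists>x\<in>U k. \<forall>w\<in>words n (Suc p). holds M \<phi> (x @ concat (map (\<lambda>j. a j (w ! j)) [0..<Suc p])) \<longleftrightarrow> w \<in> S"
    if "S \<subseteq> words n (Suc p)" for S
  proof -
    \<comment> \<open>\<open>independent_pattern\<close> prescribes where \<open>g\<close> fails,
      hence the complement of \<open>S\<close>.\<close>
    obtain g where g: "g \<in> carrier G" "\<forall>w\<in>words n (Suc p). g \<in> ?X (p + 4) (select es w) \<longleftrightarrow> w \<notin> words n (Suc p) - S"
      using pattern[THEN spec, of "words n (Suc p) - S"] by blast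
    have gU: "g \<in> U k"
      using g(1) carrier_subset by blast
    have "g \<in> ?X (p + 4) (select es w) \<longleftrightarrow> holds M \<phi> (g @ concat (map (\<lambda>j. a j (w ! j)) [0..<Suc p]))"
      if w: "w \<in> words n (Suc p)" for w
    proof -
      have len: "length w = Suc p"
        using w by (simp add: words_def)
      have sel: "select es w ! j = Some ((es ! j) (w ! j))" if "j < Suc p" for j
        using that len es by (simp add: select_def)
      have "params (select es w) = concat (map (\<lambda>j. a j (w ! j)) [0..<p])"
        unfolding params_def using sel by (intro arg_cong[of _ _ concat] map_cong) (auto simp: entry_def a_def)
      moreover have "d (the (select es w ! p)) (p + 4) = a p (w ! p)"
        using sel[of p] by (simp add: a_def)
      ultimately have "params (select es w) @ d (the (select es w ! p)) (p + 4) = concat (map (\<lambda>j. a j (w ! j)) [0..<Suc p])"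
        by simp
      then show ?thesis
        using gU uniform(1) by (simp add: fiber_def)
    qed
    then show ?thesis
      using g(2) gU by (intro bexI[OF _ gU]) auto
  qed
  ultimately show ?thesis
    by (intro exI[of _ a]) blast
qed

end

section \<open>Small subfamilies\<close>

primrec ex_closure :: "nat \<Rightarrow> ('f, 'r) fm \<Rightarrow> ('f, 'r) fm" where
  "ex_closure 0 \<phi> = \<phi>"
| "ex_closure (Suc m) \<phi> = ex_closure m (Exists m \<phi>)"

lemma ex_closure_sentence: "\<phi> \<in> formulas L m \<Longrightarrow> ex_closure m \<phi> \<in> sentences L"
proof (induction m arbitrary: \<phi>)
  case (Suc m)
  then have "Exists m \<phi> \<in> formulas L m"
    by (auto simp: formulas_def less_Suc_eq)
  then show ?case
    using Suc.IH by simp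
qed simp

lemma ex_closure_inject: "ex_closure m \<phi> = ex_closure m \<psi> \<longleftrightarrow> \<phi> = \<psi>"
  by (induction m arbitrary: \<phi> \<psi>) auto

lemma ex_closure_Suc_eq_Exists: "\<exists>\<psi>. ex_closure (Suc m) \<phi> = Exists 0 \<psi>"
  by (induction m arbitrary: \<phi>) auto

text \<open>Even without symbols there are infinitely many sentences, since renaming a bound
  variable gives a different one; each or its negation lies in \<open>T\<close>.\<close>

lemma complete_theory_infinite:
  assumes "complete_theory L T"
  shows "infinite T"
proof -
  define \<sigma> :: "nat \<Rightarrow> ('a, 'b) fm" where "\<sigma> i = Exists i (Eq (Var i) (Var i))" for i
  have "\<sigma> i \<in> sentences L" for i
    by (simp add: \<sigma>_def formulas_def)
  then have "\<sigma> i \<in> T \<or> Neg (\<sigma> i) \<in> T" for i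
    using assms by (simp add: complete_theory_def)
  then have "range (\<lambda>i. if \<sigma> i \<in> T then \<sigma> i else Neg (\<sigma> i)) \<subseteq> T"
    by auto
  moreover have "inj (\<lambda>i. if \<sigma> i \<in> T then \<sigma> i else Neg (\<sigma> i))"
    by (auto simp: inj_def \<sigma>_def split: if_splits)
  ultimately show ?thesis
    using finite_imageD finite_subset infinite_UNIV_nat by blast
qed

text \<open>\<open>T\<close> decides every sentence, so it suffices to turn formulas injectively
  into sentences such that no resulting sentence is the negation of another.\<close>

lemma formulas_inject_theory:
  assumes "complete_theory L T"
  obtains f where "inj_on f (formulas L m)" "f ` formulas L m \<subseteq> T"
proof
  \<comment> \<open>\<open>Suc m\<close> guarantees a leading \<open>Exists\<close>, also for
    \<open>m = 0\<close>, and so separates closures from negations.\<close>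
  let ?c = "ex_closure (Suc m)"
  let ?f = "\<lambda>\<phi>. if ?c \<phi> \<in> T then ?c \<phi> else Neg (?c \<phi>)"
  have "?c \<phi> \<in> sentences L" if "\<phi> \<in> formulas L m" for \<phi>
    using formulas_mono[of m "Suc m" L] that by (intro ex_closure_sentence) auto
  then have "?c \<phi> \<in> T \<or> Neg (?c \<phi>) \<in> T" if "\<phi> \<in> formulas L m" for \<phi>
    using assms that unfolding complete_theory_def by blast
  then show "?f ` formulas L m \<subseteq> T"
    by auto
  have "?c \<phi> \<noteq> Neg (?c \<psi>)" for \<phi> \<psi>
    using ex_closure_Suc_eq_Exists[of m \<phi>] by (auto simp del: ex_closure.simps)
  then show "inj_on ?f (formulas L m)"
    using ex_closure_inject[of "Suc m"] unfolding inj_on_def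
    by (metis fm.inject(3))
qed

text \<open>A triple is coded by a subset of a set of size \<open>|T|\<close>, which gives at most
  \<open>two_power |T|\<close> of them.\<close>

lemma card_of_templates:
  fixes q :: "nat \<Rightarrow> nat"
  assumes "complete_theory L T"
  shows "|{(l, \<phi>, q :: nat \<Rightarrow> nat). \<phi> \<in> formulas L (m + l)}| \<le>o beth2 ( |T| +c r)"
proof -
  let ?X = "(UNIV :: (nat \<times> nat + nat) set) <+> T" and ?Tm = "{(l, \<phi>, q :: nat \<Rightarrow> nat). \<phi> \<in> formulas L (m + l)}"
  have inf: "infinite T"
    by (rule complete_theory_infinite[OF assms])
  have "\<exists>f. inj_on f (formulas L (m + l)) \<and> f ` formulas L (m + l) \<subseteq> T" for l
    using formulas_inject_theory[OF assms] by metis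
  then obtain f where f: "\<And>l. inj_on (f l) (formulas L (m + l))" "\<And>l. f l ` formulas L (m + l) \<subseteq> T"
    by metis
  \<comment> \<open>The code consists of the number \<open>l\<close>, the image of
    \<open>\<phi>\<close> in \<open>T\<close> and the graph of \<open>q\<close>. The injection into
    \<open>T\<close> depends on \<open>l\<close>, which therefore has to be part of the
    code.\<close>
  define e where "e = (\<lambda>(l, \<phi>, q). insert (Inl (Inr l)) (insert (Inr (f l \<phi>)) (range (\<lambda>i :: nat. Inl (Inl (i, q i :: nat))))))"
  have "inj_on e ?Tm"
  proof (rule inj_onI)
    fix x y assume xy: "x \<in> ?Tm" "y \<in> ?Tm" "e x = e y"
    obtain l \<phi> q l' \<phi>' q' where x: "x = (l, \<phi>, q)" and y: "y = (l', \<phi>', q')"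
      by (metis prod_cases3)
    have \<phi>: "\<phi> \<in> formulas L (m + l)" "\<phi>' \<in> formulas L (m + l')" and eq: "e (l, \<phi>, q) = e (l', \<phi>', q')"
      using xy by (simp_all add: x y)
    have "Inl (Inr l) \<in> e (l', \<phi>', q')"
      unfolding eq[symmetric] by (simp add: e_def)
    then have l: "l = l'"
      by (auto simp: e_def)
    have "Inr (f l \<phi>) \<in> e (l', \<phi>', q')"
      unfolding eq[symmetric] by (simp add: e_def)
    then have "f l \<phi> = f l \<phi>'"
      by (auto simp: e_def l)
    then have "\<phi> = \<phi>'"
      using f(1)[of l] \<phi> by (simp add: inj_on_def l)
    moreover have "Inl (Inl (i, q i)) \<in> e (l', \<phi>', q')" for i
      unfolding eq[symmetric] by (simp add: e_def)
    then have "q i = q' i" for i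
      by (auto simp: e_def)
    ultimately show "x = y"
      using l by (auto simp: x y)
  qed
  moreover have "e ` ?Tm \<subseteq> Pow ?X"
    using f(2) by (auto simp: e_def)
  ultimately have Tm: "|?Tm| \<le>o |Pow ?X|"
    using card_of_ordLeq by blast
  have Pow: "|Pow ?X| \<le>o two_power |?X|"
    using card_of_Pow_Func[of ?X] unfolding cexp_def ctwo_def Field_card_of by (rule ordIso_imp_ordLeq)
  have "|?X| \<le>o |T|"
    using card_of_Plus_infinite2[OF inf countable_card_of_ordLeq[OF countableI_type inf]] ordIso_imp_ordLeq by blast
  moreover have "|T| \<le>o |T| +c r"
    by (rule ordLeq_csum1[OF card_of_Card_order])
  ultimately have "|?X| \<le>o |T| +c r"
    using ordLeq_transitive by blast
  moreover have "Cnotzero |?X|"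
    by (simp add: card_of_Card_order card_of_ordIso_czero_iff_empty)
  ultimately have "two_power |?X| \<le>o two_power ( |T| +c r)"
    by (intro cexp_mono2_Cnotzero Card_order_ctwo)
  also have "two_power ( |T| +c r) \<le>o beth2 ( |T| +c r)"
    by (intro ordLess_imp_ordLeq ordLess_ctwo_cexp Card_order_cexp)
  finally show ?thesis
    by (rule ordLeq_transitive[OF Tm ordLeq_transitive[OF Pow]])
qed

lemma Cinfinite_beth2: "Cinfinite r \<Longrightarrow> Cinfinite (beth2 r)"
  by (intro Cinfinite_cexp ordLeq_refl Card_order_ctwo)

section \<open>Finitely many groups for each formula and bound function\<close>

context generic_group
begin

text \<open>A definable superset of \<open>H\<close> that omits \<open>c\<close> starts the chain of
  \<open>definable_chain\<close>, and \<open>Def_unfiber\<close> brings the tuples \<open>b\<close>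
  into one block.\<close>

lemma subgroup_chain_exists:
  assumes H: "subgroup H G" "bounded_index \<kappa> G H" "type_definable L M k (N p \<union> (\<Union>j<p. set (b j))) H"
    and c: "c \<in> carrier G" "c \<notin> H"
  shows "\<exists>\<psi> d q. subgroup_chain H \<psi> d q \<and> c \<notin> slice (\<psi> 0) (d 0)"
proof -
  let ?bb = "concat (map b [0..<p])"
  let ?B = "N p \<union> set ?bb"
  have B: "A \<subseteq> ?B" "?B \<subseteq> universe M" "|?B| <o \<kappa>"
  proof -
    show "A \<subseteq> ?B"
      using A_N N_mono[of 0 p] by auto
    show "?B \<subseteq> universe M"
      using N_universe[of p] b_universe by fastforce
    show "|?B| <o \<kappa>"
      by (rule Un_Cinfinite_bound_strict[OF N_top(2) finite_card_of_ordLess[OF _ regular(1)] regular(1)]) simp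
  qed
  have Hdef: "type_definable L M k ?B H"
    using H(3) by (simp add: lessThan_atLeast0)
  have "c \<in> U k"
    using c(1) carrier_subset by blast
  then obtain X0 where X0: "X0 \<in> Def L M ?B k" "H \<subseteq> X0" "c \<notin> X0"
    using type_definable_supersets[OF Hdef] c(2) by blast
  obtain X q where X: "X 0 = X0" "\<forall>m. X m \<in> Def L M ?B k \<and> H \<subseteq> X m" "approx_chain G X"
    "\<forall>m. thick (q m) (X m)"
    using definable_chain[OF B H(1) Hdef H(2) X0(1,2)] by (elim exE conjE)
  have "\<forall>m. \<exists>y. set (snd y) \<subseteq> N p \<and> fst y \<in> formulas L (k + length ?bb + length (snd y)) \<and> X m = slice (fst y) (snd y)"
  proof
    fix m
    obtain \<phi> d where "set d \<subseteq> N p" "\<phi> \<in> formulas L (k + length ?bb + length d)"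
        "X m = {x \<in> U k. holds M \<phi> (x @ ?bb @ d)}"
      using Def_unfiber[of "X m" L M "N p" ?bb k] X(2) by blast
    then show "\<exists>y. set (snd y) \<subseteq> N p \<and> fst y \<in> formulas L (k + length ?bb + length (snd y)) \<and> X m = slice (fst y) (snd y)"
      by (intro exI[of _ "(\<phi>, d)"]) (simp add: slice_def)
  qed
  from choice[OF this] obtain y where y: "\<forall>m. set (snd (y m)) \<subseteq> N p \<and>
      fst (y m) \<in> formulas L (k + length ?bb + length (snd (y m))) \<and> X m = slice (fst (y m)) (snd (y m))"
    by (elim exE)
  have X_eq: "X = (\<lambda>m. slice (fst (y m)) (snd (y m)))"
    using y by auto
  have "subgroup_chain H (\<lambda>m. fst (y m)) (\<lambda>m. snd (y m)) q"
    unfolding subgroup_chain_def using X(2-4) y unfolding X_eq by simp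
  moreover have "c \<notin> slice (fst (y 0)) (snd (y 0))"
    using X(1) X0(3) y by metis
  ultimately show ?thesis
    by (intro exI[of _ "\<lambda>m. fst (y m)"] exI[of _ "\<lambda>m. snd (y m)"] exI[of _ q]) simp
qed

lemma no_descending_sequence:
  fixes H :: "nat \<Rightarrow> 'a list set" and \<psi> :: "nat \<Rightarrow> nat \<Rightarrow> ('f, 'r) fm"
    and d :: "nat \<Rightarrow> nat \<Rightarrow> 'a list" and c :: "nat \<Rightarrow> 'a list"
  assumes T: "model L T M" "n_dependent TYPE('a) L T (Suc p)" and omega: "natLeq <o \<kappa>"
    and \<psi>: "\<And>i. subgroup_chain (H i) (\<psi> i) (d i) q" and H: "\<And>i. subgroup (H i) G" "\<And>i. bounded_index \<kappa> G (H i)"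
    and uniform: "\<And>i. \<psi> i (p + 4) = \<phi>" "\<And>i. length (d i (p + 4)) = l"
    and c: "\<And>i. c i \<in> common_00" "\<And>i j. j < i \<Longrightarrow> c i \<in> H j" "\<And>i. c i \<notin> slice (\<psi> i 0) (d i 0)"
  shows False
proof -
  let ?bb = "concat (map b [0..<p])"
  \<comment> \<open>Countably many chains with countably many finite tuples of parameters each:
    \<open>D\<close> is countable, as \<open>coheir_array\<close> requires.\<close>
  define D where "D = (\<Union>i. \<Union>m. set (d i m))"
  have D: "countable D" "D \<subseteq> N p"
  proof -
    show "countable D"
      unfolding D_def by (intro countable_UN) (auto intro: countable_finite)
    show "D \<subseteq> N p"
      using \<psi> unfolding D_def subgroup_chain_def by blast
  qed
  obtain B where B: "\<And>r i. r < p \<Longrightarrow> B r i \<in> tuples (N (Suc r)) (length (b r)) \<and>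
      tp L M (B r i) (base D B r i) = tp L M (b r) (base D B r i)"
    using coheir_array[OF D] by blast
  interpret generic_array G L \<kappa> M k A p N \<mu> b D B
    by unfold_locales (use D B in auto)
  \<comment> \<open>The lengths of the \<open>p + 1\<close> argument tuples: the conjugates of the
    \<open>b j\<close>, then the remaining parameters of the formula at level
    \<open>p + 4\<close>.\<close>
  let ?q = "map (\<lambda>j. length (b j)) [0..<p] @ [l]"
  have "\<exists>a. (\<forall>j<Suc p. \<forall>i<n. a j i \<in> U (?q ! j)) \<and>
    (\<forall>S\<subseteq>words n (Suc p). \<exists>x\<in>U k. \<forall>w\<in>words n (Suc p).
      holds M \<phi> (x @ concat (map (\<lambda>j. a j (w ! j)) [0..<Suc p])) \<longleftrightarrow> w \<in> S)" for n
  proof (rule finite_patterns[OF \<psi> _ H c uniform])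
    show "set (d j m) \<subseteq> D" for j m
      unfolding D_def by blast
  qed
  then have fin: "\<exists>a. (\<forall>j<length ?q. \<forall>i<n. a j i \<in> U (?q ! j)) \<and>
      (\<forall>S\<subseteq>words n (length ?q). \<exists>x\<in>U k. \<forall>w\<in>words n (length ?q).
        holds M \<phi> (x @ concat (map (\<lambda>j. a j (w ! j)) [0..<length ?q])) \<longleftrightarrow> w \<in> S)" for n
    by simp
  have "sum_list ?q = length ?bb + l"
    by (simp add: length_concat comp_def)
  then have \<phi>: "\<phi> \<in> formulas L (k + sum_list ?q)"
    using \<psi>[of 0] uniform(1)[of 0] uniform(2)[of 0] unfolding subgroup_chain_def by (metis add.assoc)
  have small: "|C| <o \<kappa>" if "countable C" for C :: "'a set"
  proof -
    have "|C| \<le>o |UNIV :: nat set|"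
      using that by (rule countable_card_of_ordLeq) simp
    then have "|C| \<le>o natLeq"
      using card_of_nat ordLeq_ordIso_trans by blast
    then show ?thesis
      using omega ordLeq_ordLess_trans by blast
  qed
  have "has_IP TYPE('a) L T \<phi> k ?q"
    by (rule has_IP_of_finite_patterns[OF T(1) saturated small \<phi> fin])
  then show False
    using T(2) \<phi> unfolding n_dependent_def by (metis length_append_singleton length_map length_upt diff_zero)
qed

text \<open>If no finite \<open>F0\<close> sufficed, each finite stage would leave an element and a
  chain for the next one, and dependent choice would build the sequence that
  \<open>no_descending_sequence\<close> excludes. \<open>F\<close> consists of triples because one
  group may have many chains, depending on the element that is to be omitted.\<close>

lemma finite_subfamily:
  fixes F :: "('a list set \<times> (nat \<Rightarrow> ('f, 'r) fm) \<times> (nat \<Rightarrow> 'a list)) set" and q :: "nat \<Rightarrow> nat"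
  assumes T: "model L T M" "n_dependent TYPE('a) L T (Suc p)" and omega: "natLeq <o \<kappa>"
    and F: "\<And>H \<psi> d. (H, \<psi>, d) \<in> F \<Longrightarrow> subgroup_chain H \<psi> d q \<and> subgroup H G \<and> bounded_index \<kappa> G H \<and>
      \<psi> (p + 4) = \<phi> \<and> length (d (p + 4)) = l"
  shows "\<exists>F0\<subseteq>F. finite F0 \<and> (\<forall>c\<in>common_00. (\<forall>f\<in>F0. c \<in> fst f) \<longrightarrow>
    (\<forall>(H, \<psi>, d)\<in>F. c \<in> slice (\<psi> 0) (d 0)))"
proof (rule ccontr)
  assume contra: "\<not> ?thesis"
  have ex: "\<exists>H \<psi> d c. (H, \<psi>, d) \<in> F \<and> c \<in> common_00 \<and> (\<forall>f\<in>F0. c \<in> fst f) \<and> c \<notin> slice (\<psi> 0) (d 0)"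
    if F0: "F0 \<subseteq> F" "finite F0" for F0
  proof (rule ccontr)
    assume "\<not> ?thesis"
    then have "\<forall>c\<in>common_00. (\<forall>f\<in>F0. c \<in> fst f) \<longrightarrow> (\<forall>(H, \<psi>, d)\<in>F. c \<in> slice (\<psi> 0) (d 0))"
      by blast
    then show False
      using contra F0 by blast
  qed
  let ?P = "\<lambda>s (i :: nat) (f, c). f \<in> F \<and> c \<in> common_00 \<and> (\<forall>j<i. c \<in> fst (fst (s j))) \<and>
    c \<notin> slice (fst (snd f) 0) (snd (snd f) 0)"
  have "\<exists>s. \<forall>i. ?P s i (s i)"
  proof (rule dependent_wf_choice[of less_than ?P])
    fix s t :: "nat \<Rightarrow> ('a list set \<times> (nat \<Rightarrow> ('f, 'r) fm) \<times> (nat \<Rightarrow> 'a list)) \<times> 'a list" and i y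
    assume "\<And>j. (j, i) \<in> less_than \<Longrightarrow> s j = t j"
    then show "?P s i y = ?P t i y"
      by (simp add: split_beta)
  next
    fix i and s :: "nat \<Rightarrow> ('a list set \<times> (nat \<Rightarrow> ('f, 'r) fm) \<times> (nat \<Rightarrow> 'a list)) \<times> 'a list"
    assume IH: "\<And>j. (j, i) \<in> less_than \<Longrightarrow> ?P s j (s j)"
    have "(\<lambda>j. fst (s j)) ` {..<i} \<subseteq> F"
      using IH by (auto simp: split_beta)
    then obtain H \<psi> d c where "(H, \<psi>, d) \<in> F" "c \<in> common_00" "\<forall>f\<in>(\<lambda>j. fst (s j)) ` {..<i}. c \<in> fst f"
        "c \<notin> slice (\<psi> 0) (d 0)"
      using ex[of "(\<lambda>j. fst (s j)) ` {..<i}"] by blast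
    then show "\<exists>y. ?P s i y"
      by (intro exI[of _ "((H, \<psi>, d), c)"]) auto
  qed simp
  then obtain s where s: "\<forall>i. ?P s i (s i)"
    by (elim exE)
  define H where "H i = fst (fst (s i))" for i
  define \<psi> where "\<psi> i = fst (snd (fst (s i)))" for i
  define d where "d i = snd (snd (fst (s i)))" for i
  have mem: "(H i, \<psi> i, d i) \<in> F" for i
    using s[rule_format, of i] by (simp add: H_def \<psi>_def d_def split_beta)
  show False
  proof (rule no_descending_sequence[OF T omega, of H \<psi> d q \<phi> l "\<lambda>i. snd (s i)"])
    show "snd (s i) \<in> common_00" "snd (s i) \<notin> slice (\<psi> i 0) (d i 0)" for i
      using s[rule_format, of i] by (simp_all add: \<psi>_def d_def split_beta)
    show "snd (s i) \<in> H j" if "j < i" for i j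
      using s[rule_format, of i] that by (simp add: H_def split_beta)
  qed (use F[OF mem] in simp_all)
qed

text \<open>Each template contributes a finite subfamily, and \<open>J\<close> is the union of
  these. If \<open>c\<close> lies outside some \<open>H \<alpha>\<close>, the template of a chain of
  \<open>H \<alpha>\<close> that omits \<open>c\<close> already contributes a group omitting
  \<open>c\<close>.\<close>

lemma small_subfamily:
  fixes H :: "'i \<Rightarrow> 'a list set"
  assumes T: "model L T M" "n_dependent TYPE('a) L T (Suc p)" "complete_theory L T" and omega: "natLeq <o \<kappa>"
    and H: "\<And>\<alpha>. \<alpha> \<in> I \<Longrightarrow> subgroup (H \<alpha>) G" "\<And>\<alpha>. \<alpha> \<in> I \<Longrightarrow> bounded_index \<kappa> G (H \<alpha>)"
      "\<And>\<alpha>. \<alpha> \<in> I \<Longrightarrow> type_definable L M k (N p \<union> (\<Union>j<p. set (b j))) (H \<alpha>)"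
  shows "\<exists>J\<subseteq>I. |J| \<le>o beth2 ( |T| +c |A| ) \<and> (\<forall>c\<in>common_00. (\<forall>\<alpha>\<in>J. c \<in> H \<alpha>) \<longrightarrow> (\<forall>\<alpha>\<in>I. c \<in> H \<alpha>))"
proof -
  let ?m = "k + length (concat (map b [0..<p]))"
  let ?Tm = "{(l, \<phi>, q :: nat \<Rightarrow> nat). \<phi> \<in> formulas L (?m + l)}"
  \<comment> \<open>All chains of all \<open>H \<alpha>\<close> are collected, not one chain per
    group, since the chain needed at the end depends on \<open>c\<close>.\<close>
  define F where "F = (\<lambda>(l, \<phi>, q). {(H \<alpha>, \<psi>, d) | \<alpha> \<psi> d. \<alpha> \<in> I \<and> subgroup_chain (H \<alpha>) \<psi> d q \<and>
    \<psi> (p + 4) = \<phi> \<and> length (d (p + 4)) = l})"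
  let ?suffices = "\<lambda>\<tau> J0. J0 \<subseteq> I \<and> finite J0 \<and> (\<forall>c\<in>common_00. (\<forall>\<alpha>\<in>J0. c \<in> H \<alpha>) \<longrightarrow>
    (\<forall>(K, \<psi>, d)\<in>F \<tau>. c \<in> slice (\<psi> 0) (d 0)))"
  have "\<forall>\<tau>. \<exists>J0. ?suffices \<tau> J0"
  proof
    fix \<tau> :: "nat \<times> ('f, 'r) fm \<times> (nat \<Rightarrow> nat)"
    obtain l \<phi> q where \<tau>: "\<tau> = (l, \<phi>, q)"
      by (cases \<tau>) auto
    have F\<tau>: "subgroup_chain K \<psi> d q \<and> subgroup K G \<and> bounded_index \<kappa> G K \<and>
        \<psi> (p + 4) = \<phi> \<and> length (d (p + 4)) = l" if "(K, \<psi>, d) \<in> F \<tau>" for K \<psi> d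
      using that H(1,2) by (auto simp: F_def \<tau>)
    have "\<exists>F0\<subseteq>F \<tau>. finite F0 \<and> (\<forall>c\<in>common_00. (\<forall>f\<in>F0. c \<in> fst f) \<longrightarrow>
        (\<forall>(K, \<psi>, d)\<in>F \<tau>. c \<in> slice (\<psi> 0) (d 0)))"
      by (rule finite_subfamily[OF T(1,2) omega]) (rule F\<tau>)
    then obtain F0 where F0: "F0 \<subseteq> F \<tau>" "finite F0" "\<forall>c\<in>common_00. (\<forall>f\<in>F0. c \<in> fst f) \<longrightarrow>
        (\<forall>(K, \<psi>, d)\<in>F \<tau>. c \<in> slice (\<psi> 0) (d 0))"
      by (elim exE conjE)
    have "fst ` F0 \<subseteq> H ` I"
      using F0(1) by (auto simp: F_def \<tau>)
    then obtain J0 where J0: "J0 \<subseteq> I" "finite J0" "fst ` F0 = H ` J0"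
      using F0(2) by (meson finite_imageI finite_subset_image)
    have "\<forall>f\<in>F0. c \<in> fst f" if "\<forall>\<alpha>\<in>J0. c \<in> H \<alpha>" for c
    proof -
      have "\<forall>K\<in>H ` J0. c \<in> K"
        using that by blast
      then show ?thesis
        unfolding J0(3)[symmetric] by simp
    qed
    then show "\<exists>J0. ?suffices \<tau> J0"
      using F0(3) J0(1,2) by (intro exI[of _ J0] conjI ballI impI) simp_all
  qed
  from choice[OF this] obtain J0 where J0: "\<forall>\<tau>. ?suffices \<tau> (J0 \<tau>)"
    by (elim exE)
  let ?J = "\<Union>\<tau>\<in>?Tm. J0 \<tau>"
  have "Cinfinite |T|"
    using complete_theory_infinite[OF T(3)] by (simp add: cinfinite_def Field_card_of card_of_card_order_on)
  then have inf: "Cinfinite (beth2 ( |T| +c |A| ))"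
    by (intro Cinfinite_beth2 Cinfinite_csum1)
  have J_small: "|?J| \<le>o beth2 ( |T| +c |A| )"
  proof (rule UNION_Cinfinite_bound[OF card_of_templates[OF T(3)] _ inf])
    show "\<forall>\<tau>\<in>?Tm. |J0 \<tau>| \<le>o beth2 ( |T| +c |A| )"
      using J0 inf by (auto intro!: ordLess_imp_ordLeq finite_card_of_ordLess)
  qed
  have J_sub: "?J \<subseteq> I"
    using J0 by blast
  have J_all: "c \<in> H \<alpha>" if c: "c \<in> common_00" "\<forall>\<alpha>\<in>?J. c \<in> H \<alpha>" and \<alpha>: "\<alpha> \<in> I" for c \<alpha>
  proof (rule ccontr)
    assume "c \<notin> H \<alpha>"
    moreover have "c \<in> carrier G"
      using c(1) by (simp add: common_00_def)
    ultimately obtain \<psi> d q where \<psi>: "subgroup_chain (H \<alpha>) \<psi> d q" "c \<notin> slice (\<psi> 0) (d 0)"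
      using subgroup_chain_exists[OF H[OF \<alpha>]] by blast
    let ?\<tau> = "(length (d (p + 4)), \<psi> (p + 4), q)"
    have "?\<tau> \<in> ?Tm"
      using \<psi>(1) by (simp add: subgroup_chain_def)
    then have "\<forall>\<alpha>\<in>J0 ?\<tau>. c \<in> H \<alpha>"
      using c(2) by blast
    then have "\<forall>(K, \<psi>, d)\<in>F ?\<tau>. c \<in> slice (\<psi> 0) (d 0)"
      using J0 c(1) by blast
    moreover have "(H \<alpha>, \<psi>, d) \<in> F ?\<tau>"
      using \<psi>(1) \<alpha> by (auto simp: F_def)
    ultimately show False
      using \<psi>(2) by blast
  qed
  show ?thesis
    by (intro exI[of _ ?J] conjI ballI impI J_sub J_small) (rule J_all)
qed

end

theorem theorem4p9:
  fixes L :: "('f, 'r) lang" and T :: "('f, 'r) fm set"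
    and \<kappa> :: "'k rel" and M :: "('a, 'f, 'r) fo_struct"
    and n k :: nat and A Ms :: "'a set" and G :: "'a list monoid"
    and b :: "nat \<Rightarrow> 'a list" and I :: "'i set" and H :: "'i \<Rightarrow> 'a list set"
  assumes "n \<ge> 1"
    and "complete_theory L T"
    and "n_dependent TYPE('a) L T n"
    and "monster_model L T \<kappa> M"
    and "A \<subseteq> universe M" and "|A| <o \<kappa>"
    and "type_definable_group L M k A G"
    and "elem_submodel L M Ms" and "|Ms| <o \<kappa>" and "A \<subseteq> Ms"
    and "\<forall>i\<in>{1..n - 1}. set (b i) \<subseteq> universe M"
    and "generic_position TYPE('k) L M n Ms A b"
    and "\<forall>\<alpha>\<in>I. subgroup (H \<alpha>) G \<and> bounded_index \<kappa> G (H \<alpha>) \<and>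
           type_definable L M k (Ms \<union> (\<Union>j\<in>{1..n - 1}. set (b j))) (H \<alpha>)"
  shows "\<exists>J\<subseteq>I. |J| \<le>o beth2 ( |T| +c |A| ) \<and>
    carrier G \<inter> (\<Inter>\<alpha>\<in>I. H \<alpha>) \<inter>
      (\<Inter>i\<in>{1..n - 1}. G00 L \<kappa> M k G (Ms \<union> (\<Union>j\<in>{1..n - 1} - {i}. set (b j)))) =
    carrier G \<inter> (\<Inter>\<alpha>\<in>J. H \<alpha>) \<inter>
      (\<Inter>i\<in>{1..n - 1}. G00 L \<kappa> M k G (Ms \<union> (\<Union>j\<in>{1..n - 1} - {i}. set (b j))))"
proof -
  obtain p where n: "n = Suc p"
    using assms(1) by (cases n) auto
  have range_Suc: "{1..n - 1} = Suc ` {..<p}"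
    unfolding n by (auto simp: image_Suc_lessThan)
  have range_Suc_diff: "{1..n - 1} - {Suc s} = Suc ` ({..<p} - {s})" for s
    unfolding range_Suc by auto
  obtain \<mu> :: "nat \<Rightarrow> 'k rel" and N where
    \<mu>: "\<forall>i\<in>{1..n - 1}. regular_cardinal (\<mu> i)"
    and N: "\<forall>i<n - 1. elem_sub L M (N i) (N (i + 1))" "N (n - 1) = Ms" "A \<subseteq> N 0"
      "\<forall>i<n - 1. cardSuc (beth2 |N i| ) \<le>o \<mu> (i + 1)"
      "\<forall>i\<in>{1..n - 1}. coheir L M (\<mu> i) (N i) (b i) ((\<Union>j\<in>{1..<i}. set (b j)) \<union> N (n - 1))"
    using assms(12) unfolding generic_position_def by (elim exE conjE)
  have monster: "is_struct L M" "Cinfinite \<kappa>" "regularCard \<kappa>" "saturated L \<kappa> M" "homogeneous L \<kappa> M"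
      "model L T M" "natLeq <o \<kappa>"
    using assms(4) unfolding monster_model_def strongly_inaccessible_def regular_cardinal_def model_def cinfinite_def
    by auto
  interpret group G
    using assms(7) by (simp add: type_definable_group_def)
  interpret generic_group G L \<kappa> M k A p N "\<lambda>i. \<mu> (Suc i)" "\<lambda>i. b (Suc i)"
  proof unfold_locales
    show "elem_sub L M (N i) (N (Suc i))" if "i < p" for i
      using N(1) that by (simp add: n)
    show "elem_submodel L M (N p)" "|N p| <o \<kappa>"
      using assms(8,9) N(2) by (simp_all add: n)
    show "regular_cardinal (\<mu> (Suc i))" "set (b (Suc i)) \<subseteq> universe M" if "i < p" for i
      using \<mu> assms(11) that by (simp_all add: n)
    show "cardSuc (beth2 |N i| ) \<le>o \<mu> (Suc i)" if "i < p" for i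
      using N(4) that by (simp add: n)
    show "coheir L M (\<mu> (Suc i)) (N (Suc i)) (b (Suc i)) ((\<Union>j<i. set (b (Suc j))) \<union> N p)" if "i < p" for i
    proof -
      have eq: "{1..<Suc i} = Suc ` {..<i}"
        by (auto simp: image_Suc_lessThan)
      have "Suc i \<in> {1..n - 1}"
        using that by (simp add: n)
      from bspec[OF N(5) this] show ?thesis
        unfolding eq by (simp add: n)
    qed
  qed (use monster assms(5-7) N(3) in auto)
  have B_eq: "Ms \<union> (\<Union>j\<in>{1..n - 1}. set (b j)) = N p \<union> (\<Union>j<p. set (b (Suc j)))"
    using N(2) unfolding range_Suc by (simp add: n)
  have common: "carrier G \<inter> (\<Inter>i\<in>{1..n - 1}. G00 L \<kappa> M k G (Ms \<union> (\<Union>j\<in>{1..n - 1} - {i}. set (b j)))) = common_00"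
    (is "_ \<inter> ?\<Gamma> = _")
  proof -
    have "?\<Gamma> = (\<Inter>s\<in>{..<p}. G00 L \<kappa> M k G (N p \<union> (\<Union>j\<in>{..<p} - {s}. set (b (Suc j)))))"
      using N(2) unfolding range_Suc image_image
      by (simp add: n range_Suc_diff[unfolded range_Suc])
    then show ?thesis
      by (simp add: common_00_def)
  qed
  obtain J where J: "J \<subseteq> I" "|J| \<le>o beth2 ( |T| +c |A| )"
      "\<forall>c\<in>common_00. (\<forall>\<alpha>\<in>J. c \<in> H \<alpha>) \<longrightarrow> (\<forall>\<alpha>\<in>I. c \<in> H \<alpha>)"
  proof -
    have "n_dependent TYPE('a) L T (Suc p)"
      using assms(3) by (simp only: n)
    moreover have "subgroup (H \<alpha>) G" "bounded_index \<kappa> G (H \<alpha>)"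
        "type_definable L M k (N p \<union> (\<Union>j<p. set (b (Suc j)))) (H \<alpha>)" if "\<alpha> \<in> I" for \<alpha>
      using assms(13) that unfolding B_eq by blast+
    ultimately have "\<exists>J\<subseteq>I. |J| \<le>o beth2 ( |T| +c |A| ) \<and>
        (\<forall>c\<in>common_00. (\<forall>\<alpha>\<in>J. c \<in> H \<alpha>) \<longrightarrow> (\<forall>\<alpha>\<in>I. c \<in> H \<alpha>))"
      by (rule small_subfamily[OF monster(6) _ assms(2) monster(7)])
    then show thesis
      using that by blast
  qed
  show ?thesis
  proof (intro exI[of _ J] conjI J(1,2))
    show "carrier G \<inter> (\<Inter>\<alpha>\<in>I. H \<alpha>) \<inter> ?\<Gamma> = carrier G \<inter> (\<Inter>\<alpha>\<in>J. H \<alpha>) \<inter> ?\<Gamma>"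
      using J(1,3) unfolding common[symmetric] by blast
  qed
qed

end
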